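(* Let $\mathcal{M}$ and $\mathcal{M}'$ be compact, smooth, $n$-dimensional Riemannian manifolds without boundary, let $q\in(1,2)$, let $\xi\in\mathrm{Isom}(\mathcal{M},\mathcal{M}')$ be an isometry, and let $f\in\mathbf{L}^q(\mathcal{M})$. Let $G\in\mathcal{S}(\mathbb{R}^+)$ be nonnegative, decreasing and continuous on $[0,\infty)$ with $G(0)>0$ and $\lim_{x\to\infty}G(x)=0$, and assume that the covering constants satisfy $c_1c_2<2$. Define $f'=V_\xi f$, where $V_\xi f(x)=f(\xi^{-1}(x))$ for $x\in\mathcal{M}'$. Let $\overline{S}_q^m$ and $(\overline{S}_q^m)'$ be the $m$-layer $q$-nonwindowed geometric scattering transforms on $\mathcal{M}$ and on $\mathcal{M}'$ respectively, produced by the wavelets generated by $G$ on each manifold. Then for every $m\ge1$ $$(\overline{S}_q^m)'f'=\overline{S}_q^mf,$$ i.e. $(\overline{S}_q^m)'[j_1,\dots,j_m]f'=\overline{S}_q^m[j_1,\dots,j_m]f$ for all $(j_1,\dots,j_m)\in\mathbb{Z}^m$.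
   Context: The following is given for $\mathcal{M}$; the same definitions are used on $\mathcal{M}'$. Setting: $\mathcal{M}$ is a compact, smooth, $n$-dimensional Riemannian manifold without boundary contained in $\mathbb{R}^d$, $d\ge n$, with Riemannian volume measure $\mu$, geodesic distance $r$, and Laplace-Beltrami operator $\Delta$. $\mathbf{L}^q(\mathcal{M})$ is the space of $f:\mathcal{M}\to\mathbb{R}$ with $\int_{\mathcal{M}}|f|^q\,d\mu<\infty$. The eigenvalues of $-\Delta$ in increasing order are $\{\lambda_k\}_{k\in\mathbb{N}_0}$, with corresponding eigenfunctions $\{e_k\}_{k\in\mathbb{N}_0}$ forming an orthonormal basis of $\mathbf{L}^2(\mathcal{M})$, and $\hat f(k)=\int_{\mathcal{M}}f\,\overline{e_k}\,d\mu$. $\mathcal{S}(\mathbb{R}^+)$ is the space of Schwartz functions restricted to $\mathbb{R}^+$. Wavelets: for $j\in\mathbb{Z}$, $\hat\psi_j(k)=\left[|G(2^{j-1}\lambda_k)|^2-|G(2^j\lambda_k)|^2\right]^{1/2}$, and $f\ast\psi_j(x)=\sum_{k\in\mathbb{N}_0}\hat f(k)\hat\psi_j(k)e_k(x)$; equivalently $f\ast\psi_j(x)=\int_{\mathcal{M}}\big(\sum_k\hat\psi_j(k)e_k(x)\overline{e_k(y)}\big)f(y)\,d\mu(y)$, which makes sense for $f\in\mathbf{L}^q(\mathcal{M})$, $q\ge1$, when $G\in\mathcal{S}(\mathbb{R}^+)$. Scattering: $U[j]f=|f\ast\psi_j|$, $U[j_1,\dots,j_m]f=U[j_m]\cdots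 U[j_1]f$, $\overline{S}_q^m[j_1,\dots,j_m]f=\|U[j_1,\dots,j_m]f\|_{\mathbf{L}^q(\mathcal{M})}$ for $(j_1,\dots,j_m)\in\mathbb{Z}^m$; $\overline{S}_q^mf$ is the family of these numbers. Covering constants: fix a finite open cover $\{P_i\}_{1\le i\le I}$ of $\mathcal{M}$ such that for each $i$ there is a chart $(V_i,\varphi_i)$ with $\overline{P}_i\subset V_i$ and $\varphi_i(P_i)$ a ball in $\mathbb{R}^n$. Fix $\delta>0$ such that $3\delta$ is a Lebesgue number of the cover (every geodesic ball $B(x,3\delta)$ is contained in some $P_i$). Fix $c_1,c_2>0$ such that for any $x\in\mathcal{M}$ and any $P_i\supset B(x,3\delta)$, in the coordinates $\varphi_i$ (with $|\cdot|$ the Euclidean norm): $r(y,z)\le c_2|y-z|$ for all $y,z\in P_i$, and $r(y,z)\ge c_1|y-z|$ for all $y,z\in B(x,\delta)$. *)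

theory Defs
  imports "HOL-Analysis.Analysis"
begin

section \<open>Smooth maps, charts and Riemannian metrics\<close>

primrec C_k_on :: "nat \<Rightarrow> 'a::real_normed_vector set \<Rightarrow> ('a \<Rightarrow> 'b::real_normed_vector) \<Rightarrow> bool" where
  "C_k_on 0 S f \<longleftrightarrow> continuous_on S f"
| "C_k_on (Suc k) S f \<longleftrightarrow>
     (\<forall>x\<in>S. f differentiable (at x)) \<and>
     (\<forall>v. C_k_on k S (\<lambda>x. frechet_derivative f (at x) v))"

text \<open>Only meant for open \<open>S\<close> and finite-dimensional domains.\<close>

definition smooth_on :: "'a::real_normed_vector set \<Rightarrow> ('a \<Rightarrow> 'b::real_normed_vector) \<Rightarrow> bool" where
  "smooth_on S f \<longleftrightarrow> (\<forall>k. C_k_on k S f)"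

text \<open>
  The inverse of a chart, i.e. the local parametrization it induces. Charts are restricted to be
  those of the smooth structure that \<open>M\<close> inherits as a subset of the ambient space: \<open>V\<close> is
  relatively open, and the inverse of the chart is a smooth immersion.
\<close>

abbreviation chart_inv :: "'a set \<Rightarrow> ('a \<Rightarrow> 'c) \<Rightarrow> 'c \<Rightarrow> 'a" where
  "chart_inv V \<phi> \<equiv> inv_into V \<phi>"

definition smooth_chart :: "'a::euclidean_space set \<Rightarrow> 'a set \<Rightarrow> ('a \<Rightarrow> real^'n) \<Rightarrow> bool" where
  "smooth_chart M V \<phi> \<longleftrightarrow>
     openin (top_of_set M) V \<and> open (\<phi> ` V) \<and>
     homeomorphism V (\<phi> ` V) \<phi> (chart_inv V \<phi>) \<and>
     smooth_on (\<phi> ` V) (chart_inv V \<phi>) \<and>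
     (\<forall>u\<in>\<phi> ` V. inj (frechet_derivative (chart_inv V \<phi>) (at u)))"

text \<open>Boundaryless, since the images of charts are open in \<open>real^'n\<close>.\<close>

definition smooth_submanifold :: "'n::finite itself \<Rightarrow> 'a::euclidean_space set \<Rightarrow> bool" where
  "smooth_submanifold n M \<longleftrightarrow>
     (\<forall>x\<in>M. \<exists>V (\<phi> :: 'a \<Rightarrow> real^'n). smooth_chart M V \<phi> \<and> x \<in> V)"

definition smooth_map ::
    "'n::finite itself \<Rightarrow> 'a::euclidean_space set \<Rightarrow> ('a \<Rightarrow> 'b::real_normed_vector) \<Rightarrow> bool" where
  "smooth_map n M f \<longleftrightarrow>
     (\<forall>V (\<phi> :: 'a \<Rightarrow> real^'n). smooth_chart M V \<phi> \<longrightarrow> smooth_on (\<phi> ` V) (f \<circ> chart_inv V \<phi>))"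

definition tangent_space :: "'a::euclidean_space set \<Rightarrow> 'a \<Rightarrow> 'a set" where
  "tangent_space M x =
     {v. \<exists>\<gamma> \<epsilon>. 0 < \<epsilon> \<and> smooth_on {-\<epsilon><..<\<epsilon>} \<gamma> \<and> \<gamma> ` {-\<epsilon><..<\<epsilon>} \<subseteq> M \<and>
              \<gamma> 0 = x \<and> (\<gamma> has_vector_derivative v) (at (0::real))}"

text \<open>The Gram matrix of the metric in the coordinates \<open>\<phi>\<close>, at the coordinate point \<open>u\<close>.\<close>

definition metric_matrix ::
    "('a::euclidean_space \<Rightarrow> 'a \<Rightarrow> 'a \<Rightarrow> real) \<Rightarrow> 'a set \<Rightarrow> ('a \<Rightarrow> real^'n) \<Rightarrow> real^'n \<Rightarrow> real^'n^'n" where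
  "metric_matrix g V \<phi> u =
     (\<chi> i j. g (chart_inv V \<phi> u)
               (frechet_derivative (chart_inv V \<phi>) (at u) (axis i 1))
               (frechet_derivative (chart_inv V \<phi>) (at u) (axis j 1)))"

text \<open>
  The metric \<open>g\<close> need not be the one induced by the ambient inner product; \<open>g x\<close> is only
  relevant on the tangent space at \<open>x\<close>.
\<close>

definition riemannian_metric ::
    "'n::finite itself \<Rightarrow> 'a::euclidean_space set \<Rightarrow> ('a \<Rightarrow> 'a \<Rightarrow> 'a \<Rightarrow> real) \<Rightarrow> bool" where
  "riemannian_metric n M g \<longleftrightarrow>
     (\<forall>x\<in>M. \<forall>u\<in>tangent_space M x. \<forall>v\<in>tangent_space M x. \<forall>w\<in>tangent_space M x. \<forall>a b.
        g x (a *\<^sub>R u + b *\<^sub>R v) w = a * g x u w + b * g x v w) \<and>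
     (\<forall>x\<in>M. \<forall>v\<in>tangent_space M x. \<forall>w\<in>tangent_space M x. g x v w = g x w v) \<and>
     (\<forall>x\<in>M. \<forall>v\<in>tangent_space M x. v \<noteq> 0 \<longrightarrow> 0 < g x v v) \<and>
     (\<forall>V (\<phi> :: 'a \<Rightarrow> real^'n). smooth_chart M V \<phi> \<longrightarrow> smooth_on (\<phi> ` V) (metric_matrix g V \<phi>))"

definition compact_riemannian_manifold ::
    "'n::finite itself \<Rightarrow> 'a::euclidean_space set \<Rightarrow> ('a \<Rightarrow> 'a \<Rightarrow> 'a \<Rightarrow> real) \<Rightarrow> bool" where
  "compact_riemannian_manifold n M g \<longleftrightarrow>
     compact M \<and> smooth_submanifold n M \<and> riemannian_metric n M g"

section \<open>Volume measure, geodesic distance, Laplace-Beltrami operator, isometries\<close>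

text \<open>The formula below, for all charts, determines the measure uniquely.\<close>

definition riemannian_volume ::
    "'n::finite itself \<Rightarrow> 'a::euclidean_space set \<Rightarrow> ('a \<Rightarrow> 'a \<Rightarrow> 'a \<Rightarrow> real) \<Rightarrow> 'a measure \<Rightarrow> bool" where
  "riemannian_volume n M g \<mu> \<longleftrightarrow>
     sets \<mu> = sets (restrict_space borel M) \<and>
     (\<forall>V (\<phi> :: 'a \<Rightarrow> real^'n). smooth_chart M V \<phi> \<longrightarrow>
        (\<forall>A\<in>sets \<mu>. A \<subseteq> V \<longrightarrow>
           emeasure \<mu> A = (\<integral>\<^sup>+u\<in>\<phi> ` A. ennreal (sqrt (det (metric_matrix g V \<phi> u))) \<partial>lborel)))"

definition curve_length ::
    "('a::euclidean_space \<Rightarrow> 'a \<Rightarrow> 'a \<Rightarrow> real) \<Rightarrow> (real \<Rightarrow> 'a) \<Rightarrow> ennreal" where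
  "curve_length g \<gamma> =
     (\<integral>\<^sup>+t\<in>{0..1}. ennreal (sqrt (g (\<gamma> t) (vector_derivative \<gamma> (at t)) (vector_derivative \<gamma> (at t)))) \<partial>lborel)"

text \<open>The distance is infinite between different connected components.\<close>

definition geodesic_dist ::
    "'a::euclidean_space set \<Rightarrow> ('a \<Rightarrow> 'a \<Rightarrow> 'a \<Rightarrow> real) \<Rightarrow> 'a \<Rightarrow> 'a \<Rightarrow> ennreal" where
  "geodesic_dist M g x y =
     (INF \<gamma>\<in>{\<gamma>. valid_path \<gamma> \<and> path_image \<gamma> \<subseteq> M \<and> pathstart \<gamma> = x \<and> pathfinish \<gamma> = y}. curve_length g \<gamma>)"

definition geodesic_ball ::
    "'a::euclidean_space set \<Rightarrow> ('a \<Rightarrow> 'a \<Rightarrow> 'a \<Rightarrow> real) \<Rightarrow> 'a \<Rightarrow> real \<Rightarrow> 'a set" where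
  "geodesic_ball M g x \<rho> = {y\<in>M. geodesic_dist M g x y < ennreal \<rho>}"

definition partial_deriv :: "'n::finite \<Rightarrow> (real^'n \<Rightarrow> real) \<Rightarrow> real^'n \<Rightarrow> real" where
  "partial_deriv i F u = frechet_derivative F (at u) (axis i 1)"

text \<open>\<open>\<Delta>F = |g|\<^bsup>-1/2\<^esup> \<Sum>\<^sub>i \<partial>\<^sub>i (|g|\<^bsup>1/2\<^esup> \<Sum>\<^sub>j g\<^bsup>ij\<^esup> \<partial>\<^sub>j F)\<close> in the coordinates \<open>\<phi>\<close>.\<close>

definition laplace_coord ::
    "('a::euclidean_space \<Rightarrow> 'a \<Rightarrow> 'a \<Rightarrow> real) \<Rightarrow> 'a set \<Rightarrow> ('a \<Rightarrow> real^'n) \<Rightarrow> (real^'n \<Rightarrow> real) \<Rightarrow> real^'n \<Rightarrow> real" where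
  "laplace_coord g V \<phi> F u =
     (\<Sum>i\<in>UNIV. partial_deriv i
        (\<lambda>v. sqrt (det (metric_matrix g V \<phi> v)) *
             (\<Sum>j\<in>UNIV. matrix_inv (metric_matrix g V \<phi> v) $ i $ j * partial_deriv j F v)) u)
     / sqrt (det (metric_matrix g V \<phi> u))"

text \<open>\<open>f\<close> is smooth on \<open>M\<close> and \<open>\<Delta>f = h\<close> on \<open>M\<close>.\<close>

definition has_laplacian ::
    "'n::finite itself \<Rightarrow> 'a::euclidean_space set \<Rightarrow> ('a \<Rightarrow> 'a \<Rightarrow> 'a \<Rightarrow> real) \<Rightarrow> ('a \<Rightarrow> real) \<Rightarrow> ('a \<Rightarrow> real) \<Rightarrow> bool" where
  "has_laplacian n M g f h \<longleftrightarrow>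
     smooth_map n M f \<and>
     (\<forall>V (\<phi> :: 'a \<Rightarrow> real^'n). smooth_chart M V \<phi> \<longrightarrow>
        (\<forall>x\<in>V. h x = laplace_coord g V \<phi> (f \<circ> chart_inv V \<phi>) (\<phi> x)))"

text \<open>
  Diffeomorphisms pulling \<open>g'\<close> back to \<open>g\<close>. In a chart, the tangent vector \<open>D\<phi>\<^bsup>-1\<^esup> a\<close> is
  mapped by the differential of \<open>\<xi>\<close> to \<open>D(\<xi> \<circ> \<phi>\<^bsup>-1\<^esup>) a\<close>.
\<close>

definition riemannian_isometry ::
    "'n::finite itself \<Rightarrow> 'a::euclidean_space set \<Rightarrow> ('a \<Rightarrow> 'a \<Rightarrow> 'a \<Rightarrow> real) \<Rightarrow>
     'b::euclidean_space set \<Rightarrow> ('b \<Rightarrow> 'b \<Rightarrow> 'b \<Rightarrow> real) \<Rightarrow> ('a \<Rightarrow> 'b) \<Rightarrow> bool" where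
  "riemannian_isometry n M g M' g' \<xi> \<longleftrightarrow>
     bij_betw \<xi> M M' \<and> smooth_map n M \<xi> \<and> smooth_map n M' (inv_into M \<xi>) \<and>
     (\<forall>V (\<phi> :: 'a \<Rightarrow> real^'n). smooth_chart M V \<phi> \<longrightarrow>
        (\<forall>u\<in>\<phi> ` V. \<forall>a b.
           g' (\<xi> (chart_inv V \<phi> u))
              (frechet_derivative (\<xi> \<circ> chart_inv V \<phi>) (at u) a)
              (frechet_derivative (\<xi> \<circ> chart_inv V \<phi>) (at u) b)
           = g (chart_inv V \<phi> u)
              (frechet_derivative (chart_inv V \<phi>) (at u) a)
              (frechet_derivative (chart_inv V \<phi>) (at u) b)))"

definition covering_constants ::
    "'a::euclidean_space set \<Rightarrow> ('a \<Rightarrow> 'a \<Rightarrow> 'a \<Rightarrow> real) \<Rightarrow> nat \<Rightarrow> (nat \<Rightarrow> 'a set) \<Rightarrow> (nat \<Rightarrow> 'a set) \<Rightarrow>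
     (nat \<Rightarrow> 'a \<Rightarrow> real^'n) \<Rightarrow> real \<Rightarrow> real \<Rightarrow> real \<Rightarrow> bool" where
  "covering_constants M g I P V \<phi> \<delta> c\<^sub>1 c\<^sub>2 \<longleftrightarrow>
     (\<forall>i\<in>{1..I}. openin (top_of_set M) (P i) \<and> smooth_chart M (V i) (\<phi> i) \<and>
        closure (P i) \<subseteq> V i \<and> (\<exists>a \<rho>. 0 < \<rho> \<and> \<phi> i ` P i = ball a \<rho>)) \<and>
     (\<Union>i\<in>{1..I}. P i) = M \<and>
     0 < \<delta> \<and> (\<forall>x\<in>M. \<exists>i\<in>{1..I}. geodesic_ball M g x (3 * \<delta>) \<subseteq> P i) \<and>
     0 < c\<^sub>1 \<and> 0 < c\<^sub>2 \<and>
     (\<forall>x\<in>M. \<forall>i\<in>{1..I}. geodesic_ball M g x (3 * \<delta>) \<subseteq> P i \<longrightarrow>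
        (\<forall>y\<in>P i. \<forall>z\<in>P i. geodesic_dist M g y z \<le> ennreal (c\<^sub>2 * norm (\<phi> i y - \<phi> i z))) \<and>
        (\<forall>y\<in>geodesic_ball M g x \<delta>. \<forall>z\<in>geodesic_ball M g x \<delta>.
           ennreal (c\<^sub>1 * norm (\<phi> i y - \<phi> i z)) \<le> geodesic_dist M g y z))"

section \<open>Function spaces and spectral data\<close>

definition Lq_space :: "real \<Rightarrow> 'a measure \<Rightarrow> ('a \<Rightarrow> real) set" where
  "Lq_space q \<mu> = {f \<in> borel_measurable \<mu>. integrable \<mu> (\<lambda>x. \<bar>f x\<bar> powr q)}"

definition Lq_norm :: "real \<Rightarrow> 'a measure \<Rightarrow> ('a \<Rightarrow> real) \<Rightarrow> real" where
  "Lq_norm q \<mu> f = (\<integral>x. \<bar>f x\<bar> powr q \<partial>\<mu>) powr (1 / q)"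

definition orthonormal_basis_L2 :: "'a measure \<Rightarrow> (nat \<Rightarrow> 'a \<Rightarrow> real) \<Rightarrow> bool" where
  "orthonormal_basis_L2 \<mu> e \<longleftrightarrow>
     (\<forall>k. e k \<in> Lq_space 2 \<mu>) \<and>
     (\<forall>k l. (\<integral>x. e k x * e l x \<partial>\<mu>) = (if k = l then 1 else 0)) \<and>
     (\<forall>f\<in>Lq_space 2 \<mu>.
        (\<lambda>N. Lq_norm 2 \<mu> (\<lambda>x. f x - (\<Sum>k<N. (\<integral>y. f y * e k y \<partial>\<mu>) * e k x))) \<longlonglongrightarrow> 0)"

text \<open>The eigenvalues of \<open>-\<Delta>\<close>, repeated according to multiplicity, with eigenfunctions \<open>e k\<close>.\<close>

definition laplace_eigenbasis ::
    "'n::finite itself \<Rightarrow> 'a::euclidean_space set \<Rightarrow> ('a \<Rightarrow> 'a \<Rightarrow> 'a \<Rightarrow> real) \<Rightarrow> 'a measure \<Rightarrow>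
     (nat \<Rightarrow> real) \<Rightarrow> (nat \<Rightarrow> 'a \<Rightarrow> real) \<Rightarrow> bool" where
  "laplace_eigenbasis n M g \<mu> lam e \<longleftrightarrow>
     incseq lam \<and>
     (\<forall>k. has_laplacian n M g (e k) (\<lambda>x. - lam k * e k x)) \<and>
     orthonormal_basis_L2 \<mu> e"

text \<open>Restrictions to the half line \<open>[0, \<infinity>)\<close> of Schwartz functions on the real line.\<close>

definition schwartz_half_line :: "(real \<Rightarrow> real) \<Rightarrow> bool" where
  "schwartz_half_line G \<longleftrightarrow>
     (\<exists>H. (\<forall>k x. (deriv ^^ k) H field_differentiable (at x)) \<and>
          (\<forall>k m. \<exists>C. \<forall>x. \<bar>x ^ m * (deriv ^^ k) H x\<bar> \<le> C) \<and>
          (\<forall>x\<ge>0. G x = H x))"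

section \<open>Wavelets and the scattering transform\<close>

definition wavelet_coeff :: "(real \<Rightarrow> real) \<Rightarrow> (nat \<Rightarrow> real) \<Rightarrow> int \<Rightarrow> nat \<Rightarrow> real" where
  "wavelet_coeff G lam j k =
     sqrt (\<bar>G (2 powi (j - 1) * lam k)\<bar>\<^sup>2 - \<bar>G (2 powi j * lam k)\<bar>\<^sup>2)"

definition wavelet_kernel ::
    "(real \<Rightarrow> real) \<Rightarrow> (nat \<Rightarrow> real) \<Rightarrow> (nat \<Rightarrow> 'a \<Rightarrow> real) \<Rightarrow> int \<Rightarrow> 'a \<Rightarrow> 'a \<Rightarrow> real" where
  "wavelet_kernel G lam e j x y = (\<Sum>k. wavelet_coeff G lam j k * e k x * e k y)"

text \<open>
  \<open>f \<star> \<psi>\<^sub>j\<close> is given by its integral kernel, since this form applies to \<open>f \<in> L\<^sup>q\<close> for every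
  \<open>q \<ge> 1\<close>; it is the multiplier \<open>\<Sum>\<^sub>k (\<integral> f e\<^sub>k \<partial>\<mu>) \<psi>\<^sub>j(k) e\<^sub>k\<close>. The eigenfunctions are real, so
  no conjugation occurs.
\<close>

definition wavelet_conv ::
    "'a measure \<Rightarrow> (real \<Rightarrow> real) \<Rightarrow> (nat \<Rightarrow> real) \<Rightarrow> (nat \<Rightarrow> 'a \<Rightarrow> real) \<Rightarrow> int \<Rightarrow> ('a \<Rightarrow> real) \<Rightarrow> 'a \<Rightarrow> real" where
  "wavelet_conv \<mu> G lam e j f x = (\<integral>y. wavelet_kernel G lam e j x y * f y \<partial>\<mu>)"

definition scattering_step ::
    "'a measure \<Rightarrow> (real \<Rightarrow> real) \<Rightarrow> (nat \<Rightarrow> real) \<Rightarrow> (nat \<Rightarrow> 'a \<Rightarrow> real) \<Rightarrow> int \<Rightarrow> ('a \<Rightarrow> real) \<Rightarrow> 'a \<Rightarrow> real" where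
  "scattering_step \<mu> G lam e j f = (\<lambda>x. \<bar>wavelet_conv \<mu> G lam e j f x\<bar>)"

text \<open>\<open>U[j\<^sub>1, \<dots>, j\<^sub>m] f = U[j\<^sub>m] \<dots> U[j\<^sub>1] f\<close>: the head of the list is applied first.\<close>

definition scattering_propagator ::
    "'a measure \<Rightarrow> (real \<Rightarrow> real) \<Rightarrow> (nat \<Rightarrow> real) \<Rightarrow> (nat \<Rightarrow> 'a \<Rightarrow> real) \<Rightarrow> int list \<Rightarrow> ('a \<Rightarrow> real) \<Rightarrow> 'a \<Rightarrow> real" where
  "scattering_propagator \<mu> G lam e js f = fold (scattering_step \<mu> G lam e) js f"

definition nonwindowed_scattering ::
    "real \<Rightarrow> 'a measure \<Rightarrow> (real \<Rightarrow> real) \<Rightarrow> (nat \<Rightarrow> real) \<Rightarrow> (nat \<Rightarrow> 'a \<Rightarrow> real) \<Rightarrow> int list \<Rightarrow> ('a \<Rightarrow> real) \<Rightarrow> real" where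
  "nonwindowed_scattering q \<mu> G lam e js f = Lq_norm q \<mu> (scattering_propagator \<mu> G lam e js f)"

definition deform :: "'a set \<Rightarrow> ('a \<Rightarrow> 'b) \<Rightarrow> ('a \<Rightarrow> real) \<Rightarrow> 'b \<Rightarrow> real" where
  "deform M \<xi> f = (\<lambda>x. f (inv_into M \<xi> x))"

end

theory Submission
  imports Defs
begin

text \<open>
  An isometry carries charts to charts with the same Gram matrix, hence the volume measure to the
  volume measure and eigenfunctions to eigenfunctions. So it suffices to compare two eigenbases of
  one manifold. Green's formula makes eigenfunctions of different eigenvalues orthogonal, and two
  orthonormal bases of a finite-dimensional eigenspace have the same reproducing kernel; grouping
  the kernel series by eigenvalue is legitimate where the series converges absolutely. For that,
  \<open>\<Sum>\<^sub>k \<bar>\<psi>\<^sub>j(k)\<bar> < \<infinity>\<close> is enough, since then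
  \<open>\<Sum>\<^sub>k \<bar>\<psi>\<^sub>j(k)\<bar> e\<^sub>k\<^sup>2\<close> is integrable and so finite almost everywhere. As \<open>G\<close> decays faster
  than any power, only a polynomial bound on the eigenvalue counting function is needed; it follows
  from the Poincare inequality on the cells of a grid in finitely many charts, combined with
  Bessel's inequality for the cell averages.
\<close>

section \<open>Continuously differentiable functions\<close>

text \<open>The obstacle is that \<open>wavelet_kernel\<close> is a pointwise infinite sum over one
  enumeration of one eigenbasis, while the eigendata of the two manifolds are chosen independently
  of each other: inside an eigenspace any rotation is possible, and where the series diverges the
  value of the sum carries no information. So kernels are compared only for x and y in a common set
  of full measure. That is enough, because both the convolution and the norm ignore null sets, but
  it forces every later layer to be compared up to null sets as well. The counting estimate is
  stated for arbitrary finite orthonormal systems and their Dirichlet energies, with a free grid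
  parameter m. Cells of size 1/m cost a multiple of m^n, energies are divided by m^2, and choosing m
  proportional to the eigenvalue lets the energy term be absorbed into the left-hand side. Much of
  the calculus is done for C1 functions instead of smooth ones, since the cutoffs that localize
  Green's formula are squares of truncated polynomials.\<close>

definition C1_on :: "'a::real_normed_vector set \<Rightarrow> ('a \<Rightarrow> 'b::real_normed_vector) \<Rightarrow> bool" where
  "C1_on S f \<longleftrightarrow> (\<exists>f'. (\<forall>x\<in>S. (f has_derivative f' x) (at x)) \<and> (\<forall>v. continuous_on S (\<lambda>x. f' x v)))"

lemma C1_onI:
  assumes "\<And>x. x \<in> S \<Longrightarrow> (f has_derivative f' x) (at x)" "\<And>v. continuous_on S (\<lambda>x. f' x v)"
  shows "C1_on S f"
  using assms unfolding C1_on_def by blast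

lemma C1_onE:
  assumes "C1_on S f"
  obtains f' where "\<And>x. x \<in> S \<Longrightarrow> (f has_derivative f' x) (at x)" "\<And>v. continuous_on S (\<lambda>x. f' x v)"
  using assms unfolding C1_on_def by blast

lemma C1_on_has_derivative:
  "C1_on S f \<Longrightarrow> x \<in> S \<Longrightarrow> (f has_derivative frechet_derivative f (at x)) (at x)"
  unfolding C1_on_def using frechet_derivative_works differentiableI by blast

lemma C1_on_continuous_derivative:
  assumes "C1_on S f" shows "continuous_on S (\<lambda>x. frechet_derivative f (at x) v)"
proof -
  obtain f' where f': "\<And>x. x \<in> S \<Longrightarrow> (f has_derivative f' x) (at x)"
      "\<And>v. continuous_on S (\<lambda>x. f' x v)"
    using assms unfolding C1_on_def by blast
  have "frechet_derivative f (at x) = f' x" if "x \<in> S" for x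
    using frechet_derivative_at[OF f'(1)[OF that]] by simp
  then show ?thesis using f'(2)[of v] by (simp cong: continuous_on_cong)
qed

lemma C1_on_continuous_on: "C1_on S f \<Longrightarrow> continuous_on S f"
  by (meson C1_on_has_derivative has_derivative_continuous continuous_at_imp_continuous_on)

lemma C_k_on_Suc_imp_C1_on: "C_k_on (Suc 0) S f \<Longrightarrow> C1_on S f"
  by (rule C1_onI[where f' = "\<lambda>x. frechet_derivative f (at x)"]) (auto simp: frechet_derivative_works[symmetric])

lemma smooth_on_imp_C1_on: "smooth_on S f \<Longrightarrow> C1_on S f"
  unfolding smooth_on_def using C_k_on_Suc_imp_C1_on by blast

lemma smooth_on_frechet_derivative:
  "smooth_on S f \<Longrightarrow> smooth_on S (\<lambda>x. frechet_derivative f (at x) v)"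
  unfolding smooth_on_def by (metis C_k_on.simps(2))

lemma frechet_derivative_cong_open:
  assumes "open S" "x \<in> S" "\<And>y. y \<in> S \<Longrightarrow> f y = g y"
  shows "frechet_derivative f (at x) = frechet_derivative g (at x)"
proof -
  have "(f has_derivative D) (at x) \<longleftrightarrow> (g has_derivative D) (at x)" for D
    using has_derivative_transform_within_open[of f D x UNIV S g]
      has_derivative_transform_within_open[of g D x UNIV S f] assms by auto
  then show ?thesis unfolding frechet_derivative_def by simp
qed

lemma differentiable_cong_open:
  assumes "open S" "x \<in> S" "\<And>y. y \<in> S \<Longrightarrow> f y = g y" "f differentiable (at x)"
  shows "g differentiable (at x)"
  using has_derivative_transform_within_open[of f _ x UNIV S g] assms unfolding differentiable_def by auto

lemma C_k_on_cong_open: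
  assumes "open S" "\<And>y. y \<in> S \<Longrightarrow> f y = g y" "C_k_on k S f"
  shows "C_k_on k S g"
  using assms(2,3)
proof (induction k arbitrary: f g)
  case 0
  then show ?case by (simp cong: continuous_on_cong)
next
  case (Suc k)
  have "C_k_on k S (\<lambda>x. frechet_derivative g (at x) v)" for v
    using Suc.IH[of "\<lambda>x. frechet_derivative f (at x) v" "\<lambda>x. frechet_derivative g (at x) v"] Suc.prems
      frechet_derivative_cong_open[OF assms(1) _ Suc.prems(1)] by auto
  then show ?case
    using Suc.prems differentiable_cong_open[OF assms(1) _ Suc.prems(1)] by auto
qed

lemma smooth_on_cong_open:
  assumes "open S" "\<And>y. y \<in> S \<Longrightarrow> f y = g y" "smooth_on S f"
  shows "smooth_on S g"
  using assms C_k_on_cong_open unfolding smooth_on_def by blast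

lemma C1_on_cong_open:
  assumes "open S" "\<And>y. y \<in> S \<Longrightarrow> f y = g y" "C1_on S f"
  shows "C1_on S g"
proof -
  obtain f' where f': "\<And>x. x \<in> S \<Longrightarrow> (f has_derivative f' x) (at x)" "\<And>v. continuous_on S (\<lambda>x. f' x v)"
    using assms(3) by (rule C1_onE) blast
  have "(g has_derivative f' x) (at x)" if "x \<in> S" for x
    using has_derivative_transform_within_open[OF f'(1)[OF that] assms(1) that] assms(2) by auto
  then show ?thesis using f'(2) by (rule C1_onI)
qed

text \<open>Differentiating along the line yields a directional derivative of f restricted to the
  same line, so the induction hypothesis applies to that derivative. This makes the image of a
  coordinate line an admissible curve in \<open>tangent_space\<close>.\<close>

lemma C_k_on_line:
  fixes f :: "'a::real_normed_vector \<Rightarrow> 'b::real_normed_vector"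
  assumes "open S" "C_k_on k S f"
  shows "C_k_on k {t::real. u + t *\<^sub>R a \<in> S} (\<lambda>t. f (u + t *\<^sub>R a))"
  using assms(2)
proof (induction k arbitrary: f)
  case 0
  then have c: "continuous_on S f" by simp
  have "continuous_on {t. u + t *\<^sub>R a \<in> S} (\<lambda>t. f (u + t *\<^sub>R a))"
    by (rule continuous_on_compose2[OF c]) (auto intro!: continuous_intros)
  then show ?case by simp
next
  case (Suc k)
  let ?T = "{t::real. u + t *\<^sub>R a \<in> S}"
  have T: "open ?T"
    using continuous_open_vimage[of S "\<lambda>t::real. u + t *\<^sub>R a"] assms(1)
    by (simp add: vimage_def continuous_intros)
  have d: "((\<lambda>t. f (u + t *\<^sub>R a)) has_derivative (\<lambda>v. frechet_derivative f (at (u + t *\<^sub>R a)) (v *\<^sub>R a))) (at t)"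
    if "t \<in> ?T" for t
  proof -
    have "(f has_derivative frechet_derivative f (at (u + t *\<^sub>R a))) (at (u + t *\<^sub>R a))"
      using Suc.prems that by (auto simp: frechet_derivative_works[symmetric])
    moreover have "((\<lambda>t. u + t *\<^sub>R a) has_derivative (\<lambda>v. v *\<^sub>R a)) (at t)"
      by (auto intro!: derivative_eq_intros)
    ultimately show ?thesis using has_derivative_compose[where f = "\<lambda>t. u + t *\<^sub>R a" and f' = "\<lambda>v. v *\<^sub>R a" and x = t and s = UNIV] by blast
  qed
  have "C_k_on k ?T (\<lambda>t. frechet_derivative (\<lambda>t. f (u + t *\<^sub>R a)) (at t) v)" for v
  proof (rule C_k_on_cong_open[OF T])
    show "C_k_on k ?T (\<lambda>t. frechet_derivative f (at (u + t *\<^sub>R a)) (v *\<^sub>R a))"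
      using Suc.IH[of "\<lambda>x. frechet_derivative f (at x) (v *\<^sub>R a)"] Suc.prems by auto
    show "frechet_derivative f (at (u + t *\<^sub>R a)) (v *\<^sub>R a)
        = frechet_derivative (\<lambda>t. f (u + t *\<^sub>R a)) (at t) v" if "t \<in> ?T" for t
      using frechet_derivative_at[OF d[OF that]] by metis
  qed
  moreover have "\<forall>t\<in>?T. (\<lambda>t. f (u + t *\<^sub>R a)) differentiable (at t)"
    using d unfolding differentiable_def by blast
  ultimately show ?case by simp
qed

section \<open>Closure properties of C1 functions\<close>

lemma C1_on_const [intro]: "C1_on S (\<lambda>x. c)"
  by (rule C1_onI[where f' = "\<lambda>x v. 0"]) auto

lemma C1_on_bounded_linear: "bounded_linear f \<Longrightarrow> C1_on S f"
  by (rule C1_onI[where f' = "\<lambda>x. f"]) (auto intro: bounded_linear_imp_has_derivative)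

lemma C1_on_add [intro]:
  assumes "C1_on S f" "C1_on S g" shows "C1_on S (\<lambda>x. f x + g x)"
proof -
  obtain f' where f': "\<And>x. x \<in> S \<Longrightarrow> (f has_derivative f' x) (at x)" "\<And>v. continuous_on S (\<lambda>x. f' x v)"
    using assms(1) by (rule C1_onE) blast
  obtain g' where g': "\<And>x. x \<in> S \<Longrightarrow> (g has_derivative g' x) (at x)" "\<And>v. continuous_on S (\<lambda>x. g' x v)"
    using assms(2) by (rule C1_onE) blast
  show ?thesis
    by (rule C1_onI[where f' = "\<lambda>x v. f' x v + g' x v"])
      (auto intro!: derivative_eq_intros continuous_intros f' g')
qed

lemma C1_on_mult [intro]:
  fixes f g :: "_ \<Rightarrow> real"
  assumes "C1_on S f" "C1_on S g" shows "C1_on S (\<lambda>x. f x * g x)"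
proof -
  obtain f' where f': "\<And>x. x \<in> S \<Longrightarrow> (f has_derivative f' x) (at x)" "\<And>v. continuous_on S (\<lambda>x. f' x v)"
    using assms(1) by (rule C1_onE) blast
  obtain g' where g': "\<And>x. x \<in> S \<Longrightarrow> (g has_derivative g' x) (at x)" "\<And>v. continuous_on S (\<lambda>x. g' x v)"
    using assms(2) by (rule C1_onE) blast
  note [continuous_intros] = C1_on_continuous_on[OF assms(1)] C1_on_continuous_on[OF assms(2)]
  show ?thesis
    by (rule C1_onI[where f' = "\<lambda>x v. f x * g' x v + f' x v * g x"])
      (auto intro!: derivative_eq_intros continuous_intros f' g')
qed

lemma C1_on_sum [intro]: "(\<And>i. i \<in> I \<Longrightarrow> C1_on S (f i)) \<Longrightarrow> C1_on S (\<lambda>x. \<Sum>i\<in>I. f i x)"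
  by (induction I rule: infinite_finite_induct) auto

lemma C1_on_prod [intro]:
  fixes f :: "_ \<Rightarrow> _ \<Rightarrow> real"
  shows "(\<And>i. i \<in> I \<Longrightarrow> C1_on S (f i)) \<Longrightarrow> C1_on S (\<lambda>x. \<Prod>i\<in>I. f i x)"
  by (induction I rule: infinite_finite_induct) auto

lemma linear_expand:
  fixes f :: "'a::euclidean_space \<Rightarrow> 'b::real_vector"
  assumes "linear f" shows "f v = (\<Sum>b\<in>Basis. (v \<bullet> b) *\<^sub>R f b)"
  by (metis (no_types, lifting) assms euclidean_representation linear_scale linear_sum sum.cong)

text \<open>Continuity of f' is known for fixed directions only, while the chain rule feeds it the
  moving direction \<open>g' x v\<close>. Expanding that direction in a basis leaves finitely many
  fixed ones, hence the Euclidean middle space.\<close>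

lemma C1_on_compose:
  fixes g :: "'a::real_normed_vector \<Rightarrow> 'b::euclidean_space" and f :: "'b \<Rightarrow> 'c::real_normed_vector"
  assumes "C1_on T f" "C1_on S g" "g ` S \<subseteq> T" shows "C1_on S (\<lambda>x. f (g x))"
proof -
  obtain f' where f': "\<And>x. x \<in> T \<Longrightarrow> (f has_derivative f' x) (at x)" "\<And>v. continuous_on T (\<lambda>x. f' x v)"
    using assms(1) by (rule C1_onE) blast
  obtain g' where g': "\<And>x. x \<in> S \<Longrightarrow> (g has_derivative g' x) (at x)" "\<And>v. continuous_on S (\<lambda>x. g' x v)"
    using assms(2) by (rule C1_onE) blast
  have "continuous_on S (\<lambda>x. \<Sum>b\<in>Basis. (g' x v \<bullet> b) *\<^sub>R f' (g x) b)" for v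
    by (intro continuous_intros g' continuous_on_compose2[OF f'(2) C1_on_continuous_on[OF assms(2)] assms(3)])
  moreover have "f' (g x) (g' x v) = (\<Sum>b\<in>Basis. (g' x v \<bullet> b) *\<^sub>R f' (g x) b)" if "x \<in> S" for x v
    using f'(1)[of "g x"] that assms(3) has_derivative_linear linear_expand by blast
  ultimately have "continuous_on S (\<lambda>x. f' (g x) (g' x v))" for v
    by (simp cong: continuous_on_cong)
  moreover have "((\<lambda>x. f (g x)) has_derivative (\<lambda>v. f' (g x) (g' x v))) (at x)" if "x \<in> S" for x
    using has_derivative_compose[OF g'(1)[OF that] f'(1)] that assms(3) by auto
  ultimately show ?thesis by (intro C1_onI)
qed

lemma C1_on_real:
  fixes f :: "real \<Rightarrow> real"
  assumes "\<And>x. x \<in> S \<Longrightarrow> (f has_real_derivative f' x) (at x)" "continuous_on S f'"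
  shows "C1_on S f"
  by (rule C1_onI[where f' = "\<lambda>x v. f' x * v"])
    (use assms in \<open>auto intro!: continuous_intros simp: has_field_derivative_def\<close>)

lemma C1_on_inverse [intro]:
  fixes f :: "_ \<Rightarrow> real"
  assumes "C1_on S f" "\<And>x. x \<in> S \<Longrightarrow> f x \<noteq> 0" shows "C1_on S (\<lambda>x. inverse (f x))"
proof (rule C1_on_compose[OF _ assms(1), where T = "-{0}"])
  show "C1_on (-{0}) (inverse :: real \<Rightarrow> real)"
    by (rule C1_on_real[where f' = "\<lambda>x. - (inverse x ^ 2)"])
      (auto intro!: derivative_eq_intros continuous_intros simp: power2_eq_square)
qed (use assms in auto)

lemma C1_on_divide [intro]:
  fixes f g :: "_ \<Rightarrow> real"
  assumes "C1_on S f" "C1_on S g" "\<And>x. x \<in> S \<Longrightarrow> g x \<noteq> 0" shows "C1_on S (\<lambda>x. f x / g x)"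
  using C1_on_mult[OF assms(1) C1_on_inverse[OF assms(2,3)]] by (simp add: divide_inverse)

lemma C1_on_sqrt [intro]:
  fixes f :: "_ \<Rightarrow> real"
  assumes "C1_on S f" "\<And>x. x \<in> S \<Longrightarrow> 0 < f x" shows "C1_on S (\<lambda>x. sqrt (f x))"
proof (rule C1_on_compose[OF _ assms(1), where T = "{0<..}"])
  show "C1_on {0<..} sqrt"
    by (rule C1_on_real[where f' = "\<lambda>x. inverse (sqrt x) / 2"])
      (auto intro!: derivative_eq_intros continuous_intros)
qed (use assms in auto)

section \<open>Determinants and inverses of matrix-valued functions\<close>

lemma C1_on_det:
  fixes A :: "'a::real_normed_vector \<Rightarrow> real^'n^'n"
  assumes "\<And>i j. C1_on S (\<lambda>x. A x $ i $ j)" shows "C1_on S (\<lambda>x. det (A x))"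
  unfolding det_def by (intro C1_on_sum C1_on_mult C1_on_prod C1_on_const assms)

lemma matrix_inv_inverse:
  fixes A :: "real^'n^'n"
  assumes "det A \<noteq> 0"
  shows "A ** matrix_inv A = mat 1" "matrix_inv A ** A = mat 1"
proof -
  have "\<exists>B. A ** B = mat 1 \<and> B ** A = mat 1"
    using assms invertible_det_nz invertible_def by blast
  from someI_ex[OF this] show "A ** matrix_inv A = mat 1" "matrix_inv A ** A = mat 1"
    unfolding matrix_inv_def by auto
qed

text \<open>Column j of the inverse solves A x = \<open>axis j 1\<close>, so Cramer's rule applies.
  The entries become quotients of determinants, from which their regularity can be read off.\<close>

lemma matrix_inv_cramer:
  fixes A :: "real^'n^'n"
  assumes "det A \<noteq> 0"
  shows "matrix_inv A $ i $ j = det (\<chi> k l. if l = i then axis j 1 $ k else A $ k $ l) / det A"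
proof -
  have "A *v (matrix_inv A *v axis j 1) = axis j 1"
    by (simp add: matrix_vector_mul_assoc matrix_inv_inverse[OF assms])
  then have "matrix_inv A *v axis j 1 = (\<chi> k. det (\<chi> i l. if l = k then axis j 1 $ i else A $ i $ l) / det A)"
    using cramer[OF assms] by blast
  moreover have "(matrix_inv A *v axis j 1) $ i = matrix_inv A $ i $ j"
    by (simp add: matrix_vector_mul_component inner_axis)
  ultimately show ?thesis by simp
qed

lemma C1_on_matrix_inv:
  fixes A :: "'a::real_normed_vector \<Rightarrow> real^'n^'n"
  assumes "open S" "\<And>i j. C1_on S (\<lambda>x. A x $ i $ j)" "\<And>x. x \<in> S \<Longrightarrow> det (A x) \<noteq> 0"
  shows "C1_on S (\<lambda>x. matrix_inv (A x) $ i $ j)"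
proof (rule C1_on_cong_open[OF assms(1)])
  show "C1_on S (\<lambda>x. det (\<chi> k l. if l = i then axis j 1 $ k else A x $ k $ l) / det (A x))"
  proof (intro C1_on_divide C1_on_det assms)
    show "C1_on S (\<lambda>x. (\<chi> k l. if l = i then axis j 1 $ k else A x $ k $ l) $ k $ l)" for k l
      using assms(2) by (cases "l = i") auto
  qed auto
qed (simp add: matrix_inv_cramer assms)

section \<open>Charts and the metric in coordinates\<close>

lemma smooth_chartD:
  assumes "smooth_chart M V \<phi>"
  shows "open (\<phi> ` V)" "V \<subseteq> M" "openin (top_of_set M) V"
    "\<And>u. u \<in> \<phi> ` V \<Longrightarrow> chart_inv V \<phi> u \<in> V"
    "\<And>u. u \<in> \<phi> ` V \<Longrightarrow> \<phi> (chart_inv V \<phi> u) = u"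
    "\<And>x. x \<in> V \<Longrightarrow> chart_inv V \<phi> (\<phi> x) = x"
    "continuous_on V \<phi>" "continuous_on (\<phi> ` V) (chart_inv V \<phi>)"
    "smooth_on (\<phi> ` V) (chart_inv V \<phi>)"
    "\<And>u. u \<in> \<phi> ` V \<Longrightarrow> inj (frechet_derivative (chart_inv V \<phi>) (at u))"
    "chart_inv V \<phi> ` \<phi> ` V = V"
proof -
  have h: "homeomorphism V (\<phi> ` V) \<phi> (chart_inv V \<phi>)" using assms unfolding smooth_chart_def by blast
  show "open (\<phi> ` V)" "openin (top_of_set M) V" "smooth_on (\<phi> ` V) (chart_inv V \<phi>)"
    "\<And>u. u \<in> \<phi> ` V \<Longrightarrow> inj (frechet_derivative (chart_inv V \<phi>) (at u))"
    using assms unfolding smooth_chart_def by auto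
  then show "V \<subseteq> M" by (simp add: openin_contains_ball)
  show "\<And>u. u \<in> \<phi> ` V \<Longrightarrow> chart_inv V \<phi> u \<in> V" "\<And>u. u \<in> \<phi> ` V \<Longrightarrow> \<phi> (chart_inv V \<phi> u) = u"
    "\<And>x. x \<in> V \<Longrightarrow> chart_inv V \<phi> (\<phi> x) = x" "continuous_on V \<phi>"
    "continuous_on (\<phi> ` V) (chart_inv V \<phi>)" "chart_inv V \<phi> ` \<phi> ` V = V"
    using h unfolding homeomorphism_def by auto
qed

lemma chart_inv_has_derivative:
  assumes "smooth_chart M V \<phi>" "u \<in> \<phi> ` V"
  shows "(chart_inv V \<phi> has_derivative frechet_derivative (chart_inv V \<phi>) (at u)) (at u)"
  using smooth_chartD(9)[OF assms(1)] assms(2) smooth_on_imp_C1_on C1_on_has_derivative by blast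

lemma linear_expand_cart:
  fixes f :: "real^'n \<Rightarrow> 'b::real_vector"
  assumes "linear f" shows "f a = (\<Sum>i\<in>UNIV. a $ i *\<^sub>R f (axis i 1))"
proof -
  have "a = (\<Sum>i\<in>UNIV. a $ i *\<^sub>R axis i 1)"
    using basis_expansion[of a] by (simp add: scalar_mult_eq_scaleR)
  then have "f a = f (\<Sum>i\<in>UNIV. a $ i *\<^sub>R axis i 1)" by simp
  also have "\<dots> = (\<Sum>i\<in>UNIV. a $ i *\<^sub>R f (axis i 1))"
    using assms by (simp add: linear_sum linear_scale)
  finally show ?thesis .
qed

lemma C_k_on_subset: "C_k_on k S f \<Longrightarrow> T \<subseteq> S \<Longrightarrow> C_k_on k T f"
  by (induction k arbitrary: f) (auto intro: continuous_on_subset)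

text \<open>The witness is the image of the coordinate line u + t a, which stays in the chart for
  small t. The axioms of the metric speak only of tangent vectors, so each use of them in
  coordinates passes through this fact.\<close>

lemma tangent_spaceI:
  fixes \<phi> :: "'a::euclidean_space \<Rightarrow> real^'n"
  assumes ch: "smooth_chart M V \<phi>" and u: "u \<in> \<phi> ` V"
  shows "frechet_derivative (chart_inv V \<phi>) (at u) a \<in> tangent_space M (chart_inv V \<phi> u)"
proof -
  let ?\<sigma> = "chart_inv V \<phi>" and ?T = "{t::real. u + t *\<^sub>R a \<in> \<phi> ` V}"
  note c = smooth_chartD[OF ch]
  have "open ?T"
    using continuous_open_vimage[of "\<phi> ` V" "\<lambda>t::real. u + t *\<^sub>R a"] c(1)
    by (simp add: vimage_def continuous_intros)
  moreover have "0 \<in> ?T" using u by simp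
  ultimately obtain e where e: "e > 0" "ball 0 e \<subseteq> ?T" using open_contains_ball by blast
  then have sub: "{-e<..<e} \<subseteq> ?T" by (auto simp: dist_norm subset_iff)
  let ?\<gamma> = "\<lambda>t. ?\<sigma> (u + t *\<^sub>R a)"
  have "smooth_on {-e<..<e} ?\<gamma>"
    using c(9) C_k_on_line[OF c(1)] C_k_on_subset[OF _ sub] unfolding smooth_on_def by blast
  moreover have "?\<gamma> ` {-e<..<e} \<subseteq> M" using sub c(2,4) by auto
  moreover have "(?\<gamma> has_vector_derivative frechet_derivative ?\<sigma> (at u) a) (at 0)"
  proof -
    have l: "linear (frechet_derivative ?\<sigma> (at u))"
      using chart_inv_has_derivative[OF ch u] has_derivative_linear by blast
    have "((\<lambda>t::real. u + t *\<^sub>R a) has_derivative (\<lambda>v. v *\<^sub>R a)) (at 0)"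
      by (auto intro!: derivative_eq_intros)
    moreover have "(?\<sigma> has_derivative frechet_derivative ?\<sigma> (at u)) (at (u + 0 *\<^sub>R a))"
      using chart_inv_has_derivative[OF ch u] by simp
    ultimately have "(?\<gamma> has_derivative (\<lambda>v. frechet_derivative ?\<sigma> (at u) (v *\<^sub>R a))) (at 0)"
      using has_derivative_compose[where f = "\<lambda>t. u + t *\<^sub>R a" and f' = "\<lambda>v. v *\<^sub>R a" and x = 0 and s = UNIV] by blast
    then show ?thesis
      unfolding has_vector_derivative_def using l by (simp add: linear_scale)
  qed
  ultimately show ?thesis unfolding tangent_space_def using e(1) by (intro CollectI exI[of _ ?\<gamma>] exI[of _ e]) auto
qed

section \<open>The metric in coordinates as a positive definite form\<close>

locale riemannian_manifold =
  fixes n :: "'n::finite itself" and M :: "'a::euclidean_space set"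
    and g :: "'a \<Rightarrow> 'a \<Rightarrow> 'a \<Rightarrow> real" and \<mu> :: "'a measure"
  assumes manifold: "compact_riemannian_manifold n M g"
    and volume: "riemannian_volume n M g \<mu>"
begin

abbreviation chart :: "'a set \<Rightarrow> ('a \<Rightarrow> real^'n) \<Rightarrow> bool" where
  "chart V \<phi> \<equiv> smooth_chart M V \<phi>"

lemma compact_M: "compact M" and metric: "riemannian_metric n M g"
  using manifold unfolding compact_riemannian_manifold_def by auto

lemma chart_at:
  assumes "x \<in> M" obtains V \<phi> where "chart V \<phi>" "x \<in> V"
  using manifold assms unfolding compact_riemannian_manifold_def smooth_submanifold_def by blast

lemma metric_smooth: "chart V \<phi> \<Longrightarrow> smooth_on (\<phi> ` V) (metric_matrix g V \<phi>)"
  using metric unfolding riemannian_metric_def by blast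

lemma metric_tangent:
  assumes "x \<in> M" "u \<in> tangent_space M x" "v \<in> tangent_space M x" "w \<in> tangent_space M x"
  shows "g x (a *\<^sub>R u + b *\<^sub>R v) w = a * g x u w + b * g x v w" "g x v w = g x w v"
    "v \<noteq> 0 \<Longrightarrow> 0 < g x v v"
  using metric assms unfolding riemannian_metric_def by auto

context
  fixes V \<phi> u assumes ch: "chart V \<phi>" and u: "u \<in> \<phi> ` V"
begin

lemma chart_deriv_linear: "linear (frechet_derivative (chart_inv V \<phi>) (at u))"
  using chart_inv_has_derivative[OF ch u] has_derivative_linear by blast

lemmas metric_chart = metric_tangent[OF subsetD[OF smooth_chartD(2)[OF ch] smooth_chartD(4)[OF ch u]]
  tangent_spaceI[OF ch u] tangent_spaceI[OF ch u] tangent_spaceI[OF ch u]]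

lemma metric_sym:
  "g (chart_inv V \<phi> u) (frechet_derivative (chart_inv V \<phi>) (at u) a) (frechet_derivative (chart_inv V \<phi>) (at u) b)
   = g (chart_inv V \<phi> u) (frechet_derivative (chart_inv V \<phi>) (at u) b) (frechet_derivative (chart_inv V \<phi>) (at u) a)"
  by (rule metric_chart(2))

lemma metric_linear:
  "linear (\<lambda>a. g (chart_inv V \<phi> u) (frechet_derivative (chart_inv V \<phi>) (at u) a) (frechet_derivative (chart_inv V \<phi>) (at u) b))"
proof -
  let ?D = "frechet_derivative (chart_inv V \<phi>) (at u)"
  have *: "g (chart_inv V \<phi> u) (r *\<^sub>R ?D a + s *\<^sub>R ?D c) (?D b)
      = r * g (chart_inv V \<phi> u) (?D a) (?D b) + s * g (chart_inv V \<phi> u) (?D c) (?D b)" for a c r s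
    by (rule metric_chart(1))
  note l = linear_add[OF chart_deriv_linear] linear_scale[OF chart_deriv_linear]
  show ?thesis
    using *[of 1 _ 1] *[of _ _ 0 0] by (intro linearI) (simp_all add: l)
qed

text \<open>The Gram matrix records g on coordinate basis vectors only; bilinearity on tangent
  vectors extends it to all pairs of directions.\<close>

lemma metric_matrix_inner:
  "g (chart_inv V \<phi> u) (frechet_derivative (chart_inv V \<phi>) (at u) a) (frechet_derivative (chart_inv V \<phi>) (at u) b)
   = a \<bullet> (metric_matrix g V \<phi> u *v b)"
proof -
  let ?B = "\<lambda>a b. g (chart_inv V \<phi> u) (frechet_derivative (chart_inv V \<phi>) (at u) a) (frechet_derivative (chart_inv V \<phi>) (at u) b)"
  have *: "?B c b = (\<Sum>j\<in>UNIV. b $ j * ?B c (axis j 1))" for c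
    unfolding metric_sym[of c] using linear_expand_cart[OF metric_linear[of c], of b] by simp
  have "?B a b = (\<Sum>i\<in>UNIV. a $ i * ?B (axis i 1) b)"
    using linear_expand_cart[OF metric_linear[of b], of a] by simp
  also have "\<dots> = (\<Sum>i\<in>UNIV. a $ i * (\<Sum>j\<in>UNIV. b $ j * ?B (axis i 1) (axis j 1)))"
    by (subst *) simp
  also have "\<dots> = a \<bullet> (metric_matrix g V \<phi> u *v b)"
    by (simp add: inner_vec_def matrix_vector_mult_def metric_matrix_def mult.commute)
  finally show ?thesis .
qed

lemma metric_matrix_sym: "a \<bullet> (metric_matrix g V \<phi> u *v b) = b \<bullet> (metric_matrix g V \<phi> u *v a)"
  using metric_matrix_inner metric_sym by metis

lemma metric_matrix_pos:
  assumes "a \<noteq> 0" shows "0 < a \<bullet> (metric_matrix g V \<phi> u *v a)"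
proof -
  have "frechet_derivative (chart_inv V \<phi>) (at u) a \<noteq> 0"
    using smooth_chartD(10)[OF ch u] assms linear_0[OF chart_deriv_linear] by (metis injD)
  then show ?thesis
    unfolding metric_matrix_inner[symmetric] by (rule metric_chart(3))
qed

end

end

text \<open>The determinant does not vanish along the segment from the identity to \<open>A\<close>.\<close>

lemma det_pos_if_pos_def:
  fixes A :: "real^'n^'n"
  assumes pos: "\<And>a. a \<noteq> 0 \<Longrightarrow> 0 < a \<bullet> (A *v a)"
  shows "0 < det A"
proof (rule ccontr)
  let ?P = "\<lambda>t::real. (\<chi> i j. (1 - t) * mat 1 $ i $ j + t * A $ i $ j) :: real^'n^'n"
  assume "\<not> 0 < det A"
  moreover have "?P 1 = A" "?P 0 = mat 1" by (simp_all add: vec_eq_iff)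
  ultimately have "det (?P 1) \<le> 0" "0 \<le> det (?P 0)" by simp_all
  moreover have "continuous_on {0..1} (\<lambda>t. det (?P t))"
    unfolding det_def by (auto intro!: continuous_intros)
  ultimately obtain t where t: "0 \<le> t" "t \<le> 1" "det (?P t) = 0"
    using IVT2'[of "\<lambda>t. det (?P t)" 1 0 0] by auto
  then have "\<not> invertible (?P t)" by (simp add: invertible_det_nz)
  then obtain x where x: "x \<noteq> 0" "?P t *v x = 0"
    using invertible_left_inverse matrix_left_invertible_ker by blast
  have "(?P t *v x) $ i = (1 - t) * x $ i + t * (A *v x) $ i" for i
  proof -
    have "(?P t *v x) $ i = (1 - t) * (mat 1 *v x) $ i + t * (A *v x) $ i"
    proof -
      have "(?P t *v x) $ i = (\<Sum>j\<in>UNIV. (1 - t) * (mat 1 $ i $ j * x $ j) + t * (A $ i $ j * x $ j))"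
        unfolding matrix_vector_mult_def by (simp add: algebra_simps)
      then show ?thesis
        unfolding sum.distrib sum_distrib_left[symmetric] by (simp only: matrix_vector_mult_def vec_lambda_beta)
    qed
    then show ?thesis by simp
  qed
  then have "?P t *v x = (1 - t) *\<^sub>R x + t *\<^sub>R (A *v x)" by (simp add: vec_eq_iff)
  then have "(1 - t) *\<^sub>R x + t *\<^sub>R (A *v x) = 0" using x(2) by simp
  then have "x \<bullet> ((1 - t) *\<^sub>R x + t *\<^sub>R (A *v x)) = 0" by (simp only: inner_zero_right)
  then have "0 = (1 - t) * (x \<bullet> x) + t * (x \<bullet> (A *v x))"
    by (simp only: inner_add_right inner_scaleR_right)
  moreover have "0 \<le> (1 - t) * (x \<bullet> x)" "0 \<le> t * (x \<bullet> (A *v x))"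
    using t pos[OF x(1)] by simp_all
  moreover have "0 < (1 - t) * (x \<bullet> x) \<or> 0 < t * (x \<bullet> (A *v x))"
    using t x(1) pos[OF x(1)] by (cases "t = 0") auto
  ultimately show False by linarith
qed

text \<open>This yields differentiability of transition maps, since a chart itself is only known to
  be a homeomorphism. With L a left inverse of A, the map L \<circ> \<psi> has the identity as
  derivative at \<tau> u, so the increments of \<tau> and of L \<circ> \<psi> \<circ> \<tau> differ
  by a small multiple of the increment of \<tau>; continuity of \<tau> makes this estimate available
  near u, and the second map is differentiable by assumption.\<close>

lemma has_derivative_through_immersion:
  fixes \<psi> :: "'b::euclidean_space \<Rightarrow> 'c::euclidean_space" and \<tau> :: "'a::real_normed_vector \<Rightarrow> 'b"
  assumes \<psi>: "(\<psi> has_derivative A) (at (\<tau> u))" and inj: "inj A"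
    and cont: "isCont \<tau> u" and comp: "((\<lambda>x. \<psi> (\<tau> x)) has_derivative B) (at u)"
  obtains T where "(\<tau> has_derivative T) (at u)" "\<And>a. A (T a) = B a"
proof -
  have lA: "linear A" using \<psi> has_derivative_linear by blast
  obtain L where L: "linear L" "\<And>x. L (A x) = x"
    using linear_injective_left_inverse[OF lA inj] by (auto simp: fun_eq_iff)
  have bL: "bounded_linear L" using L(1) linear_conv_bounded_linear by blast
  define T where "T a = L (B a)" for a
  have h: "((\<lambda>y. L (\<psi> y)) has_derivative (\<lambda>x. x)) (at (\<tau> u))"
    using bounded_linear.has_derivative[OF bL \<psi>] L(2) by simp
  have k: "((\<lambda>x. L (\<psi> (\<tau> x))) has_derivative T) (at u)"
    using bounded_linear.has_derivative[OF bL comp] unfolding T_def .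
  have bT: "bounded_linear T" using k has_derivative_bounded_linear by blast
  then obtain C where C: "0 < C" "\<And>x. norm (T x) \<le> norm x * C" using bounded_linear.pos_bounded by blast
  have "(\<tau> has_derivative T) (at u)"
    unfolding has_derivative_at_alt
  proof (intro conjI allI impI)
    show "bounded_linear T" by fact
    fix e :: real assume "0 < e"
    \<comment> \<open>The bound 1/2 lets the increment of \<tau> on the right be absorbed, giving
      the Lipschitz constant 1 + 2 C at u; inserting it leaves the error \<eta> (2 + 2 C), which the
      second bound keeps below e.\<close>
    define \<eta> where "\<eta> = min (1/2) (e / (2 + 2 * C))"
    have "0 < \<eta>" using \<open>0 < e\<close> C(1) unfolding \<eta>_def min_less_iff_conj by simp
    moreover have "\<eta> \<le> 1/2" unfolding \<eta>_def by (rule min.cobounded1)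
    moreover have "\<eta> \<le> e / (2 + 2 * C)" unfolding \<eta>_def by (rule min.cobounded2)
    ultimately have \<eta>: "0 < \<eta>" "\<eta> \<le> 1/2" "\<eta> \<le> e / (2 + 2 * C)" by auto
    have \<eta>e: "\<eta> * (2 + 2 * C) \<le> e"
      using \<eta>(3) C(1) by (simp add: pos_le_divide_eq)
    obtain d1 where d1: "d1 > 0" "\<And>y. norm (y - \<tau> u) < d1 \<Longrightarrow>
        norm (L (\<psi> y) - L (\<psi> (\<tau> u)) - (y - \<tau> u)) \<le> \<eta> * norm (y - \<tau> u)"
      using h \<eta>(1) unfolding has_derivative_at_alt by blast
    obtain d2 where d2: "d2 > 0" "\<And>x. norm (x - u) < d2 \<Longrightarrow>
        norm (L (\<psi> (\<tau> x)) - L (\<psi> (\<tau> u)) - T (x - u)) \<le> \<eta> * norm (x - u)"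
      using k \<eta>(1) unfolding has_derivative_at_alt by blast
    obtain d3 where d3: "d3 > 0" "\<And>x. norm (x - u) < d3 \<Longrightarrow> norm (\<tau> x - \<tau> u) < d1"
      using cont d1(1) unfolding continuous_at_eps_delta dist_norm by blast
    show "\<exists>d>0. \<forall>y. norm (y - u) < d \<longrightarrow> norm (\<tau> y - \<tau> u - T (y - u)) \<le> e * norm (y - u)"
    proof (intro exI conjI allI impI)
      show "0 < min d2 d3" using d2 d3 by simp
      fix x assume x: "norm (x - u) < min d2 d3"
      let ?a = "norm (\<tau> x - \<tau> u)" and ?b = "norm (x - u)" and ?c = "norm (\<tau> x - \<tau> u - T (x - u))"
      have 1: "?c \<le> \<eta> * ?a + \<eta> * ?b"
      proof -
        have "\<tau> x - \<tau> u - T (x - u) = (L (\<psi> (\<tau> x)) - L (\<psi> (\<tau> u)) - T (x - u))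
            - (L (\<psi> (\<tau> x)) - L (\<psi> (\<tau> u)) - (\<tau> x - \<tau> u))" by simp
        then have "?c \<le> norm (L (\<psi> (\<tau> x)) - L (\<psi> (\<tau> u)) - T (x - u))
            + norm (L (\<psi> (\<tau> x)) - L (\<psi> (\<tau> u)) - (\<tau> x - \<tau> u))"
          by (metis norm_triangle_ineq4)
        then show ?thesis using d1(2) d2(2) d3(2) x by fastforce
      qed
      have "?a = norm ((\<tau> x - \<tau> u - T (x - u)) + T (x - u))" by simp
      also have "\<dots> \<le> ?c + norm (T (x - u))" by (rule norm_triangle_ineq)
      finally have "?a \<le> ?c + ?b * C" using C(2)[of "x - u"] by linarith
      moreover have "\<eta> * ?a \<le> 1/2 * ?a" "\<eta> * ?b \<le> 1/2 * ?b"
        by (rule mult_right_mono[OF \<eta>(2)], simp)+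
      ultimately have "?a \<le> (1 + 2 * C) * ?b" using 1 by (simp add: algebra_simps)
      then have "\<eta> * ?a \<le> \<eta> * ((1 + 2 * C) * ?b)" using \<eta> by (simp add: mult_left_mono)
      with 1 have "?c \<le> \<eta> * (2 + 2 * C) * ?b" by (simp add: algebra_simps)
      also have "\<dots> \<le> e * ?b" using \<eta>e by (simp add: mult_right_mono)
      finally show "?c \<le> e * ?b" .
    qed
  qed
  moreover have "A (T a) = B a" for a
  proof -
    have "((\<lambda>x. \<psi> (\<tau> x)) has_derivative (\<lambda>a. A (T a))) (at u)"
      using has_derivative_compose[OF calculation \<psi>] .
    then show ?thesis using has_derivative_unique[OF comp] by metis
  qed
  ultimately show ?thesis using that by blast
qed

section \<open>The inner product of gradients\<close>

context riemannian_manifold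
begin

lemma det_metric_pos: "chart V \<phi> \<Longrightarrow> u \<in> \<phi> ` V \<Longrightarrow> 0 < det (metric_matrix g V \<phi> u)"
  using det_pos_if_pos_def metric_matrix_pos by blast

text \<open>These are the components of the differential; the gradient vector arises from them by
  applying the inverse Gram matrix.\<close>

definition grad_coord :: "'a set \<Rightarrow> ('a \<Rightarrow> real^'n) \<Rightarrow> ('a \<Rightarrow> real) \<Rightarrow> real^'n \<Rightarrow> real^'n" where
  "grad_coord V \<phi> w u = (\<chi> i. partial_deriv i (w \<circ> chart_inv V \<phi>) u)"

definition grad_inner_coord ::
    "'a set \<Rightarrow> ('a \<Rightarrow> real^'n) \<Rightarrow> ('a \<Rightarrow> real) \<Rightarrow> ('a \<Rightarrow> real) \<Rightarrow> real^'n \<Rightarrow> real" where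
  "grad_inner_coord V \<phi> v w u =
     grad_coord V \<phi> v u \<bullet> (matrix_inv (metric_matrix g V \<phi> u) *v grad_coord V \<phi> w u)"

text \<open>A function on the manifold itself, obtained from an arbitrary chart around x; for C1
  functions \<open>grad_inner_coord_chart_independent\<close> makes the choice immaterial.\<close>

definition grad_inner :: "('a \<Rightarrow> real) \<Rightarrow> ('a \<Rightarrow> real) \<Rightarrow> 'a \<Rightarrow> real" where
  "grad_inner v w x = (SOME t. \<exists>V \<phi>. chart V \<phi> \<and> x \<in> V \<and> t = grad_inner_coord V \<phi> v w (\<phi> x))"

definition C1_manifold :: "('a \<Rightarrow> real) \<Rightarrow> bool" where
  "C1_manifold w \<longleftrightarrow> (\<forall>V \<phi>. chart V \<phi> \<longrightarrow> C1_on (\<phi> ` V) (w \<circ> chart_inv V \<phi>))"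

lemma C1_manifoldD: "C1_manifold w \<Longrightarrow> chart V \<phi> \<Longrightarrow> C1_on (\<phi> ` V) (w \<circ> chart_inv V \<phi>)"
  unfolding C1_manifold_def by blast

lemma C1_manifold_derivative:
  "C1_manifold w \<Longrightarrow> chart V \<phi> \<Longrightarrow> u \<in> \<phi> ` V \<Longrightarrow>
    (w \<circ> chart_inv V \<phi> has_derivative frechet_derivative (w \<circ> chart_inv V \<phi>) (at u)) (at u)"
  by (rule C1_on_has_derivative[OF C1_manifoldD])

lemma frechet_derivative_grad_coord:
  assumes "C1_manifold w" "chart V \<phi>" "u \<in> \<phi> ` V"
  shows "frechet_derivative (w \<circ> chart_inv V \<phi>) (at u) a = a \<bullet> grad_coord V \<phi> w u"
proof -
  have "linear (frechet_derivative (w \<circ> chart_inv V \<phi>) (at u))"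
    using C1_manifold_derivative[OF assms] has_derivative_linear by blast
  from linear_expand_cart[OF this, of a] show ?thesis
    by (simp add: inner_vec_def grad_coord_def partial_deriv_def)
qed

lemma openin_chart_inv_vimage:
  assumes "chart V \<phi>" "openin (top_of_set M) W"
  shows "open {u \<in> \<phi> ` V. chart_inv V \<phi> u \<in> W}"
proof -
  obtain T where T: "open T" "W = M \<inter> T" using assms(2) openin_open by blast
  have "{u \<in> \<phi> ` V. chart_inv V \<phi> u \<in> W} = \<phi> ` V \<inter> chart_inv V \<phi> -` T"
    using T smooth_chartD(2,4)[OF assms(1)] by auto
  then show ?thesis
    using continuous_open_preimage[OF smooth_chartD(8,1)[OF assms(1)] T(1)] by simp
qed

text \<open>The gradient is the tangent vector representing the differential, so a transition map
  carries its coordinates in one chart to those in the other.\<close>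

lemma grad_inner_coord_chart_independent:
  assumes ch: "chart V \<phi>" and ch': "chart V' \<phi>'" and x: "x \<in> V" "x \<in> V'"
    and v: "C1_manifold v" and w: "C1_manifold w"
  shows "grad_inner_coord V \<phi> v w (\<phi> x) = grad_inner_coord V' \<phi>' v w (\<phi>' x)"
proof -
  let ?\<sigma> = "chart_inv V \<phi>" and ?\<sigma>' = "chart_inv V' \<phi>'"
  define W where "W = {u \<in> \<phi> ` V. ?\<sigma> u \<in> V'}"
  define u u' where "u = \<phi> x" and "u' = \<phi>' x"
  note c = smooth_chartD[OF ch] and c' = smooth_chartD[OF ch']
  define \<tau> where "\<tau> = (\<lambda>u. \<phi>' (?\<sigma> u))"
  have u: "u \<in> \<phi> ` V" "u' \<in> \<phi>' ` V'" "?\<sigma> u = x" "?\<sigma>' u' = x" "\<tau> u = u'"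
    using x c(6)[OF x(1)] c'(6)[OF x(2)] by (auto simp: u_def u'_def \<tau>_def)
  have W: "open W" unfolding W_def using openin_chart_inv_vimage[OF ch c'(3)] .
  have uW: "u \<in> W" using u x by (auto simp: W_def)
  have comp: "?\<sigma>' (\<tau> y) = ?\<sigma> y" if "y \<in> W" for y
    using that c'(6) by (auto simp: W_def \<tau>_def)
  have "continuous_on W \<tau>"
    unfolding \<tau>_def
    by (rule continuous_on_compose2[OF c'(7) continuous_on_subset[OF c(8)]]) (auto simp: W_def)
  then have cont: "isCont \<tau> u" using W uW by (simp add: continuous_on_eq_continuous_at)
  let ?B = "frechet_derivative ?\<sigma> (at u)" and ?A = "frechet_derivative ?\<sigma>' (at u')"
  have "((\<lambda>y. ?\<sigma>' (\<tau> y)) has_derivative ?B) (at u)"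
    using has_derivative_transform_within_open[OF chart_inv_has_derivative[OF ch u(1)] W uW] comp by simp
  then obtain T where T: "(\<tau> has_derivative T) (at u)" "\<And>a. ?A (T a) = ?B a"
    using has_derivative_through_immersion[of ?\<sigma>' ?A \<tau> u ?B] chart_inv_has_derivative[OF ch' u(2)]
      c'(10)[OF u(2)] cont u(5) by metis
  have lT: "linear T" using T(1) has_derivative_linear by blast
  \<comment> \<open>An injective linear endomorphism is onto, so every test vector b below is of the
    form T a.\<close>
  have "inj T" using c(10)[OF u(1)] T(2) by (metis injD injI)
  then have surj: "surj T" using lT linear_injective_imp_surjective by blast
  have trans: "frechet_derivative (f \<circ> ?\<sigma>) (at u) a = frechet_derivative (f \<circ> ?\<sigma>') (at u') (T a)"
    if f: "C1_manifold f" for f a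
  proof -
    have "((\<lambda>y. (f \<circ> ?\<sigma>') (\<tau> y)) has_derivative (\<lambda>a. frechet_derivative (f \<circ> ?\<sigma>') (at u') (T a))) (at u)"
      using has_derivative_compose[OF T(1), of "f \<circ> ?\<sigma>'"] C1_manifold_derivative[OF f ch' u(2)] u(5) by auto
    from has_derivative_transform_within_open[OF this W uW, of "f \<circ> ?\<sigma>"]
    have "(f \<circ> ?\<sigma> has_derivative (\<lambda>a. frechet_derivative (f \<circ> ?\<sigma>') (at u') (T a))) (at u)"
      using comp by simp
    from has_derivative_unique[OF this C1_manifold_derivative[OF f ch u(1)]] show ?thesis by metis
  qed
  let ?G = "metric_matrix g V \<phi> u" and ?G' = "metric_matrix g V' \<phi>' u'"
  have inv: "?G ** matrix_inv ?G = mat 1" "matrix_inv ?G' ** ?G' = mat 1"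
    using matrix_inv_inverse det_metric_pos[OF ch u(1)] det_metric_pos[OF ch' u(2)] by (metis less_irrefl)+
  \<comment> \<open>X is the gradient of w in the first chart. The fact \<open>GX'\<close> then says
    that T X is the gradient in the second chart, because T preserves the metric pairing as well as
    the differential.\<close>
  define X where "X = matrix_inv ?G *v grad_coord V \<phi> w u"
  have GX: "?G *v X = grad_coord V \<phi> w u"
    unfolding X_def by (simp add: matrix_vector_mul_assoc inv)
  have GX': "?G' *v T X = grad_coord V' \<phi>' w u'"
  proof (rule vector_eq_rdot[THEN iffD1, rule_format])
    fix b
    obtain a where a: "b = T a" using surj by auto
    have "b \<bullet> (?G' *v T X) = a \<bullet> (?G *v X)"
      unfolding a metric_matrix_inner[OF ch u(1), symmetric] metric_matrix_inner[OF ch' u(2), symmetric]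
      by (simp add: T(2) u)
    also have "\<dots> = b \<bullet> grad_coord V' \<phi>' w u'"
      unfolding a GX using trans[OF w, of a] frechet_derivative_grad_coord[OF w ch u(1)]
        frechet_derivative_grad_coord[OF w ch' u(2)] by simp
    finally show "(?G' *v T X) \<bullet> b = grad_coord V' \<phi>' w u' \<bullet> b" by (simp add: inner_commute)
  qed
  have "matrix_inv ?G' *v grad_coord V' \<phi>' w u' = T X"
    unfolding GX'[symmetric] by (simp add: matrix_vector_mul_assoc inv)
  then have "grad_inner_coord V' \<phi>' v w u' = T X \<bullet> grad_coord V' \<phi>' v u'"
    by (simp add: grad_inner_coord_def inner_commute)
  also have "\<dots> = X \<bullet> grad_coord V \<phi> v u"
    using trans[OF v, of X] frechet_derivative_grad_coord[OF v ch u(1)]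
      frechet_derivative_grad_coord[OF v ch' u(2)] by simp
  also have "\<dots> = grad_inner_coord V \<phi> v w u"
    by (simp add: grad_inner_coord_def X_def inner_commute)
  finally show ?thesis by (simp add: u_def u'_def)
qed

lemma grad_inner_eq:
  assumes "chart V \<phi>" "x \<in> V" "C1_manifold v" "C1_manifold w"
  shows "grad_inner v w x = grad_inner_coord V \<phi> v w (\<phi> x)"
  unfolding grad_inner_def
  by (rule someI2[of _ "grad_inner_coord V \<phi> v w (\<phi> x)"])
    (use assms grad_inner_coord_chart_independent in blast)+

section \<open>Symmetry, positivity, regularity and additivity of the gradient pairing\<close>

lemma matrix_inv_metric_sym:
  assumes "chart V \<phi>" "u \<in> \<phi> ` V"
  shows "a \<bullet> (matrix_inv (metric_matrix g V \<phi> u) *v b) = b \<bullet> (matrix_inv (metric_matrix g V \<phi> u) *v a)"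
proof -
  let ?G = "metric_matrix g V \<phi> u"
  have i: "?G ** matrix_inv ?G = mat 1"
    using matrix_inv_inverse det_metric_pos[OF assms] by (metis less_irrefl)
  have "a = ?G *v (matrix_inv ?G *v a)" "b = ?G *v (matrix_inv ?G *v b)"
    by (simp_all add: matrix_vector_mul_assoc i)
  then show ?thesis using metric_matrix_sym[OF assms] by (metis inner_commute)
qed

lemma matrix_inv_metric_pos:
  assumes "chart V \<phi>" "u \<in> \<phi> ` V" "a \<noteq> 0"
  shows "0 < a \<bullet> (matrix_inv (metric_matrix g V \<phi> u) *v a)"
proof -
  let ?G = "metric_matrix g V \<phi> u"
  have i: "?G ** matrix_inv ?G = mat 1"
    using matrix_inv_inverse det_metric_pos[OF assms(1,2)] by (metis less_irrefl)
  have a: "a = ?G *v (matrix_inv ?G *v a)"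
    by (simp add: matrix_vector_mul_assoc i)
  then have "matrix_inv ?G *v a \<noteq> 0" using assms(3) by force
  from metric_matrix_pos[OF assms(1,2) this] show ?thesis
    using a by (metis inner_commute)
qed

lemma grad_inner_sym:
  assumes "x \<in> M" "C1_manifold v" "C1_manifold w"
  shows "grad_inner v w x = grad_inner w v x"
proof -
  obtain V \<phi> where c: "chart V \<phi>" "x \<in> V" using chart_at[OF assms(1)] .
  then show ?thesis
    unfolding grad_inner_eq[OF c assms(2,3)] grad_inner_eq[OF c assms(3,2)] grad_inner_coord_def
    using matrix_inv_metric_sym by blast
qed

lemma grad_inner_nonneg:
  assumes "x \<in> M" "C1_manifold w" shows "0 \<le> grad_inner w w x"
proof -
  obtain V \<phi> where c: "chart V \<phi>" "x \<in> V" using chart_at[OF assms(1)] .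
  then show ?thesis
    unfolding grad_inner_eq[OF c assms(2,2)] grad_inner_coord_def
    using matrix_inv_metric_pos[of V \<phi> "\<phi> x"] by (cases "grad_coord V \<phi> w (\<phi> x) = 0") (auto intro: less_imp_le)
qed

lemma C1_manifold_mult: "C1_manifold v \<Longrightarrow> C1_manifold w \<Longrightarrow> C1_manifold (\<lambda>x. v x * w x)"
  unfolding C1_manifold_def comp_def by auto

lemma C1_manifold_sum: "(\<And>i. i \<in> I \<Longrightarrow> C1_manifold (v i)) \<Longrightarrow> C1_manifold (\<lambda>x. \<Sum>i\<in>I. v i x)"
  unfolding C1_manifold_def comp_def by auto

lemma C1_manifold_divide:
  assumes "C1_manifold v" "C1_manifold w" "\<And>x. x \<in> M \<Longrightarrow> w x \<noteq> 0"
  shows "C1_manifold (\<lambda>x. v x / w x)"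
  unfolding C1_manifold_def comp_def
proof (intro allI impI C1_on_divide)
  fix V \<phi> assume ch: "chart V \<phi>"
  show "C1_on (\<phi> ` V) (\<lambda>u. v (chart_inv V \<phi> u))" "C1_on (\<phi> ` V) (\<lambda>u. w (chart_inv V \<phi> u))"
    using assms C1_manifoldD[OF _ ch] unfolding comp_def by auto
  show "w (chart_inv V \<phi> u) \<noteq> 0" if "u \<in> \<phi> ` V" for u
    using assms(3) smooth_chartD(2,4)[OF ch] that by blast
qed

lemma C1_manifold_ambient:
  assumes "C1_on UNIV w" shows "C1_manifold w"
  unfolding C1_manifold_def comp_def
  using C1_on_compose[OF assms smooth_on_imp_C1_on[OF smooth_chartD(9)]] by blast

lemma C1_manifold_smooth_map: "smooth_map n M w \<Longrightarrow> C1_manifold w"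
  unfolding C1_manifold_def smooth_map_def by (auto intro: smooth_on_imp_C1_on)

text \<open>Continuity is local, and V is open in M, so at a point of V the filters of
  neighbourhoods within V and within M coincide.\<close>

lemma continuous_on_manifold:
  fixes F :: "'a \<Rightarrow> 'b::topological_space"
  assumes "\<And>V \<phi>. chart V \<phi> \<Longrightarrow> continuous_on (\<phi> ` V) (F \<circ> chart_inv V \<phi>)"
  shows "continuous_on M F"
proof -
  have "continuous (at x within M) F" if x: "x \<in> M" for x
  proof -
    obtain V \<phi> where c: "chart V \<phi>" "x \<in> V" using chart_at[OF x] .
    note d = smooth_chartD[OF c(1)]
    have "continuous_on V (\<lambda>x. (F \<circ> chart_inv V \<phi>) (\<phi> x))"
      by (rule continuous_on_compose2[OF assms[OF c(1)] d(7)]) auto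
    then have "continuous_on V F" using d(6) by (simp cong: continuous_on_cong)
    then have "continuous (at x within V) F" using c(2) by (simp add: continuous_on_eq_continuous_within)
    moreover obtain T where "open T" "V = M \<inter> T" using d(3) openin_open by blast
    then have "at x within V = at x within M" using at_within_nhd[of x T V M] c(2) by blast
    ultimately show ?thesis by simp
  qed
  then show ?thesis by (simp add: continuous_on_eq_continuous_within)
qed

lemma C1_manifold_continuous: "C1_manifold w \<Longrightarrow> continuous_on M w"
  by (rule continuous_on_manifold, rule C1_on_continuous_on[OF C1_manifoldD])

lemma C1_on_metric: 
  assumes "chart V \<phi>"
  shows "C1_on (\<phi> ` V) (\<lambda>u. metric_matrix g V \<phi> u $ i $ j)"
proof -
  have "C1_on (\<phi> ` V) (metric_matrix g V \<phi>)" using assms metric_smooth smooth_on_imp_C1_on by blast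
  moreover have "C1_on UNIV (\<lambda>A::real^'n^'n. A $ i $ j)"
    by (intro C1_on_bounded_linear bounded_linear_compose[OF bounded_linear_vec_nth] bounded_linear_vec_nth)
  ultimately show ?thesis using C1_on_compose by blast
qed

lemma C1_on_metric_inv:
  "chart V \<phi> \<Longrightarrow> C1_on (\<phi> ` V) (\<lambda>u. matrix_inv (metric_matrix g V \<phi> u) $ i $ j)"
  using det_metric_pos smooth_chartD(1) by (intro C1_on_matrix_inv C1_on_metric) force+

lemma C1_on_sqrt_det: "chart V \<phi> \<Longrightarrow> C1_on (\<phi> ` V) (\<lambda>u. sqrt (det (metric_matrix g V \<phi> u)))"
  by (intro C1_on_sqrt C1_on_det C1_on_metric det_metric_pos)

lemma grad_inner_coord_sum:
  "grad_inner_coord V \<phi> v w u =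
     (\<Sum>i\<in>UNIV. \<Sum>j\<in>UNIV. matrix_inv (metric_matrix g V \<phi> u) $ i $ j *
        partial_deriv i (v \<circ> chart_inv V \<phi>) u * partial_deriv j (w \<circ> chart_inv V \<phi>) u)"
  by (simp add: grad_inner_coord_def grad_coord_def inner_vec_def matrix_vector_mult_def sum_distrib_left ac_simps)

lemma continuous_on_partial_deriv: "C1_on S F \<Longrightarrow> continuous_on S (partial_deriv i F)"
  using C1_on_continuous_derivative unfolding partial_deriv_def by blast

lemma continuous_on_grad_inner_coord:
  assumes "chart V \<phi>" "C1_manifold v" "C1_manifold w"
  shows "continuous_on (\<phi> ` V) (grad_inner_coord V \<phi> v w)"
  unfolding grad_inner_coord_sum[abs_def]
  by (intro continuous_intros continuous_on_partial_deriv C1_manifoldD[OF assms(2,1)]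
      C1_manifoldD[OF assms(3,1)] C1_on_continuous_on[OF C1_on_metric_inv[OF assms(1)]])

lemma continuous_on_grad_inner:
  assumes "C1_manifold v" "C1_manifold w"
  shows "continuous_on M (grad_inner v w)"
proof (rule continuous_on_manifold)
  fix V \<phi> assume ch: "chart V \<phi>"
  have "(grad_inner v w \<circ> chart_inv V \<phi>) u = grad_inner_coord V \<phi> v w u" if "u \<in> \<phi> ` V" for u
    using grad_inner_eq[OF ch _ assms, of "chart_inv V \<phi> u"] smooth_chartD(4,5)[OF ch that] by simp
  then show "continuous_on (\<phi> ` V) (grad_inner v w \<circ> chart_inv V \<phi>)"
    using continuous_on_grad_inner_coord[OF ch assms] by (simp cong: continuous_on_cong)
qed

lemma grad_coord_sum:
  assumes ch: "chart V \<phi>" and u: "u \<in> \<phi> ` V" and v: "\<And>i. i \<in> I \<Longrightarrow> C1_manifold (v i)"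
  shows "grad_coord V \<phi> (\<lambda>x. \<Sum>i\<in>I. v i x) u = (\<Sum>i\<in>I. grad_coord V \<phi> (v i) u)"
proof -
  have "((\<lambda>x. \<Sum>i\<in>I. v i x) \<circ> chart_inv V \<phi> has_derivative
      (\<lambda>a. \<Sum>i\<in>I. frechet_derivative (v i \<circ> chart_inv V \<phi>) (at u) a)) (at u)"
    using C1_manifold_derivative[OF v ch u] unfolding comp_def by (intro has_derivative_sum)
  then have "frechet_derivative ((\<lambda>x. \<Sum>i\<in>I. v i x) \<circ> chart_inv V \<phi>) (at u)
      = (\<lambda>a. \<Sum>i\<in>I. frechet_derivative (v i \<circ> chart_inv V \<phi>) (at u) a)"
    using frechet_derivative_at by metis
  then show ?thesis by (simp add: grad_coord_def partial_deriv_def vec_eq_iff)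
qed

lemma grad_inner_sum_left:
  assumes x: "x \<in> M" and v: "\<And>i. i \<in> I \<Longrightarrow> C1_manifold (v i)" and w: "C1_manifold w"
  shows "grad_inner (\<lambda>x. \<Sum>i\<in>I. v i x) w x = (\<Sum>i\<in>I. grad_inner (v i) w x)"
proof -
  obtain V \<phi> where c: "chart V \<phi>" "x \<in> V" using chart_at[OF x] .
  then have u: "\<phi> x \<in> \<phi> ` V" by auto
  show ?thesis
    using grad_inner_eq[OF c C1_manifold_sum w, of I v] grad_inner_eq[OF c v w] v
    by (simp add: grad_inner_coord_def grad_coord_sum[OF c(1) u] inner_sum_left)
qed

lemma grad_inner_cong_left:
  assumes x: "x \<in> M" and "\<And>x. x \<in> M \<Longrightarrow> v x = v' x" "C1_manifold v" "C1_manifold v'" "C1_manifold w"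
  shows "grad_inner v w x = grad_inner v' w x"
proof -
  obtain V \<phi> where c: "chart V \<phi>" "x \<in> V" using chart_at[OF x] .
  note d = smooth_chartD[OF c(1)]
  have "frechet_derivative (v \<circ> chart_inv V \<phi>) (at (\<phi> x)) = frechet_derivative (v' \<circ> chart_inv V \<phi>) (at (\<phi> x))"
    by (rule frechet_derivative_cong_open[OF d(1)]) (use c assms(2) d(2,4) in auto)
  then show ?thesis
    unfolding grad_inner_eq[OF c assms(3,5)] grad_inner_eq[OF c assms(4,5)]
    by (simp add: grad_inner_coord_def grad_coord_def partial_deriv_def)
qed

end

section \<open>Integration in charts and Green's formula\<close>

lemma compact_abs_bounded:
  fixes f :: "'a::topological_space \<Rightarrow> real"
  assumes "compact K" "continuous_on K f"
  obtains B where "\<And>x. x \<in> K \<Longrightarrow> \<bar>f x\<bar> \<le> B"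
  using compact_imp_bounded[OF compact_continuous_image[OF assms(2,1)]]
  unfolding bounded_iff real_norm_def by blast

text \<open>Serves to glue an extension by zero: such a function is C1 inside the chart and,
  separately, off its compact support.\<close>

lemma C1_on_Un:
  assumes "open S" "open T" "C1_on S f" "C1_on T f" shows "C1_on (S \<union> T) f"
proof (rule C1_onI[where f' = "\<lambda>x. frechet_derivative f (at x)"])
  show "(f has_derivative frechet_derivative f (at x)) (at x)" if "x \<in> S \<union> T" for x
    using that assms C1_on_has_derivative by blast
  show "continuous_on (S \<union> T) (\<lambda>x. frechet_derivative f (at x) v)" for v
    using assms C1_on_continuous_derivative by (intro continuous_on_open_Un) auto
qed

lemma integrable_compact_support:
  fixes F :: "'a::euclidean_space \<Rightarrow> real"
  assumes F: "continuous_on UNIV F" and K: "compact K" "\<And>x. x \<notin> K \<Longrightarrow> F x = 0"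
  shows "integrable lborel F"
proof -
  obtain C where C: "\<And>x. x \<in> K \<Longrightarrow> \<bar>F x\<bar> \<le> C"
    by (rule compact_abs_bounded[OF K(1) continuous_on_subset[OF F]]) auto
  show ?thesis
  proof (rule Bochner_Integration.integrable_bound)
    show "integrable lborel (\<lambda>x. \<bar>C\<bar> * indicator K x)"
      using emeasure_bounded_finite[OF compact_imp_bounded[OF K(1)]] K(1)
      by (auto intro!: integrable_mult_right integrable_real_indicator borel_compact)
    show "AE x in lborel. norm (F x) \<le> norm (\<bar>C\<bar> * indicator K x)"
    proof (rule AE_I2)
      fix x show "norm (F x) \<le> norm (\<bar>C\<bar> * indicator K x)"
        using C[of x] K(2)[of x] by (cases "x \<in> K") auto
    qed
    show "F \<in> borel_measurable lborel" using borel_measurable_continuous_onI[OF F] by simp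
  qed
qed

lemma frechet_derivative_zero_outside:
  assumes "closed K" "\<And>x. x \<notin> K \<Longrightarrow> F x = 0" "x \<notin> K"
  shows "frechet_derivative F (at x) a = 0"
proof -
  have "frechet_derivative F (at x) = frechet_derivative (\<lambda>_. 0) (at x)"
    by (rule frechet_derivative_cong_open[of "-K"]) (use assms in auto)
  then show ?thesis by simp
qed

text \<open>By translation invariance of Lebesgue measure every difference quotient of F in
  direction a has integral zero; dominated convergence passes this to the derivative. It is the
  divergence theorem without boundary, one direction at a time.\<close>

lemma integral_derivative_compact_support:
  fixes F :: "'a::euclidean_space \<Rightarrow> real"
  assumes F: "C1_on UNIV F" and K: "compact K" "\<And>x. x \<notin> K \<Longrightarrow> F x = 0"
  shows "(\<integral>x. frechet_derivative F (at x) a \<partial>lborel) = 0"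
proof -
  let ?D = "\<lambda>x. frechet_derivative F (at x) a"
  have der: "(F has_derivative frechet_derivative F (at x)) (at x)" for x
    using C1_on_has_derivative[OF F] by simp
  have contF: "continuous_on UNIV F" by (rule C1_on_continuous_on[OF F])
  have cont: "continuous_on UNIV ?D" by (rule C1_on_continuous_derivative[OF F])
  have D0: "?D x = 0" if "x \<notin> K" for x
    using frechet_derivative_zero_outside[OF compact_imp_closed[OF K(1)] K(2) that] .
  obtain B where B: "\<And>x. x \<in> K \<Longrightarrow> \<bar>?D x\<bar> \<le> B"
    by (rule compact_abs_bounded[OF K(1) continuous_on_subset[OF cont]]) auto
  have B': "\<bar>?D x\<bar> \<le> \<bar>B\<bar>" for x
    by (cases "x \<in> K") (use B[of x] D0[of x] in auto)
  obtain r where r: "\<And>x. x \<in> K \<Longrightarrow> norm x \<le> r"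
    using compact_imp_bounded[OF K(1)] unfolding bounded_iff by blast
  have line: "((\<lambda>t. F (x + t *\<^sub>R a)) has_real_derivative ?D (x + t *\<^sub>R a)) (at t)" for x t
  proof -
    have "((\<lambda>t. x + t *\<^sub>R a) has_derivative (\<lambda>s. s *\<^sub>R a)) (at t)"
      by (auto intro!: derivative_eq_intros)
    from has_derivative_compose[OF this der]
    have "((\<lambda>t. F (x + t *\<^sub>R a)) has_derivative (\<lambda>s. frechet_derivative F (at (x + t *\<^sub>R a)) (s *\<^sub>R a))) (at t)" .
    then show ?thesis
      using linear_scale[OF has_derivative_linear[OF der]]
      by (simp add: has_field_derivative_def mult_commute_abs)
  qed
  define t :: "nat \<Rightarrow> real" where "t k = inverse (real (Suc k))" for k
  have t: "0 < t k" "t k \<le> 1" for k by (auto simp: t_def field_simps)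
  have t0: "t \<longlonglongrightarrow> 0" unfolding t_def by (rule LIMSEQ_inverse_real_of_nat)
  let ?s = "\<lambda>k x. (F (x + t k *\<^sub>R a) - F x) / t k"
  have [measurable]: "F \<in> borel_measurable borel" "?D \<in> borel_measurable borel"
    using contF cont borel_measurable_continuous_onI by auto
  have intF: "integrable lborel F" by (rule integrable_compact_support[OF contF K])
  have shift: "integrable lborel (\<lambda>x. F (x + c))" "(\<integral>x. F (x + c) \<partial>lborel) = (\<integral>x. F x \<partial>lborel)" for c
  proof -
    have d: "distr lborel borel (\<lambda>x. x + c) = (lborel :: 'a measure)"
    proof -
      have "(\<lambda>x::'a. x + c) = (+) c" by (simp add: fun_eq_iff add.commute)
      then show ?thesis using lborel_distr_plus[of c] by simp
    qed
    show "integrable lborel (\<lambda>x. F (x + c))"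
      using integrable_distr_eq[of "\<lambda>x. x + c" lborel borel F] intF d by simp
    show "(\<integral>x. F (x + c) \<partial>lborel) = (\<integral>x. F x \<partial>lborel)"
      using integral_distr[of "\<lambda>x. x + c" lborel borel F] d by simp
  qed
  have lim: "(\<lambda>k. \<integral>x. ?s k x \<partial>lborel) \<longlonglongrightarrow> (\<integral>x. ?D x \<partial>lborel)"
  proof (rule integral_dominated_convergence)
    \<comment> \<open>As \<open>t k\<close> \<le> 1, both x and x + \<open>t k\<close> a miss K once
      the norm of x exceeds r + norm a. Elsewhere the mean value theorem bounds the quotient by the
      bound for the derivative.\<close>
    show "integrable lborel (\<lambda>x. \<bar>B\<bar> * indicator (cball 0 (r + norm a)) x)"
      by (auto intro!: integrable_mult_right integrable_real_indicator emeasure_bounded_finite)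
    show "AE x in lborel. (\<lambda>k. ?s k x) \<longlonglongrightarrow> ?D x"
    proof (rule AE_I2)
      fix x
      have "((\<lambda>h. (F (x + h *\<^sub>R a) - F x) / h) \<longlongrightarrow> ?D x) (at 0)"
        using line[of x 0] by (simp add: DERIV_def)
      moreover have "filterlim t (at 0) sequentially"
        unfolding filterlim_at using t0 t by (auto simp: less_imp_neq[symmetric] less_imp_le)
      ultimately show "(\<lambda>k. ?s k x) \<longlonglongrightarrow> ?D x" by (rule filterlim_compose)
    qed
    show "AE x in lborel. norm (?s k x) \<le> \<bar>B\<bar> * indicator (cball 0 (r + norm a)) x" for k
    proof (rule AE_I2)
      fix x
      obtain z where z: "F (x + t k *\<^sub>R a) - F (x + 0 *\<^sub>R a) = (t k - 0) * ?D (x + z *\<^sub>R a)"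
        using MVT2[OF t(1)[of k], of "\<lambda>s. F (x + s *\<^sub>R a)" "\<lambda>s. ?D (x + s *\<^sub>R a)"] line by blast
      then have "?s k x = ?D (x + z *\<^sub>R a)" using t(1)[of k] by simp
      then have b: "norm (?s k x) \<le> \<bar>B\<bar>" using B'[of "x + z *\<^sub>R a"] by simp
      have "?s k x = 0" if "x \<notin> cball 0 (r + norm a)"
      proof -
        have "x \<notin> K" using r[of x] that norm_ge_zero[of a] by (auto simp del: norm_ge_zero)
        moreover have "x + t k *\<^sub>R a \<notin> K"
        proof
          assume "x + t k *\<^sub>R a \<in> K"
          then have "norm (x + t k *\<^sub>R a) \<le> r" by (rule r)
          moreover have "norm (t k *\<^sub>R a) \<le> norm a" using t[of k] by (simp add: mult_left_le_one_le)
          moreover have "norm x \<le> norm (x + t k *\<^sub>R a) + norm (t k *\<^sub>R a)"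
            using norm_triangle_ineq4[of "x + t k *\<^sub>R a" "t k *\<^sub>R a"] by simp
          ultimately show False using that by simp
        qed
        ultimately show ?thesis using K(2) by simp
      qed
      then show "norm (?s k x) \<le> \<bar>B\<bar> * indicator (cball 0 (r + norm a)) x"
        using b by (cases "x \<in> cball 0 (r + norm a)") auto
    qed
  qed auto
  have z: "(\<integral>x. ?s k x \<partial>lborel) = 0" for k
    using Bochner_Integration.integral_diff[OF shift(1)[of "t k *\<^sub>R a"] intF] shift(2)[of "t k *\<^sub>R a"] by simp
  show ?thesis using lim unfolding z by (simp add: LIMSEQ_const_iff)
qed

section \<open>The volume measure in charts, finite covers and integrability\<close>

context riemannian_manifold
begin

abbreviation vol_density :: "'a set \<Rightarrow> ('a \<Rightarrow> real^'n) \<Rightarrow> real^'n \<Rightarrow> real" where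
  "vol_density V \<phi> u \<equiv> sqrt (det (metric_matrix g V \<phi> u))"

lemma sets_mu: "sets \<mu> = sets (restrict_space borel M)" and space_mu: "space \<mu> = M"
proof -
  show s: "sets \<mu> = sets (restrict_space borel M)" using volume unfolding riemannian_volume_def by blast
  show "space \<mu> = M" using sets_eq_imp_space_eq[OF s] by (simp add: space_restrict_space)
qed

lemma openin_sets_mu: "openin (top_of_set M) D \<Longrightarrow> D \<in> sets \<mu>"
  unfolding sets_mu openin_open sets_restrict_space by auto

lemma measurable_continuous: "continuous_on M f \<Longrightarrow> f \<in> borel_measurable \<mu>"
  using borel_measurable_continuous_on_restrict[of M f] measurable_cong_sets[OF sets_mu refl] by auto

lemma sets_restrict_mu:
  assumes "V \<subseteq> M" shows "sets (restrict_space \<mu> V) = sets (restrict_space borel V)"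
proof -
  have "sets (restrict_space \<mu> V) = sets (restrict_space (restrict_space borel M) V)"
    using sets_mu sets_restrict_space by metis
  also have "\<dots> = sets (restrict_space borel V)"
    using assms by (simp add: sets_restrict_restrict_space Int_absorb1)
  finally show ?thesis .
qed

lemma chart_inv_measurable:
  assumes ch: "chart V \<phi>"
  shows "chart_inv V \<phi> \<in> measurable (restrict_space lborel (\<phi> ` V)) (restrict_space \<mu> V)"
proof -
  note c = smooth_chartD[OF ch]
  have "chart_inv V \<phi> \<in> borel_measurable (restrict_space borel (\<phi> ` V))"
    by (rule borel_measurable_continuous_on_restrict[OF c(8)])
  moreover have "space (restrict_space borel (\<phi> ` V)) = \<phi> ` V" by (simp add: space_restrict_space)
  ultimately have "chart_inv V \<phi> \<in> measurable (restrict_space borel (\<phi> ` V)) (restrict_space borel V)"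
    using c(4) by (intro measurable_restrict_space2) auto
  moreover have "sets (restrict_space \<mu> V) = sets (restrict_space borel V)" by (rule sets_restrict_mu[OF c(2)])
  moreover have "sets (restrict_space lborel (\<phi> ` V)) = sets (restrict_space borel (\<phi> ` V))"
    by (simp add: sets_restrict_space)
  ultimately show ?thesis using measurable_cong_sets by blast
qed

lemma vol_density_measurable:
  assumes ch: "chart V \<phi>"
  shows "vol_density V \<phi> \<in> borel_measurable (restrict_space lborel (\<phi> ` V))"
  using borel_measurable_continuous_on_restrict[OF C1_on_continuous_on[OF C1_on_sqrt_det[OF ch]]]
    measurable_cong_sets[of "restrict_space lborel (\<phi> ` V)" "restrict_space borel (\<phi> ` V)"]
  by (simp add: sets_restrict_space)

lemma chart_image_eq:
  assumes "chart V \<phi>" "A \<subseteq> V" shows "\<phi> ` A = chart_inv V \<phi> -` A \<inter> \<phi> ` V"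
  using smooth_chartD(5,6)[OF assms(1)] assms(2) by force

text \<open>Recasts the defining formula for the volume of sets as an equality of measures, so that
  the general rules for image measures and densities give the change of variables for
  integrals.\<close>

lemma restrict_mu_chart:
  assumes ch: "chart V \<phi>"
  shows "restrict_space \<mu> V = distr (density (restrict_space lborel (\<phi> ` V)) (\<lambda>u. ennreal (vol_density V \<phi> u)))
     (restrict_space \<mu> V) (chart_inv V \<phi>)"
proof (rule measure_eqI)
  note c = smooth_chartD[OF ch] and [measurable] = chart_inv_measurable[OF ch] vol_density_measurable[OF ch]
  have V: "V \<in> sets \<mu>" using openin_sets_mu[OF c(3)] .
  have VM: "V \<inter> space \<mu> \<in> sets \<mu>" using V by auto
  have U: "\<phi> ` V \<inter> space lborel \<in> sets lborel" using c(1) by simp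
  fix A assume A: "A \<in> sets (restrict_space \<mu> V)"
  then have A': "A \<in> sets \<mu>" "A \<subseteq> V" using sets_restrict_space_iff[OF VM] by auto
  have m: "chart_inv V \<phi> -` A \<inter> \<phi> ` V \<in> sets (restrict_space lborel (\<phi> ` V))"
    using measurable_sets[OF chart_inv_measurable[OF ch] A] by (simp add: space_restrict_space)
  have "emeasure \<mu> A = (\<integral>\<^sup>+u\<in>\<phi> ` A. ennreal (vol_density V \<phi> u) \<partial>lborel)"
    using volume ch A' unfolding riemannian_volume_def by blast
  also have "\<dots> = (\<integral>\<^sup>+u. ennreal (vol_density V \<phi> u) * indicator (chart_inv V \<phi> -` A \<inter> \<phi> ` V) u \<partial>(restrict_space lborel (\<phi> ` V)))"
    unfolding chart_image_eq[OF ch A'(2)] nn_integral_restrict_space[OF U]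
    by (intro nn_integral_cong) (auto simp: indicator_def)
  also have "\<dots> = emeasure (density (restrict_space lborel (\<phi> ` V)) (\<lambda>u. ennreal (vol_density V \<phi> u)))
      (chart_inv V \<phi> -` A \<inter> \<phi> ` V)"
    using m by (simp add: emeasure_density)
  also have "\<dots> = emeasure (distr (density (restrict_space lborel (\<phi> ` V)) (\<lambda>u. ennreal (vol_density V \<phi> u)))
     (restrict_space \<mu> V) (chart_inv V \<phi>)) A"
    using A by (subst emeasure_distr) (auto simp: space_restrict_space)
  finally show "emeasure (restrict_space \<mu> V) A = \<dots>"
    using A' VM by (simp add: emeasure_restrict_space)
qed simp

lemma integral_chart:
  fixes f :: "'a \<Rightarrow> real"
  assumes ch: "chart V \<phi>" and f: "f \<in> borel_measurable \<mu>"
  shows "(\<integral>x. indicator V x * f x \<partial>\<mu>)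
      = (\<integral>u. indicator (\<phi> ` V) u * (vol_density V \<phi> u * f (chart_inv V \<phi> u)) \<partial>lborel)"
    and "integrable \<mu> (\<lambda>x. indicator V x * f x) \<longleftrightarrow>
      integrable lborel (\<lambda>u. indicator (\<phi> ` V) u * (vol_density V \<phi> u * f (chart_inv V \<phi> u)))"
proof -
  note c = smooth_chartD[OF ch] and [measurable] = chart_inv_measurable[OF ch] vol_density_measurable[OF ch]
  have VM: "V \<inter> space \<mu> \<in> sets \<mu>" using openin_sets_mu[OF c(3)] by auto
  have U: "\<phi> ` V \<inter> space lborel \<in> sets lborel" using c(1) by simp
  have [measurable]: "f \<in> borel_measurable (restrict_space \<mu> V)" using f measurable_restrict_space1 by blast
  have nn: "AE u in restrict_space lborel (\<phi> ` V). 0 \<le> vol_density V \<phi> u"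
    using det_metric_pos[OF ch] by (intro AE_I2) (auto simp: space_restrict_space less_imp_le)
  have "(\<integral>x. indicator V x * f x \<partial>\<mu>) = (\<integral>x. f x \<partial>(restrict_space \<mu> V))"
    by (simp add: integral_restrict_space[OF VM])
  also have "\<dots> = (\<integral>u. vol_density V \<phi> u * f (chart_inv V \<phi> u) \<partial>(restrict_space lborel (\<phi> ` V)))"
    by (subst restrict_mu_chart[OF ch]) (use nn in \<open>simp add: integral_distr integral_density\<close>)
  finally show "(\<integral>x. indicator V x * f x \<partial>\<mu>)
      = (\<integral>u. indicator (\<phi> ` V) u * (vol_density V \<phi> u * f (chart_inv V \<phi> u)) \<partial>lborel)"
    by (simp add: integral_restrict_space[OF U])
  have "integrable \<mu> (\<lambda>x. indicator V x * f x) \<longleftrightarrow> integrable (restrict_space \<mu> V) f"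
    by (simp add: integrable_restrict_space[OF VM])
  also have "\<dots> \<longleftrightarrow> integrable (restrict_space lborel (\<phi> ` V)) (\<lambda>u. vol_density V \<phi> u * f (chart_inv V \<phi> u))"
    by (subst restrict_mu_chart[OF ch]) (use nn in \<open>simp add: integrable_distr_eq integrable_density\<close>)
  finally show "integrable \<mu> (\<lambda>x. indicator V x * f x) \<longleftrightarrow>
      integrable lborel (\<lambda>u. indicator (\<phi> ` V) u * (vol_density V \<phi> u * f (chart_inv V \<phi> u)))"
    by (simp add: integrable_restrict_space[OF U])
qed

text \<open>The form in which compactness turns local statements into global ones: finiteness of the
  volume, Green's formula, the counting estimate and the transport of the measure all pass through
  it.\<close>

lemma finite_subcover:
  assumes "\<And>p. p \<in> M \<Longrightarrow> \<exists>D. openin (top_of_set M) D \<and> p \<in> D \<and> P D"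
  shows "\<exists>\<D>. finite \<D> \<and> \<Union>\<D> = M \<and> (\<forall>D\<in>\<D>. openin (top_of_set M) D \<and> P D)"
proof -
  let ?C = "{D. openin (top_of_set M) D \<and> P D}"
  have "\<exists>\<D>\<subseteq>?C. finite \<D> \<and> M \<subseteq> \<Union>\<D>"
    using compact_M assms unfolding compact_eq_openin_cover by (auto dest!: spec[of _ ?C])
  then obtain \<D> where \<D>: "\<D> \<subseteq> ?C" "finite \<D>" "M \<subseteq> \<Union>\<D>" by blast
  have "D \<subseteq> M" if "D \<in> \<D>" for D using that \<D>(1) openin_subset[of "top_of_set M" D] by auto
  then have "\<Union>\<D> = M" using \<D>(3) by blast
  moreover have "openin (top_of_set M) D \<and> P D" if "D \<in> \<D>" for D using that \<D>(1) by auto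
  ultimately show ?thesis using \<D>(2) by blast
qed

lemma chart_ball:
  assumes p: "p \<in> M"
  obtains V \<phi> e where "chart V \<phi>" "p \<in> V" "0 < e" "cball (\<phi> p) e \<subseteq> \<phi> ` V"
    "openin (top_of_set M) {x \<in> V. \<phi> x \<in> ball (\<phi> p) e}"
proof -
  obtain V \<phi> where ch: "chart V \<phi>" and pV: "p \<in> V" using chart_at[OF p] .
  note c = smooth_chartD[OF ch]
  obtain e where e: "e > 0" "cball (\<phi> p) e \<subseteq> \<phi> ` V"
    using c(1) pV open_contains_cball by blast
  have "openin (top_of_set V) (V \<inter> \<phi> -` ball (\<phi> p) e)"
    using continuous_openin_preimage_gen[OF c(7)] by blast
  moreover have "V \<inter> \<phi> -` ball (\<phi> p) e = {x \<in> V. \<phi> x \<in> ball (\<phi> p) e}" by auto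
  ultimately have "openin (top_of_set M) {x \<in> V. \<phi> x \<in> ball (\<phi> p) e}"
    using c(3) openin_trans by metis
  then show ?thesis using that ch pV e by blast
qed

text \<open>The density is bounded on a closed coordinate ball, so the open ball inside it has
  finite volume, and finitely many of these cover M. This is what makes continuous functions
  integrable.\<close>

lemma finite_measure_mu: "finite_measure \<mu>"
proof -
  have "\<exists>D. openin (top_of_set M) D \<and> p \<in> D \<and> emeasure \<mu> D < \<infinity>" if p: "p \<in> M" for p
  proof -
    obtain V \<phi> e where ch: "chart V \<phi>" and pV: "p \<in> V" and e: "0 < e" "cball (\<phi> p) e \<subseteq> \<phi> ` V"
      and oD: "openin (top_of_set M) {x \<in> V. \<phi> x \<in> ball (\<phi> p) e}" using chart_ball[OF p] .
    define D where "D = {x \<in> V. \<phi> x \<in> ball (\<phi> p) e}"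
    have D: "openin (top_of_set M) D" using oD unfolding D_def .
    have cc: "continuous_on (cball (\<phi> p) e) (vol_density V \<phi>)"
      using continuous_on_subset[OF C1_on_continuous_on[OF C1_on_sqrt_det[OF ch]] e(2)] .
    obtain B where B: "\<And>u. u \<in> cball (\<phi> p) e \<Longrightarrow> \<bar>vol_density V \<phi> u\<bar> \<le> B"
      by (rule compact_abs_bounded[OF compact_cball cc]) blast
    have "emeasure \<mu> D = (\<integral>\<^sup>+u\<in>\<phi> ` D. ennreal (vol_density V \<phi> u) \<partial>lborel)"
      using volume ch openin_sets_mu[OF D] unfolding riemannian_volume_def by (auto simp: D_def)
    also have "\<dots> \<le> (\<integral>\<^sup>+u. ennreal B * indicator (cball (\<phi> p) e) u \<partial>lborel)"
    proof (intro nn_integral_mono)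
      fix u show "ennreal (vol_density V \<phi> u) * indicator (\<phi> ` D) u \<le> ennreal B * indicator (cball (\<phi> p) e) u"
        using B[of u] by (auto simp: indicator_def D_def intro!: ennreal_leI)
    qed
    also have "\<dots> = ennreal B * emeasure lborel (cball (\<phi> p) e)"
      by (simp add: nn_integral_cmult_indicator)
    also have "\<dots> < \<infinity>" using emeasure_bounded_finite[of "cball (\<phi> p) e"]
      by (simp add: ennreal_mult_less_top)
    finally show ?thesis using D pV e(1) by (intro exI[of _ D]) (auto simp: D_def)
  qed
  then obtain \<D> where \<D>: "finite \<D>" "\<Union>\<D> = M"
      "\<And>D. D \<in> \<D> \<Longrightarrow> openin (top_of_set M) D \<and> emeasure \<mu> D < \<infinity>"
    using finite_subcover[of "\<lambda>D. emeasure \<mu> D < \<infinity>"] by metis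
  have "emeasure \<mu> (\<Union>D\<in>\<D>. D) \<le> (\<Sum>D\<in>\<D>. emeasure \<mu> D)"
    by (rule emeasure_subadditive_finite) (use \<D> openin_sets_mu in auto)
  also have "\<dots> < \<infinity>" using \<D> by (simp add: less_top)
  finally show ?thesis using \<D>(2) space_mu by (intro finite_measureI) auto
qed

sublocale mu: finite_measure \<mu> by (rule finite_measure_mu)

lemma integrable_continuous:
  fixes f :: "'a \<Rightarrow> real"
  assumes "continuous_on M f" shows "integrable \<mu> f"
proof -
  obtain B where "\<And>x. x \<in> M \<Longrightarrow> \<bar>f x\<bar> \<le> B"
    by (rule compact_abs_bounded[OF compact_M assms]) blast
  then show ?thesis
    using measurable_continuous[OF assms] space_mu by (intro mu.integrable_const_bound[of _ B]) auto
qed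

end

section \<open>Cutoff functions and Green's formula\<close>

lemma C1_on_max_square: "C1_on UNIV (\<lambda>t::real. (max 0 t)\<^sup>2)"
proof (rule C1_on_real[where f' = "\<lambda>t. 2 * max 0 t"])
  fix t :: real
  consider "t < 0" | "t = 0" | "t > 0" by linarith
  then show "((\<lambda>t. (max 0 t)\<^sup>2) has_real_derivative 2 * max 0 t) (at t)"
  proof cases
    case 1
    have "((\<lambda>t. 0) has_real_derivative 2 * max 0 t) (at t)" using 1 by auto
    then show ?thesis by (rule has_field_derivative_transform_within_open[of _ _ _ "{..<0}"]) (use 1 in auto)
  next
    case 2
    have "((\<lambda>h::real. max 0 h) \<longlongrightarrow> max 0 0) (at 0)" by (intro tendsto_intros)
    moreover have "(max 0 h)\<^sup>2 / h = max 0 h" for h :: real by (auto simp: max_def power2_eq_square)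
    ultimately show ?thesis using 2 by (simp add: DERIV_def)
  next
    case 3
    have "((\<lambda>t. t\<^sup>2) has_real_derivative 2 * max 0 t) (at t)" using 3 by (auto intro!: derivative_eq_intros)
    then show ?thesis by (rule has_field_derivative_transform_within_open[of _ _ _ "{0<..}"]) (use 3 in auto)
  qed
qed (auto intro!: continuous_intros)

text \<open>Squaring removes the kink of the maximum at 0, so this is C1, the regularity that
  Green's formula asks of a test function. For positive \<rho> it is positive exactly on the open
  ball, as a partition of unity subordinate to balls requires.\<close>

definition bump :: "'a::euclidean_space \<Rightarrow> real \<Rightarrow> 'a \<Rightarrow> real" where
  "bump p \<rho> x = (max 0 (\<rho>\<^sup>2 - (x - p) \<bullet> (x - p)))\<^sup>2"

lemma C1_on_bump: "C1_on UNIV (bump p \<rho>)"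
proof -
  have "C1_on UNIV (\<lambda>x::'a. \<rho>\<^sup>2 - (x - p) \<bullet> (x - p))"
    by (rule C1_onI[where f' = "\<lambda>x v. - 2 * ((x - p) \<bullet> v)"])
      (auto intro!: derivative_eq_intros continuous_intros simp: inner_commute)
  from C1_on_compose[OF C1_on_max_square this] show ?thesis by (simp add: bump_def[abs_def])
qed

lemma bump_nonneg: "0 \<le> bump p \<rho> x"
  by (simp add: bump_def)

lemma bump_pos_iff: "0 < \<rho> \<Longrightarrow> 0 < bump p \<rho> x \<longleftrightarrow> x \<in> ball p \<rho>"
proof -
  assume "0 < \<rho>"
  have "0 < bump p \<rho> x \<longleftrightarrow> (norm (x - p))\<^sup>2 < \<rho>\<^sup>2"
    by (auto simp: bump_def power2_norm_eq_inner max_def)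
  also have "\<dots> \<longleftrightarrow> norm (x - p) < \<rho>"
    using \<open>0 < \<rho>\<close> power2_less_imp_less[of "norm (x - p)" \<rho>] power_strict_mono[of "norm (x - p)" \<rho> 2] by auto
  finally show ?thesis by (simp add: dist_norm norm_minus_commute)
qed

context riemannian_manifold
begin

lemma grad_inner_zero_outside:
  assumes v: "C1_manifold v" and u: "C1_manifold u" and K: "closed K" "\<And>x. x \<in> M \<Longrightarrow> x \<notin> K \<Longrightarrow> v x = 0"
    and x: "x \<in> M" "x \<notin> K"
  shows "grad_inner v u x = 0"
proof -
  obtain V \<phi> where c: "chart V \<phi>" "x \<in> V" using chart_at[OF x(1)] .
  note d = smooth_chartD[OF c(1)]
  define W where "W = {u \<in> \<phi> ` V. chart_inv V \<phi> u \<in> M \<inter> -K}"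
  have "openin (top_of_set M) (M \<inter> -K)" using K(1) by (simp add: openin_open_Int open_Compl)
  then have "open W" unfolding W_def by (rule openin_chart_inv_vimage[OF c(1)])
  moreover have "\<phi> x \<in> W" using x c d(6) by (auto simp: W_def)
  ultimately have "frechet_derivative (v \<circ> chart_inv V \<phi>) (at (\<phi> x)) = frechet_derivative (\<lambda>_. 0) (at (\<phi> x))"
    by (rule frechet_derivative_cong_open) (use K in \<open>auto simp: W_def\<close>)
  then have "grad_coord V \<phi> v (\<phi> x) = 0" by (simp add: grad_coord_def partial_deriv_def vec_eq_iff)
  then show ?thesis using grad_inner_eq[OF c v u] by (simp add: grad_inner_coord_def)
qed

text \<open>In coordinates the sum of the two integrands, times the volume density, is the
  divergence of the field v X, where X is the density times the gradient of u. Since v has compact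
  support in the chart, that divergence integrates to zero.\<close>

lemma green_chart:
  assumes ch: "chart V \<phi>" and v: "C1_manifold v" and K: "compact K" "K \<subseteq> V"
    and v0: "\<And>x. x \<in> M \<Longrightarrow> x \<notin> K \<Longrightarrow> v x = 0"
    and lap: "has_laplacian n M g u h" and h: "continuous_on M h"
  shows "(\<integral>x. v x * h x \<partial>\<mu>) = - (\<integral>x. grad_inner v u x \<partial>\<mu>)"
proof -
  let ?\<sigma> = "chart_inv V \<phi>" and ?U = "\<phi> ` V" and ?w = "vol_density V \<phi>"
  note c = smooth_chartD[OF ch]
  have su: "smooth_map n M u" using lap unfolding has_laplacian_def by blast
  have u: "C1_manifold u" using C1_manifold_smooth_map[OF su] .
  have su': "smooth_on ?U (u \<circ> ?\<sigma>)" using su ch unfolding smooth_map_def by blast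
  define X where "X i p = ?w p * (\<Sum>j\<in>UNIV. matrix_inv (metric_matrix g V \<phi> p) $ i $ j * partial_deriv j (u \<circ> ?\<sigma>) p)" for i p
  have X: "C1_on ?U (X i)" for i
    unfolding X_def[abs_def] partial_deriv_def
    by (intro C1_on_mult C1_on_sum C1_on_sqrt_det[OF ch] C1_on_metric_inv[OF ch]
        smooth_on_imp_C1_on[OF smooth_on_frechet_derivative[OF su']])
  define L where "L = \<phi> ` K"
  have L: "compact L" "L \<subseteq> ?U" unfolding L_def
    using compact_continuous_image[OF continuous_on_subset[OF c(7) K(2)] K(1)] K(2) by auto
  have vL: "v (?\<sigma> p) = 0" if "p \<in> ?U" "p \<notin> L" for p
  proof (rule v0)
    show "?\<sigma> p \<in> M" using c(2,4) that(1) by blast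
    show "?\<sigma> p \<notin> K" using c(5)[OF that(1)] that(2) unfolding L_def by (metis imageI)
  qed
  \<comment> \<open>Extension by zero. The chart image and the complement of the compact set L cover
    the whole space, and F is C1 on each of the two.\<close>
  define F where "F i p = (if p \<in> ?U then v (?\<sigma> p) * X i p else 0)" for i p
  have F0: "F i p = 0" if "p \<notin> L" for i p using vL that by (simp add: F_def)
  have v': "C1_on ?U (\<lambda>p. v (?\<sigma> p))" using C1_manifoldD[OF v ch] by (simp add: comp_def)
  have F: "C1_on UNIV (F i)" for i
  proof -
    have "C1_on ?U (F i)"
      by (rule C1_on_cong_open[OF c(1) _ C1_on_mult[OF v' X[of i]]]) (simp add: F_def)
    moreover have oL: "open (- L)" using L(1) compact_imp_closed by auto
    moreover have "C1_on (- L) (F i)"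
      by (rule C1_on_cong_open[OF oL _ C1_on_const[of _ 0]]) (simp add: F0)
    ultimately have "C1_on (?U \<union> - L) (F i)" using C1_on_Un c(1) by blast
    moreover have "?U \<union> - L = UNIV" using L(2) by blast
    ultimately show ?thesis by simp
  qed
  have int0: "(\<integral>p. partial_deriv i (F i) p \<partial>lborel) = 0" for i
    unfolding partial_deriv_def by (rule integral_derivative_compact_support[OF F L(1) F0])
  have intF: "integrable lborel (partial_deriv i (F i))" for i
    unfolding partial_deriv_def
    by (rule integrable_compact_support[OF C1_on_continuous_derivative[OF F] L(1)])
      (rule frechet_derivative_zero_outside[OF compact_imp_closed[OF L(1)] F0])
  let ?A = "\<lambda>p. indicator ?U p * (?w p * (v (?\<sigma> p) * h (?\<sigma> p)))"
  let ?B = "\<lambda>p. indicator ?U p * (?w p * grad_inner v u (?\<sigma> p))"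
  \<comment> \<open>Product rule: the derivatives that fall on X assemble to the Laplacian, by the
    formula for \<open>laplace_coord\<close>, and those that fall on v to the gradient
    pairing.\<close>
  have pt: "(\<Sum>i\<in>UNIV. partial_deriv i (F i) p) = ?A p + ?B p" for p
  proof (cases "p \<in> ?U")
    case False
    then have "p \<notin> L" using L(2) by blast
    have "partial_deriv i (F i) p = 0" for i
      unfolding partial_deriv_def
      by (rule frechet_derivative_zero_outside[OF compact_imp_closed[OF L(1)] F0]) (use \<open>p \<notin> L\<close> in auto)
    then show ?thesis using False by simp
  next
    case p: True
    have x: "?\<sigma> p \<in> V" "?\<sigma> p \<in> M" "\<phi> (?\<sigma> p) = p" using c(2,4,5) p by auto
    have w: "0 < ?w p" using det_metric_pos[OF ch p] by simp
    have pd: "partial_deriv i (F i) p = v (?\<sigma> p) * partial_deriv i (X i) p + partial_deriv i (v \<circ> ?\<sigma>) p * X i p" for i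
    proof -
      have "((\<lambda>p. v (?\<sigma> p)) has_derivative frechet_derivative (v \<circ> ?\<sigma>) (at p)) (at p)"
        using C1_manifold_derivative[OF v ch p] by (simp add: comp_def)
      note frechet_derivative_at[OF has_derivative_mult[OF this C1_on_has_derivative[OF X[of i] p]], symmetric]
      then have "frechet_derivative (\<lambda>p. v (?\<sigma> p) * X i p) (at p) = (\<lambda>a. v (?\<sigma> p) * frechet_derivative (X i) (at p) a
          + frechet_derivative (v \<circ> ?\<sigma>) (at p) a * X i p)" .
      moreover have "frechet_derivative (F i) (at p) = frechet_derivative (\<lambda>p. v (?\<sigma> p) * X i p) (at p)"
        by (rule frechet_derivative_cong_open[OF c(1) p]) (simp add: F_def)
      ultimately show ?thesis by (simp add: partial_deriv_def)
    qed
    have "h (?\<sigma> p) = laplace_coord g V \<phi> (u \<circ> ?\<sigma>) (\<phi> (?\<sigma> p))"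
      using lap ch x(1) unfolding has_laplacian_def by blast
    then have "h (?\<sigma> p) = laplace_coord g V \<phi> (u \<circ> ?\<sigma>) p" unfolding x(3) .
    also have "\<dots> = (\<Sum>i\<in>UNIV. partial_deriv i (X i) p) / ?w p"
      by (simp add: laplace_coord_def X_def[abs_def])
    finally have "(\<Sum>i\<in>UNIV. partial_deriv i (X i) p) = ?w p * h (?\<sigma> p)" using w by simp
    moreover have "(\<Sum>i\<in>UNIV. partial_deriv i (v \<circ> ?\<sigma>) p * X i p) = ?w p * grad_inner v u (?\<sigma> p)"
      unfolding grad_inner_eq[OF ch x(1) v u] x(3) grad_inner_coord_sum X_def
      by (simp add: sum_distrib_left ac_simps)
    ultimately show ?thesis using p by (simp add: pd sum.distrib flip: sum_distrib_left)
  qed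
  have cont: "continuous_on M (\<lambda>x. v x * h x)" "continuous_on M (grad_inner v u)"
    using C1_manifold_continuous[OF v] h continuous_on_grad_inner[OF v u] by (auto intro: continuous_intros)
  have V: "V \<in> sets \<mu>" using openin_sets_mu[OF c(3)] .
  have i: "integrable \<mu> (\<lambda>x. indicator V x * f x)" if "continuous_on M f" for f :: "_ \<Rightarrow> real"
    using integrable_real_mult_indicator[OF V integrable_continuous[OF that]] by (simp add: mult.commute)
  have "integrable lborel ?A" "integrable lborel ?B"
    using integral_chart(2)[OF ch measurable_continuous[OF cont(1)]]
      integral_chart(2)[OF ch measurable_continuous[OF cont(2)]] i[OF cont(1)] i[OF cont(2)] by auto
  then have "(\<integral>p. ?A p \<partial>lborel) + (\<integral>p. ?B p \<partial>lborel) = (\<integral>p. ?A p + ?B p \<partial>lborel)" by simp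
  also have "\<dots> = (\<Sum>i\<in>UNIV. \<integral>p. partial_deriv i (F i) p \<partial>lborel)"
    unfolding pt[symmetric] by (rule Bochner_Integration.integral_sum) (rule intF)
  finally have "(\<integral>p. ?A p \<partial>lborel) + (\<integral>p. ?B p \<partial>lborel) = 0" by (simp add: int0)
  moreover have "(\<integral>x. v x * h x \<partial>\<mu>) = (\<integral>x. indicator V x * (v x * h x) \<partial>\<mu>)"
    using v0 K(2) by (intro Bochner_Integration.integral_cong) (auto simp: space_mu indicator_def)
  moreover have "(\<integral>x. grad_inner v u x \<partial>\<mu>) = (\<integral>x. indicator V x * grad_inner v u x \<partial>\<mu>)"
    using grad_inner_zero_outside[OF v u compact_imp_closed[OF K(1)] v0] K(2)
    by (intro Bochner_Integration.integral_cong) (auto simp: space_mu indicator_def)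
  ultimately show ?thesis
    using integral_chart(1)[OF ch measurable_continuous[OF cont(1)]]
      integral_chart(1)[OF ch measurable_continuous[OF cont(2)]] by linarith
qed

text \<open>A partition of unity: v is the sum of the functions bump times v / s, where s is the sum
  of all bumps and is positive on M because the balls cover it. Each summand is supported in a
  single chart, and the gradient pairing is additive in its first argument.\<close>

theorem green:
  assumes v: "C1_manifold v" and lap: "has_laplacian n M g u h" and h: "continuous_on M h"
  shows "(\<integral>x. v x * h x \<partial>\<mu>) = - (\<integral>x. grad_inner v u x \<partial>\<mu>)"
proof -
  have u: "C1_manifold u" using C1_manifold_smooth_map lap unfolding has_laplacian_def by blast
  \<comment> \<open>The closed ball has to stay in the chart domain: its intersection with M is the
    compact set that carries the cutoff.\<close>
  define Q where "Q D p \<rho> V \<phi> \<longleftrightarrow> D = M \<inter> ball p \<rho> \<and> 0 < \<rho> \<and> chart V \<phi> \<and> M \<inter> cball p \<rho> \<subseteq> V" for D p \<rho> V \<phi>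
  have "\<exists>D. openin (top_of_set M) D \<and> p \<in> D \<and> (\<exists>p \<rho> V \<phi>. Q D p \<rho> V \<phi>)" if p: "p \<in> M" for p
  proof -
    obtain V \<phi> where c: "chart V \<phi>" "p \<in> V" using chart_at[OF p] .
    then obtain \<rho> where "0 < \<rho>" "cball p \<rho> \<inter> M \<subseteq> V"
      using smooth_chartD(3)[OF c(1)] openin_contains_cball by metis
    then have "Q (M \<inter> ball p \<rho>) p \<rho> V \<phi>" "p \<in> M \<inter> ball p \<rho>" using c p by (auto simp: Q_def)
    moreover have "openin (top_of_set M) (M \<inter> ball p \<rho>)" by (simp add: openin_open_Int)
    ultimately show ?thesis by blast
  qed
  then obtain \<D> where \<D>: "finite \<D>" "\<Union>\<D> = M"
      "\<And>D. D \<in> \<D> \<Longrightarrow> openin (top_of_set M) D \<and> (\<exists>p \<rho> V \<phi>. Q D p \<rho> V \<phi>)"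
    using finite_subcover[of "\<lambda>D. \<exists>p \<rho> V \<phi>. Q D p \<rho> V \<phi>"] by metis
  then obtain p \<rho> V \<phi> where "\<And>D. D \<in> \<D> \<Longrightarrow> Q D (p D) (\<rho> D) (V D) (\<phi> D)" by metis
  then have D: "D = M \<inter> ball (p D) (\<rho> D)" "0 < \<rho> D" "chart (V D) (\<phi> D)" "M \<inter> cball (p D) (\<rho> D) \<subseteq> V D"
    if "D \<in> \<D>" for D
    using that unfolding Q_def by blast+
  define s where "s x = (\<Sum>D\<in>\<D>. bump (p D) (\<rho> D) x)" for x
  have s: "0 < s x" if x: "x \<in> M" for x
  proof -
    obtain D0 where D0: "D0 \<in> \<D>" "x \<in> D0" using x \<D>(2) by blast
    then have "0 < bump (p D0) (\<rho> D0) x" using D[OF D0(1)] bump_pos_iff by blast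
    then show ?thesis unfolding s_def by (rule sum_pos2[OF \<D>(1) D0(1)]) (rule bump_nonneg)
  qed
  have bC: "C1_manifold (bump a r)" for a r by (rule C1_manifold_ambient[OF C1_on_bump])
  have sC: "C1_manifold s" unfolding s_def[abs_def] by (rule C1_manifold_sum) (rule bC)
  define w where "w D x = bump (p D) (\<rho> D) x * (v x / s x)" for D x
  have wC: "C1_manifold (w D)" for D
    unfolding w_def[abs_def] using s by (intro C1_manifold_mult bC C1_manifold_divide v sC) fastforce
  have sumw: "(\<Sum>D\<in>\<D>. w D x) = v x" if "x \<in> M" for x
  proof -
    have "(\<Sum>D\<in>\<D>. w D x) = s x * (v x / s x)" unfolding w_def by (simp only: s_def sum_distrib_right)
    then show ?thesis using s[OF that] by simp
  qed
  have g: "(\<integral>x. w D x * h x \<partial>\<mu>) = - (\<integral>x. grad_inner (w D) u x \<partial>\<mu>)" if DD: "D \<in> \<D>" for D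
  proof (rule green_chart[OF D(3)[OF DD] wC _ D(4)[OF DD] _ lap h])
    show "compact (M \<inter> cball (p D) (\<rho> D))" using compact_M by (simp add: compact_Int)
    fix x assume "x \<in> M" "x \<notin> M \<inter> cball (p D) (\<rho> D)"
    then have "x \<notin> ball (p D) (\<rho> D)" by auto
    then have "bump (p D) (\<rho> D) x = 0" using bump_pos_iff[OF D(2)[OF DD]] bump_nonneg by (metis less_eq_real_def)
    then show "w D x = 0" by (simp add: w_def)
  qed
  have "(\<integral>x. v x * h x \<partial>\<mu>) = (\<integral>x. (\<Sum>D\<in>\<D>. w D x * h x) \<partial>\<mu>)"
    by (intro Bochner_Integration.integral_cong) (simp_all add: space_mu sumw flip: sum_distrib_right)
  also have "\<dots> = (\<Sum>D\<in>\<D>. \<integral>x. w D x * h x \<partial>\<mu>)"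
    by (intro Bochner_Integration.integral_sum integrable_continuous continuous_intros C1_manifold_continuous wC h)
  also have "\<dots> = - (\<Sum>D\<in>\<D>. \<integral>x. grad_inner (w D) u x \<partial>\<mu>)"
    by (simp add: g sum_negf)
  also have "(\<Sum>D\<in>\<D>. \<integral>x. grad_inner (w D) u x \<partial>\<mu>) = (\<integral>x. (\<Sum>D\<in>\<D>. grad_inner (w D) u x) \<partial>\<mu>)"
    by (intro Bochner_Integration.integral_sum[symmetric] integrable_continuous continuous_on_grad_inner wC u)
  also have "\<dots> = (\<integral>x. grad_inner v u x \<partial>\<mu>)"
  proof (rule Bochner_Integration.integral_cong[OF refl])
    fix x assume "x \<in> space \<mu>"
    then have x: "x \<in> M" by (simp add: space_mu)
    have "(\<Sum>D\<in>\<D>. grad_inner (w D) u x) = grad_inner (\<lambda>x. \<Sum>D\<in>\<D>. w D x) u x"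
      by (rule grad_inner_sum_left[OF x wC u, symmetric])
    also have "\<dots> = grad_inner v u x"
      by (rule grad_inner_cong_left[OF x sumw C1_manifold_sum[OF wC] v u])
    finally show "(\<Sum>D\<in>\<D>. grad_inner (w D) u x) = grad_inner v u x" .
  qed
  finally show ?thesis .
qed

lemma eigenfunction_C1: "has_laplacian n M g u h \<Longrightarrow> C1_manifold u"
  using C1_manifold_smooth_map unfolding has_laplacian_def by blast

lemma green_eigenfunction:
  assumes "C1_manifold v" "has_laplacian n M g u (\<lambda>x. - a * u x)"
  shows "(\<integral>x. grad_inner v u x \<partial>\<mu>) = a * (\<integral>x. v x * u x \<partial>\<mu>)"
proof -
  have "continuous_on M (\<lambda>x. - a * u x)"
    using C1_manifold_continuous[OF eigenfunction_C1[OF assms(2)]] by (intro continuous_intros)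
  from green[OF assms this] have "(\<integral>x. grad_inner v u x \<partial>\<mu>) = - (\<integral>x. (- a) * (v x * u x) \<partial>\<mu>)"
    by (simp add: ac_simps)
  then show ?thesis by (simp only: integral_mult_right_zero)
qed

text \<open>Green's formula with either function as the test function evaluates the same symmetric
  energy, once as a and once as b times the integral of u v.\<close>

lemma eigenfunctions_orthogonal:
  assumes u: "has_laplacian n M g u (\<lambda>x. - a * u x)" and v: "has_laplacian n M g v (\<lambda>x. - b * v x)"
    and "a \<noteq> b"
  shows "(\<integral>x. u x * v x \<partial>\<mu>) = 0"
proof -
  have "(\<integral>x. grad_inner v u x \<partial>\<mu>) = (\<integral>x. grad_inner u v x \<partial>\<mu>)"
    using grad_inner_sym eigenfunction_C1[OF u] eigenfunction_C1[OF v]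
    by (intro Bochner_Integration.integral_cong) (auto simp: space_mu)
  then have "a * (\<integral>x. u x * v x \<partial>\<mu>) = b * (\<integral>x. u x * v x \<partial>\<mu>)"
    using green_eigenfunction[OF eigenfunction_C1[OF v] u] green_eigenfunction[OF eigenfunction_C1[OF u] v]
    by (simp add: mult.commute[of "v _"])
  then show ?thesis using assms(3) by simp
qed

end

section \<open>A Poincare inequality on convex sets and Bessel's inequality\<close>

lemma (in finite_measure) integrable_bounded:
  fixes f :: "'a \<Rightarrow> real"
  assumes "f \<in> borel_measurable M" "\<And>x. x \<in> space M \<Longrightarrow> \<bar>f x\<bar> \<le> B" shows "integrable M f"
  using assms by (intro integrable_const_bound[of _ B]) auto

text \<open>The variance written through pairs of points, so that increments of f along segments can
  be inserted. The left-hand side is a nonnegative integral, which lets Tonelli exchange the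
  integrals later without integrability conditions.\<close>

lemma (in finite_measure) nn_integral_square_difference:
  fixes f :: "'a \<Rightarrow> real"
  assumes [measurable]: "f \<in> borel_measurable M" and B: "\<And>x. x \<in> space M \<Longrightarrow> \<bar>f x\<bar> \<le> B"
  shows "(\<integral>\<^sup>+x. \<integral>\<^sup>+y. ennreal ((f x - f y)\<^sup>2) \<partial>M \<partial>M)
      = ennreal (2 * measure M (space M) * (\<integral>x. (f x)\<^sup>2 \<partial>M) - 2 * (\<integral>x. f x \<partial>M)\<^sup>2)"
proof -
  let ?m = "measure M (space M)" and ?S = "\<integral>x. f x \<partial>M" and ?Q = "\<integral>x. (f x)\<^sup>2 \<partial>M"
  have i1: "integrable M f" by (rule integrable_bounded[OF _ B]) simp
  have i2: "integrable M (\<lambda>x. (f x)\<^sup>2)"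
  proof (rule integrable_bounded[of _ "B\<^sup>2"])
    fix x assume "x \<in> space M"
    from power_mono[OF B[OF this], of 2] show "\<bar>(f x)\<^sup>2\<bar> \<le> B\<^sup>2" by simp
  qed simp
  have e: "(c - f y)\<^sup>2 = c\<^sup>2 - 2 * c * f y + (f y)\<^sup>2" for c y by (simp add: power2_diff)
  have inner: "(\<integral>\<^sup>+y. ennreal ((c - f y)\<^sup>2) \<partial>M) = ennreal (?m * c\<^sup>2 - 2 * ?S * c + ?Q)" for c
  proof -
    have "integrable M (\<lambda>y. (c - f y)\<^sup>2)" unfolding e using i1 i2 by simp
    then have "(\<integral>\<^sup>+y. ennreal ((c - f y)\<^sup>2) \<partial>M) = ennreal (\<integral>y. (c - f y)\<^sup>2 \<partial>M)"
      by (rule nn_integral_eq_integral) simp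
    also have "(\<integral>y. (c - f y)\<^sup>2 \<partial>M) = ?m * c\<^sup>2 - 2 * ?S * c + ?Q"
      unfolding e using i1 i2 by simp
    finally show ?thesis .
  qed
  have nn: "0 \<le> ?m * c\<^sup>2 - 2 * ?S * c + ?Q" for c
  proof -
    have "0 \<le> (\<integral>y. (c - f y)\<^sup>2 \<partial>M)" by simp
    then show ?thesis unfolding e using i1 i2 by (simp add: ac_simps)
  qed
  have "(\<integral>\<^sup>+x. \<integral>\<^sup>+y. ennreal ((f x - f y)\<^sup>2) \<partial>M \<partial>M) = ennreal (\<integral>x. ?m * (f x)\<^sup>2 - 2 * ?S * f x + ?Q \<partial>M)"
    unfolding inner using i1 i2 nn by (intro nn_integral_eq_integral) auto
  also have "(\<integral>x. ?m * (f x)\<^sup>2 - 2 * ?S * f x + ?Q \<partial>M) = 2 * ?m * ?Q - 2 * ?S\<^sup>2"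
    using i1 i2 by (simp add: power2_eq_square)
  finally show ?thesis .
qed

text \<open>The increment is the integral over [0,1] of the derivative along the segment; Jensen's
  inequality moves the square inside, and Cauchy-Schwarz separates the length of the segment from
  the gradient.\<close>

lemma square_increment_le:
  fixes f :: "'a::euclidean_space \<Rightarrow> real" and G :: "'a \<Rightarrow> 'a"
  assumes seg: "\<And>t. 0 \<le> t \<Longrightarrow> t \<le> 1 \<Longrightarrow> y + t *\<^sub>R (x - y) \<in> C"
    and f: "\<And>z. z \<in> C \<Longrightarrow> (f has_derivative (\<lambda>a. a \<bullet> G z)) (at z)"
    and G: "continuous_on C G" and d: "norm (x - y) \<le> d"
  shows "ennreal ((f x - f y)\<^sup>2) \<le> (\<integral>\<^sup>+t\<in>{0..1}. ennreal (d\<^sup>2 * (norm (G (y + t *\<^sub>R (x - y))))\<^sup>2) \<partial>lborel)"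
proof -
  let ?z = "\<lambda>t. y + t *\<^sub>R (x - y)"
  let ?p = "\<lambda>t. (x - y) \<bullet> G (?z t)" and ?c = "f x - f y"
  have contG: "continuous_on {0..1} (\<lambda>t. G (?z t))"
    by (rule continuous_on_compose2[OF G]) (auto intro!: continuous_intros seg)
  then have contp: "continuous_on {0..1} ?p" by (intro continuous_intros)
  have der: "((\<lambda>t. f (?z t)) has_vector_derivative ?p t) (at t within {0..1})" if "0 \<le> t" "t \<le> 1" for t
  proof -
    have "(?z has_derivative (\<lambda>s. s *\<^sub>R (x - y))) (at t within {0..1})" by (auto intro!: derivative_eq_intros)
    from has_derivative_compose[OF this f[OF seg[OF that]]]
    show ?thesis by (simp add: has_vector_derivative_def)
  qed
  have I1: "integrable lborel (\<lambda>t. indicator {0..1} t *\<^sub>R ?p t)" "(\<integral>t. indicator {0..1} t *\<^sub>R ?p t \<partial>lborel) = ?c"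
    using has_bochner_integral_FTC_Icc[of 0 1 "\<lambda>t. f (?z t)" ?p] der contp
    by (auto simp: has_bochner_integral_iff)
  have I2: "integrable lborel (\<lambda>t. indicator {0..1} t *\<^sub>R (?p t)\<^sup>2)"
    by (rule borel_integrable_compact) (auto intro!: continuous_intros contp)
  have I3: "integrable lborel (\<lambda>t. indicator {0..1} t *\<^sub>R (d\<^sup>2 * (norm (G (?z t)))\<^sup>2))"
    by (rule borel_integrable_compact) (auto intro!: continuous_intros contG)
  have I0: "integrable lborel (\<lambda>t. indicator {0..1::real} t * ?c\<^sup>2)" by simp
  \<comment> \<open>Jensen's inequality by hand: ?c is the mean of ?p over [0,1], so expanding this
    nonnegative variance leaves the square of ?c below the mean of the square of ?p.\<close>
  have "0 \<le> (\<integral>t. indicator {0..1} t * (?p t - ?c)\<^sup>2 \<partial>lborel)" by (intro integral_nonneg_AE) auto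
  also have "\<dots> = (\<integral>t. (indicator {0..1} t *\<^sub>R (?p t)\<^sup>2 - 2 * ?c * (indicator {0..1} t *\<^sub>R ?p t))
      + indicator {0..1} t * ?c\<^sup>2 \<partial>lborel)"
  proof (intro Bochner_Integration.integral_cong refl)
    fix t
    have "(P - c)\<^sup>2 = (P\<^sup>2 - 2 * c * P) + c\<^sup>2" for P c :: real by (simp add: power2_diff)
    then show "indicator {0..1} t * (?p t - ?c)\<^sup>2 = (indicator {0..1} t *\<^sub>R (?p t)\<^sup>2
        - 2 * ?c * (indicator {0..1} t *\<^sub>R ?p t)) + indicator {0..1} t * ?c\<^sup>2"
      by (cases "t \<in> {0..1}") simp_all
  qed
  also have "\<dots> = (\<integral>t. indicator {0..1} t *\<^sub>R (?p t)\<^sup>2 \<partial>lborel) - 2 * ?c * ?c + ?c\<^sup>2"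
    using I1 I2 I0 by simp
  finally have "0 \<le> (\<integral>t. indicator {0..1} t *\<^sub>R (?p t)\<^sup>2 \<partial>lborel) - 2 * ?c * ?c + ?c\<^sup>2" .
  then have "?c\<^sup>2 \<le> (\<integral>t. indicator {0..1} t *\<^sub>R (?p t)\<^sup>2 \<partial>lborel)"
    unfolding power2_eq_square[of ?c] by linarith
  also have "\<dots> \<le> (\<integral>t. indicator {0..1} t *\<^sub>R (d\<^sup>2 * (norm (G (?z t)))\<^sup>2) \<partial>lborel)"
  proof (rule integral_mono[OF I2 I3])
    fix t
    have "\<bar>?p t\<bar> \<le> norm (x - y) * norm (G (?z t))" by (rule Cauchy_Schwarz_ineq2)
    also have "\<dots> \<le> d * norm (G (?z t))" using d by (simp add: mult_right_mono)
    finally have "\<bar>?p t\<bar>\<^sup>2 \<le> (d * norm (G (?z t)))\<^sup>2" by (rule power_mono) simp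
    then show "indicator {0..1} t *\<^sub>R (?p t)\<^sup>2 \<le> indicator {0..1} t *\<^sub>R (d\<^sup>2 * (norm (G (?z t)))\<^sup>2)"
      by (auto simp: power_mult_distrib indicator_def)
  qed
  finally have "ennreal (?c\<^sup>2) \<le> ennreal (\<integral>t. indicator {0..1} t *\<^sub>R (d\<^sup>2 * (norm (G (?z t)))\<^sup>2) \<partial>lborel)"
    by (rule ennreal_leI)
  also have "\<dots> = (\<integral>\<^sup>+t. ennreal (indicator {0..1} t *\<^sub>R (d\<^sup>2 * (norm (G (?z t)))\<^sup>2)) \<partial>lborel)"
    by (rule nn_integral_eq_integral[OF I3, symmetric]) auto
  also have "\<dots> = (\<integral>\<^sup>+t\<in>{0..1}. ennreal (d\<^sup>2 * (norm (G (?z t)))\<^sup>2) \<partial>lborel)"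
    by (intro nn_integral_cong) (auto simp: indicator_def)
  finally show ?thesis .
qed

text \<open>Substitution costs the factor t^-n, where n is the dimension, and t \<ge> 1/2 bounds it
  by 2^n.\<close>

lemma nn_integral_affine_le:
  fixes h :: "'a::euclidean_space \<Rightarrow> ennreal"
  assumes [measurable]: "h \<in> borel_measurable borel" and t: "1/2 \<le> t"
  shows "(\<integral>\<^sup>+x. h (c + t *\<^sub>R x) \<partial>lborel) \<le> 2 ^ DIM('a) * (\<integral>\<^sup>+x. h x \<partial>lborel)"
proof -
  have "(\<integral>\<^sup>+x. h x \<partial>lborel) = (\<integral>\<^sup>+x. h x \<partial>(density (distr lborel borel (\<lambda>x. c + t *\<^sub>R x)) (\<lambda>_. ennreal (\<bar>t\<bar> ^ DIM('a)))))"
    using lborel_affine[of t c] t by simp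
  also have "\<dots> = ennreal (\<bar>t\<bar> ^ DIM('a)) * (\<integral>\<^sup>+x. h (c + t *\<^sub>R x) \<partial>lborel)"
    by (simp add: nn_integral_density nn_integral_distr nn_integral_cmult)
  finally have eq: "2 ^ DIM('a) * (\<integral>\<^sup>+x. h x \<partial>lborel)
      = 2 ^ DIM('a) * ennreal (\<bar>t\<bar> ^ DIM('a)) * (\<integral>\<^sup>+x. h (c + t *\<^sub>R x) \<partial>lborel)"
    by (simp add: mult.assoc)
  have "1 \<le> (2 * \<bar>t\<bar>) ^ DIM('a)" using t by (intro one_le_power) auto
  then have "1 \<le> ennreal (2 ^ DIM('a) * \<bar>t\<bar> ^ DIM('a))"
    unfolding power_mult_distrib using ennreal_leI by fastforce
  also have "\<dots> = 2 ^ DIM('a) * ennreal (\<bar>t\<bar> ^ DIM('a))"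
    by (simp add: ennreal_mult ennreal_power[symmetric])
  finally show ?thesis unfolding eq using mult_right_mono[of 1 _ "\<integral>\<^sup>+x. h (c + t *\<^sub>R x) \<partial>lborel"] by simp
qed

text \<open>For \<open>t \<ge> 1/2\<close> the substitution is made in \<open>x\<close>, otherwise in \<open>y\<close>.\<close>

lemma nn_integral_segment_le:
  fixes h :: "'a::euclidean_space \<Rightarrow> ennreal"
  assumes [measurable]: "h \<in> borel_measurable borel" "C \<in> sets borel"
  shows "(\<integral>\<^sup>+x\<in>C. \<integral>\<^sup>+y\<in>C. h (y + t *\<^sub>R (x - y)) \<partial>lborel \<partial>lborel)
      \<le> 2 ^ DIM('a) * emeasure lborel C * (\<integral>\<^sup>+x. h x \<partial>lborel)"
proof (cases "1/2 \<le> t")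
  case True
  have "(\<integral>\<^sup>+x\<in>C. \<integral>\<^sup>+y\<in>C. h (y + t *\<^sub>R (x - y)) \<partial>lborel \<partial>lborel)
      = (\<integral>\<^sup>+x. \<integral>\<^sup>+y. h (y + t *\<^sub>R (x - y)) * indicator C y * indicator C x \<partial>lborel \<partial>lborel)"
    by (intro nn_integral_cong) (simp add: nn_integral_multc)
  also have "\<dots> = (\<integral>\<^sup>+y. \<integral>\<^sup>+x. h (y + t *\<^sub>R (x - y)) * indicator C y * indicator C x \<partial>lborel \<partial>lborel)"
    by (rule lborel_pair.Fubini'[symmetric]) simp
  also have "\<dots> \<le> (\<integral>\<^sup>+y. 2 ^ DIM('a) * (\<integral>\<^sup>+x. h x \<partial>lborel) * indicator C y \<partial>lborel)"
  proof (intro nn_integral_mono)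
    fix y
    have "(\<integral>\<^sup>+x. h (y + t *\<^sub>R (x - y)) * indicator C y * indicator C x \<partial>lborel)
        \<le> (\<integral>\<^sup>+x. h ((y - t *\<^sub>R y) + t *\<^sub>R x) * indicator C y \<partial>lborel)"
      by (intro nn_integral_mono) (auto simp: indicator_def algebra_simps)
    also have "\<dots> = (\<integral>\<^sup>+x. h ((y - t *\<^sub>R y) + t *\<^sub>R x) \<partial>lborel) * indicator C y"
      by (simp add: nn_integral_multc)
    also have "\<dots> \<le> 2 ^ DIM('a) * (\<integral>\<^sup>+x. h x \<partial>lborel) * indicator C y"
      by (intro mult_right_mono nn_integral_affine_le True) auto
    finally show "(\<integral>\<^sup>+x. h (y + t *\<^sub>R (x - y)) * indicator C y * indicator C x \<partial>lborel)
        \<le> 2 ^ DIM('a) * (\<integral>\<^sup>+x. h x \<partial>lborel) * indicator C y" .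
  qed
  also have "\<dots> = 2 ^ DIM('a) * emeasure lborel C * (\<integral>\<^sup>+x. h x \<partial>lborel)"
    by (subst nn_integral_cmult_indicator) (simp_all add: ac_simps)
  finally show ?thesis .
next
  case False
  have "(\<integral>\<^sup>+x\<in>C. \<integral>\<^sup>+y\<in>C. h (y + t *\<^sub>R (x - y)) \<partial>lborel \<partial>lborel)
      \<le> (\<integral>\<^sup>+x. 2 ^ DIM('a) * (\<integral>\<^sup>+x. h x \<partial>lborel) * indicator C x \<partial>lborel)"
  proof (intro nn_integral_mono mult_right_mono)
    fix x
    have "(\<integral>\<^sup>+y\<in>C. h (y + t *\<^sub>R (x - y)) \<partial>lborel) \<le> (\<integral>\<^sup>+y. h (t *\<^sub>R x + (1 - t) *\<^sub>R y) \<partial>lborel)"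
      by (intro nn_integral_mono) (auto simp: indicator_def algebra_simps)
    also have "\<dots> \<le> 2 ^ DIM('a) * (\<integral>\<^sup>+x. h x \<partial>lborel)"
      using False by (intro nn_integral_affine_le) auto
    finally show "(\<integral>\<^sup>+y\<in>C. h (y + t *\<^sub>R (x - y)) \<partial>lborel) \<le> 2 ^ DIM('a) * (\<integral>\<^sup>+x. h x \<partial>lborel)" .
  qed simp
  also have "\<dots> = 2 ^ DIM('a) * emeasure lborel C * (\<integral>\<^sup>+x. h x \<partial>lborel)"
    by (subst nn_integral_cmult_indicator) (simp_all add: ac_simps)
  finally show ?thesis .
qed

text \<open>The squared increments are integrated over C \<times> C. Convexity keeps all segments in
  C, and after exchanging the integrals the double integral for fixed t is handled by
  \<open>nn_integral_segment_le\<close>. Multiplying through by the measure of C keeps the statement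
  meaningful for null sets. The compact set K supplies bounds for f and G, as a grid cell need not
  be closed.\<close>

theorem poincare_convex:
  fixes f :: "'a::euclidean_space \<Rightarrow> real" and G :: "'a \<Rightarrow> 'a"
  assumes C: "convex C" "C \<in> sets borel" and K: "C \<subseteq> K" "compact K"
    and f: "\<And>z. z \<in> K \<Longrightarrow> (f has_derivative (\<lambda>a. a \<bullet> G z)) (at z)" and G: "continuous_on K G"
    and d: "\<And>x y. x \<in> C \<Longrightarrow> y \<in> C \<Longrightarrow> norm (x - y) \<le> d"
  shows "measure lborel C * (\<integral>x. indicator C x * (f x)\<^sup>2 \<partial>lborel) \<le> (\<integral>x. indicator C x * f x \<partial>lborel)\<^sup>2
      + 2 ^ DIM('a) * d\<^sup>2 * measure lborel C * (\<integral>x. indicator C x * (norm (G x))\<^sup>2 \<partial>lborel)"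
proof -
  define N where "N = restrict_space lborel C"
  note [measurable] = C(2)
  have sp: "space N = C" by (simp add: N_def space_restrict_space)
  have Cl: "C \<inter> space lborel \<in> sets lborel" using C(2) by simp
  have fin: "emeasure lborel C < \<infinity>" using emeasure_bounded_finite bounded_subset[OF compact_imp_bounded[OF K(2)] K(1)] by blast
  interpret N: finite_measure N
    using fin by (intro finite_measureI) (simp add: N_def space_restrict_space emeasure_restrict_space)
  have mN: "measure N (space N) = measure lborel C"
    by (simp add: sp, simp add: N_def measure_restrict_space)
  have contf: "continuous_on C f"
    using has_derivative_continuous[OF f] K(1) by (intro continuous_at_imp_continuous_on) blast
  have fm[measurable]: "f \<in> borel_measurable N"
    using borel_measurable_continuous_on_restrict[OF contf]
      measurable_cong_sets[of N "restrict_space borel C"] by (simp add: N_def sets_restrict_space)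
  have contfK: "continuous_on K f"
    using has_derivative_continuous[OF f] by (intro continuous_at_imp_continuous_on) blast
  obtain B where B: "\<And>x. x \<in> K \<Longrightarrow> \<bar>f x\<bar> \<le> B" by (rule compact_abs_bounded[OF K(2) contfK]) blast
  \<comment> \<open>With the indicator of C built in, h is Borel on the whole space, where affine
    substitutions can be made freely.\<close>
  define h where "h z = ennreal (indicator C z *\<^sub>R (d\<^sup>2 * (norm (G z))\<^sup>2))" for z
  have GC: "continuous_on C (\<lambda>z. d\<^sup>2 * (norm (G z))\<^sup>2)"
    using continuous_on_subset[OF G K(1)] by (intro continuous_intros)
  have hm[measurable]: "h \<in> borel_measurable borel"
    unfolding h_def[abs_def] using borel_measurable_continuous_on_indicator[OF C(2) GC] by simp
  have "ennreal (2 * measure lborel C * (\<integral>x. (f x)\<^sup>2 \<partial>N) - 2 * (\<integral>x. f x \<partial>N)\<^sup>2)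
      = (\<integral>\<^sup>+x. \<integral>\<^sup>+y. ennreal ((f x - f y)\<^sup>2) \<partial>N \<partial>N)"
    by (rule N.nn_integral_square_difference[OF fm, of B, unfolded mN, symmetric]) (use B K(1) sp in auto)
  also have "\<dots> \<le> (\<integral>\<^sup>+x. \<integral>\<^sup>+y. (\<integral>\<^sup>+t\<in>{0..1}. h (y + t *\<^sub>R (x - y)) \<partial>lborel) \<partial>N \<partial>N)"
  proof (intro nn_integral_mono)
    fix x y assume "x \<in> space N" "y \<in> space N"
    then have xy: "x \<in> C" "y \<in> C" by (simp_all add: sp)
    have seg: "y + t *\<^sub>R (x - y) \<in> C" if "0 \<le> t" "t \<le> 1" for t
      using convexD_alt[OF C(1) xy(2,1) that] by (simp add: algebra_simps)
    have "ennreal ((f x - f y)\<^sup>2) \<le> (\<integral>\<^sup>+t\<in>{0..1}. ennreal (d\<^sup>2 * (norm (G (y + t *\<^sub>R (x - y))))\<^sup>2) \<partial>lborel)"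
      by (rule square_increment_le[OF seg f continuous_on_subset[OF G K(1)] d[OF xy]]) (use K(1) in auto)
    also have "\<dots> = (\<integral>\<^sup>+t\<in>{0..1}. h (y + t *\<^sub>R (x - y)) \<partial>lborel)"
      by (intro nn_integral_cong) (auto simp: indicator_def h_def seg)
    finally show "ennreal ((f x - f y)\<^sup>2) \<le> (\<integral>\<^sup>+t\<in>{0..1}. h (y + t *\<^sub>R (x - y)) \<partial>lborel)" .
  qed
  also have "\<dots> = (\<integral>\<^sup>+x. \<integral>\<^sup>+y. \<integral>\<^sup>+t. h (y + t *\<^sub>R (x - y)) * indicator {0..1} t * indicator C y * indicator C x
      \<partial>lborel \<partial>lborel \<partial>lborel)"
    unfolding N_def nn_integral_restrict_space[OF Cl] by (simp add: nn_integral_multc)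
  also have "\<dots> = (\<integral>\<^sup>+x. \<integral>\<^sup>+t. \<integral>\<^sup>+y. h (y + t *\<^sub>R (x - y)) * indicator {0..1} t * indicator C y * indicator C x
      \<partial>lborel \<partial>lborel \<partial>lborel)"
  proof (intro nn_integral_cong)
    fix x
    show "(\<integral>\<^sup>+y. \<integral>\<^sup>+t. h (y + t *\<^sub>R (x - y)) * indicator {0..1} t * indicator C y * indicator C x \<partial>lborel \<partial>lborel)
      = (\<integral>\<^sup>+t. \<integral>\<^sup>+y. h (y + t *\<^sub>R (x - y)) * indicator {0..1} t * indicator C y * indicator C x \<partial>lborel \<partial>lborel)"
      by (rule lborel_pair.Fubini'[symmetric]) simp
  qed
  also have "\<dots> = (\<integral>\<^sup>+t. \<integral>\<^sup>+x. \<integral>\<^sup>+y. h (y + t *\<^sub>R (x - y)) * indicator {0..1} t * indicator C y * indicator C x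
      \<partial>lborel \<partial>lborel \<partial>lborel)"
    by (rule lborel_pair.Fubini'[symmetric]) simp
  also have "\<dots> = (\<integral>\<^sup>+t. (\<integral>\<^sup>+x\<in>C. \<integral>\<^sup>+y\<in>C. h (y + t *\<^sub>R (x - y)) \<partial>lborel \<partial>lborel) * indicator {0..1::real} t \<partial>lborel)"
  proof (intro nn_integral_cong)
    fix t :: real
    show "(\<integral>\<^sup>+x. \<integral>\<^sup>+y. h (y + t *\<^sub>R (x - y)) * indicator {0..1} t * indicator C y * indicator C x \<partial>lborel \<partial>lborel)
      = (\<integral>\<^sup>+x\<in>C. \<integral>\<^sup>+y\<in>C. h (y + t *\<^sub>R (x - y)) \<partial>lborel \<partial>lborel) * indicator {0..1} t"
      by (cases "t \<in> {0..1}") (simp_all add: nn_integral_multc)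
  qed
  also have "\<dots> \<le> (\<integral>\<^sup>+t. 2 ^ DIM('a) * emeasure lborel C * (\<integral>\<^sup>+x. h x \<partial>lborel) * indicator {0..1::real} t \<partial>lborel)"
    by (intro nn_integral_mono mult_right_mono nn_integral_segment_le) auto
  also have "\<dots> = 2 ^ DIM('a) * emeasure lborel C * (\<integral>\<^sup>+x. h x \<partial>lborel)"
    by (simp add: nn_integral_cmult_indicator)
  also have "(\<integral>\<^sup>+x. h x \<partial>lborel) = ennreal (d\<^sup>2 * (\<integral>x. indicator C x * (norm (G x))\<^sup>2 \<partial>lborel))"
  proof -
    obtain B' where B': "\<And>x. x \<in> K \<Longrightarrow> \<bar>norm (G x)\<bar> \<le> B'"
      by (rule compact_abs_bounded[OF K(2) continuous_on_norm[OF G]]) blast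
    have m: "(\<lambda>z. indicator C z *\<^sub>R (d\<^sup>2 * (norm (G z))\<^sup>2)) \<in> borel_measurable borel"
      using borel_measurable_continuous_on_indicator[OF C(2) GC] .
    have "integrable lborel (\<lambda>z. indicator C z *\<^sub>R (d\<^sup>2 * (norm (G z))\<^sup>2))"
    proof (rule Bochner_Integration.integrable_bound)
      show "integrable lborel (\<lambda>x. (d\<^sup>2 * B'\<^sup>2) * indicator C x)"
        using fin by (intro integrable_mult_right integrable_real_indicator) auto
      show "AE x in lborel. norm (indicator C x *\<^sub>R (d\<^sup>2 * (norm (G x))\<^sup>2)) \<le> norm ((d\<^sup>2 * B'\<^sup>2) * indicator C x)"
        using B' K(1) power_mono[of "norm (G _)" B' 2] by (intro AE_I2) (auto simp: indicator_def intro!: mult_left_mono)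
    qed (use m in simp)
    then have "(\<integral>\<^sup>+x. h x \<partial>lborel) = ennreal (\<integral>z. indicator C z *\<^sub>R (d\<^sup>2 * (norm (G z))\<^sup>2) \<partial>lborel)"
      unfolding h_def by (intro nn_integral_eq_integral) auto
    also have "(\<integral>z. indicator C z *\<^sub>R (d\<^sup>2 * (norm (G z))\<^sup>2) \<partial>lborel) = d\<^sup>2 * (\<integral>x. indicator C x * (norm (G x))\<^sup>2 \<partial>lborel)"
      by (subst integral_mult_right_zero[symmetric]) (simp add: ac_simps)
    finally show ?thesis .
  qed
  also have "emeasure lborel C = ennreal (measure lborel C)"
    using fin by (simp add: emeasure_eq_ennreal_measure less_top)
  also have "2 ^ DIM('a) * ennreal (measure lborel C) * ennreal (d\<^sup>2 * (\<integral>x. indicator C x * (norm (G x))\<^sup>2 \<partial>lborel))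
      = ennreal (2 ^ DIM('a) * measure lborel C * (d\<^sup>2 * (\<integral>x. indicator C x * (norm (G x))\<^sup>2 \<partial>lborel)))"
    by (simp add: ennreal_mult ennreal_power[symmetric] integral_nonneg_AE)
  finally have "2 * measure lborel C * (\<integral>x. (f x)\<^sup>2 \<partial>N) - 2 * (\<integral>x. f x \<partial>N)\<^sup>2
      \<le> 2 ^ DIM('a) * measure lborel C * (d\<^sup>2 * (\<integral>x. indicator C x * (norm (G x))\<^sup>2 \<partial>lborel))"
    by (subst (asm) ennreal_le_iff) (auto intro!: integral_nonneg_AE mult_nonneg_nonneg)
  moreover have "(\<integral>x. (f x)\<^sup>2 \<partial>N) = (\<integral>x. indicator C x * (f x)\<^sup>2 \<partial>lborel)" "(\<integral>x. f x \<partial>N) = (\<integral>x. indicator C x * f x \<partial>lborel)"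
    unfolding N_def by (simp_all add: integral_restrict_space[OF Cl])
  ultimately have le: "2 * measure lborel C * (\<integral>x. indicator C x * (f x)\<^sup>2 \<partial>lborel) - 2 * (\<integral>x. indicator C x * f x \<partial>lborel)\<^sup>2
      \<le> 2 ^ DIM('a) * measure lborel C * (d\<^sup>2 * (\<integral>x. indicator C x * (norm (G x))\<^sup>2 \<partial>lborel))"
    by simp
  have nonneg: "0 \<le> 2 ^ DIM('a) * measure lborel C * (d\<^sup>2 * (\<integral>x. indicator C x * (norm (G x))\<^sup>2 \<partial>lborel))"
    by (auto intro!: integral_nonneg_AE mult_nonneg_nonneg)
  have eq: "2 ^ DIM('a) * d\<^sup>2 * measure lborel C * (\<integral>x. indicator C x * (norm (G x))\<^sup>2 \<partial>lborel)
      = 2 ^ DIM('a) * measure lborel C * (d\<^sup>2 * (\<integral>x. indicator C x * (norm (G x))\<^sup>2 \<partial>lborel))"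
    by (simp add: ac_simps)
  \<comment> \<open>Halving would leave p / 2; as p is nonnegative it is replaced by the larger
    p.\<close>
  have arith: "a \<le> s + p" if "2 * a - 2 * s \<le> p" "0 \<le> p" for a s p :: real using that by linarith
  show ?thesis
    unfolding eq using le nonneg by (intro arith) (simp_all only: mult.assoc)
qed

text \<open>Nonnegativity of the squared distance from v to its projection onto the span of the
  system. Boundedness on a space of finite measure makes all products integrable.\<close>

lemma (in finite_measure) bessel_inequality:
  fixes u :: "'b \<Rightarrow> 'a \<Rightarrow> real"
  assumes "finite F"
    and u: "\<And>k. k \<in> F \<Longrightarrow> u k \<in> borel_measurable M" "\<And>k x. k \<in> F \<Longrightarrow> x \<in> space M \<Longrightarrow> \<bar>u k x\<bar> \<le> B k"
    and orth: "\<And>k l. k \<in> F \<Longrightarrow> l \<in> F \<Longrightarrow> (\<integral>x. u k x * u l x \<partial>M) = (if k = l then 1 else 0)"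
    and v: "v \<in> borel_measurable M" "\<And>x. x \<in> space M \<Longrightarrow> \<bar>v x\<bar> \<le> A"
  shows "(\<Sum>k\<in>F. (\<integral>x. u k x * v x \<partial>M)\<^sup>2) \<le> (\<integral>x. (v x)\<^sup>2 \<partial>M)"
proof -
  define a where "a k = (\<integral>x. u k x * v x \<partial>M)" for k
  have prod: "integrable M (\<lambda>x. f x * h x)"
    if "f \<in> borel_measurable M" "\<And>x. x \<in> space M \<Longrightarrow> \<bar>f x\<bar> \<le> b"
       "h \<in> borel_measurable M" "\<And>x. x \<in> space M \<Longrightarrow> \<bar>h x\<bar> \<le> c" for f h :: "'a \<Rightarrow> real" and b c
  proof (rule integrable_bounded[of _ "\<bar>b\<bar> * \<bar>c\<bar>"])
    fix x assume "x \<in> space M"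
    then show "\<bar>f x * h x\<bar> \<le> \<bar>b\<bar> * \<bar>c\<bar>"
      using that(2,4)[of x] by (auto simp: abs_mult intro!: mult_mono)
  qed (use that in simp)
  have iv: "integrable M (\<lambda>x. v x * v x)" by (rule prod[OF v v])
  have iuv: "integrable M (\<lambda>x. u k x * v x)" if "k \<in> F" for k by (rule prod[OF u(1,2)[OF that] v])
  have iuu: "integrable M (\<lambda>x. u k x * u l x)" if "k \<in> F" "l \<in> F" for k l
    by (rule prod[OF u(1,2)[OF that(1)] u(1,2)[OF that(2)]])
  have "0 \<le> (\<integral>x. (v x - (\<Sum>k\<in>F. a k * u k x))\<^sup>2 \<partial>M)" by simp
  also have "\<dots> = (\<integral>x. v x * v x - 2 * (\<Sum>k\<in>F. a k * (u k x * v x))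
      + (\<Sum>k\<in>F. \<Sum>l\<in>F. a k * a l * (u k x * u l x)) \<partial>M)"
    by (intro Bochner_Integration.integral_cong refl)
      (simp add: power2_eq_square sum_product sum_distrib_left sum_distrib_right algebra_simps)
  also have "\<dots> = (\<integral>x. v x * v x \<partial>M) - 2 * (\<Sum>k\<in>F. a k * (\<integral>x. u k x * v x \<partial>M))
      + (\<Sum>k\<in>F. \<Sum>l\<in>F. a k * a l * (\<integral>x. u k x * u l x \<partial>M))"
    using iv iuv iuu
    by (subst Bochner_Integration.integral_add Bochner_Integration.integral_diff Bochner_Integration.integral_sum
        | auto intro!: Bochner_Integration.integrable_diff integrable_mult_right Bochner_Integration.integrable_sum
            sum.cong simp: Bochner_Integration.integral_sum)+
  also have "(\<Sum>k\<in>F. \<Sum>l\<in>F. a k * a l * (\<integral>x. u k x * u l x \<partial>M)) = (\<Sum>k\<in>F. (a k)\<^sup>2)"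
    using assms(1) by (intro sum.cong refl) (simp add: orth if_distrib power2_eq_square cong: if_cong)
  finally show ?thesis by (simp add: a_def[symmetric] power2_eq_square)
qed

section \<open>A polynomial bound on the number of eigenvalues\<close>

text \<open>The cells are the intersections of Q with half-open cubes of side 1/m, that is, the
  fibres of the vector of floors of m x_i. As fibres they are disjoint, and as intersections of
  slabs with Q they are convex.\<close>

lemma grid_cells:
  fixes Q :: "(real^'n) set"
  assumes "compact Q" "convex Q"
  shows "\<exists>B\<ge>0. \<forall>m\<ge>1. \<exists>\<C>. finite \<C> \<and> real (card \<C>) \<le> B * real m ^ CARD('n) \<and>
     disjoint_family_on id \<C> \<and> \<Union>\<C> = Q \<and>
     (\<forall>C\<in>\<C>. convex C \<and> C \<in> sets borel \<and> (\<forall>x\<in>C. \<forall>y\<in>C. norm (x - y) \<le> real CARD('n) / real m))"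
proof -
  obtain R where R: "\<And>x. x \<in> Q \<Longrightarrow> norm x \<le> R"
    using compact_imp_bounded[OF assms(1)] unfolding bounded_iff by blast
  define r where "r = nat \<lceil>\<bar>R\<bar>\<rceil> + 1"
  have r: "norm x \<le> real r" if "x \<in> Q" for x using R[OF that] unfolding r_def by linarith
  have "\<exists>\<C>. finite \<C> \<and> real (card \<C>) \<le> real ((2 * r + 1) ^ CARD('n)) * real m ^ CARD('n) \<and>
     disjoint_family_on id \<C> \<and> \<Union>\<C> = Q \<and>
     (\<forall>C\<in>\<C>. convex C \<and> C \<in> sets borel \<and> (\<forall>x\<in>C. \<forall>y\<in>C. norm (x - y) \<le> real CARD('n) / real m))"
    if m: "m \<ge> 1" for m :: nat
  proof -
    define k where "k x i = \<lfloor>real m * x $ i\<rfloor>" for x :: "real^'n" and i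
    define cell where "cell l = {x \<in> Q. k x = l}" for l
    define J where "J = PiE UNIV (\<lambda>_::'n. {- int (m * r) .. int (m * r)})"
    have kJ: "k x \<in> J" if x: "x \<in> Q" for x
    proof -
      have "- int (m * r) \<le> k x i \<and> k x i \<le> int (m * r)" for i
      proof -
        have "\<bar>x $ i\<bar> \<le> real r" using component_le_norm_cart[of x i] r[OF x] by linarith
        then have "\<bar>real m * x $ i\<bar> \<le> real m * real r" by (simp add: abs_mult mult_left_mono)
        then have "- real (m * r) \<le> real m * x $ i" "real m * x $ i \<le> real (m * r)" by auto
        then show ?thesis unfolding k_def by linarith
      qed
      then show ?thesis by (auto simp: J_def)
    qed
    have finJ: "finite J" unfolding J_def by (intro finite_PiE) auto
    have "card J = (2 * (m * r) + 1) ^ CARD('n)" unfolding J_def by (simp add: card_PiE nat_add_distrib nat_mult_distrib)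
    \<comment> \<open>Here m \<ge> 1 turns 2 m r + 1 into a plain multiple of m, so that the count
      is a constant times a power of m.\<close>
    also have "\<dots> \<le> ((2 * r + 1) * m) ^ CARD('n)" using m by (intro power_mono) (auto simp: algebra_simps)
    finally have cJ: "card J \<le> (2 * r + 1) ^ CARD('n) * m ^ CARD('n)" by (simp only: power_mult_distrib)
    let ?C = "cell ` J"
    have "card ?C \<le> (2 * r + 1) ^ CARD('n) * m ^ CARD('n)" using card_image_le[OF finJ, of cell] cJ by linarith
    then have "real (card ?C) \<le> real ((2 * r + 1) ^ CARD('n) * m ^ CARD('n))" by (rule of_nat_mono)
    then have "real (card ?C) \<le> real ((2 * r + 1) ^ CARD('n)) * real m ^ CARD('n)" by simp
    moreover have "finite ?C" using finJ by simp
    moreover have "disjoint_family_on id ?C" by (auto simp: disjoint_family_on_def cell_def)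
    moreover have "\<Union>?C = Q" using kJ by (auto simp: cell_def)
    moreover have "convex C \<and> C \<in> sets borel \<and> (\<forall>x\<in>C. \<forall>y\<in>C. norm (x - y) \<le> real CARD('n) / real m)"
      if C: "C \<in> ?C" for C
    proof -
      obtain l where l: "C = cell l" using C by auto
      have mem: "x \<in> C \<longleftrightarrow> x \<in> Q \<and> (\<forall>i. of_int (l i) \<le> real m * x $ i \<and> real m * x $ i < of_int (l i) + 1)" for x
        unfolding l cell_def k_def fun_eq_iff by (simp add: floor_eq_iff)
      have "C = Q \<inter> (\<Inter>i. {x. of_int (l i) \<le> real m * x $ i \<and> real m * x $ i < of_int (l i) + 1})"
        using mem by blast
      moreover have "convex {x::real^'n. of_int (l i) \<le> real m * x $ i \<and> real m * x $ i < of_int (l i) + 1}" for i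
      proof -
        have "{x::real^'n. of_int (l i) \<le> real m * x $ i \<and> real m * x $ i < of_int (l i) + 1}
          = (\<lambda>x. real m * x $ i) -` {of_int (l i)..<of_int (l i) + 1}" by auto
        moreover have "linear (\<lambda>x::real^'n. real m * x $ i)" by (auto intro!: linearI simp: algebra_simps)
        ultimately show ?thesis using convex_linear_vimage convex_real_interval by metis
      qed
      moreover have "{x::real^'n. of_int (l i) \<le> real m * x $ i \<and> real m * x $ i < of_int (l i) + 1} \<in> sets borel" for i
      proof -
        have "(\<lambda>x::real^'n. real m * x $ i) \<in> borel_measurable borel"
          by (intro borel_measurable_continuous_onI continuous_intros)
        then show ?thesis by measurable
      qed
      ultimately have "convex C" "C \<in> sets borel"
        using assms borel_compact by (auto intro!: convex_Int convex_INT sets.Int sets.countable_INT'')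
      moreover have "norm (x - y) \<le> real CARD('n) / real m" if "x \<in> C" "y \<in> C" for x y
      proof -
        have "\<bar>(x - y) $ i\<bar> \<le> 1 / real m" for i
        proof -
          have "real m * x $ i - real m * y $ i \<le> 1" "real m * y $ i - real m * x $ i \<le> 1"
            using that unfolding mem by (smt (verit, best))+
          then have "real m * \<bar>x $ i - y $ i\<bar> \<le> 1" by (simp add: abs_if algebra_simps)
          then show ?thesis using m by (simp add: field_simps)
        qed
        \<comment> \<open>The Euclidean norm is bounded by the sum of the moduli of the coordinates,
          which explains the diameter \<open>CARD('n)\<close> / m.\<close>
        then have "(\<Sum>i\<in>UNIV. \<bar>(x - y) $ i\<bar>) \<le> (\<Sum>i\<in>(UNIV::'n set). 1 / real m)" by (intro sum_mono)
        then show ?thesis using norm_le_l1_cart[of "x - y"] by simp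
      qed
      ultimately show ?thesis by blast
    qed
    ultimately show ?thesis by blast
  qed
  then show ?thesis by (intro exI[of _ "real ((2 * r + 1) ^ CARD('n))"]) auto
qed

lemma integrable_indicator_continuous:
  fixes f :: "'a::euclidean_space \<Rightarrow> real"
  assumes "C \<in> sets borel" "C \<subseteq> K" "compact K" "continuous_on K f"
  shows "integrable lborel (\<lambda>x. indicator C x * f x)"
proof -
  have "integrable lborel (\<lambda>x. indicator K x *\<^sub>R f x)" using assms by (intro borel_integrable_compact)
  from integrable_real_mult_indicator[OF _ this, of C] assms(1)
  have "integrable lborel (\<lambda>x. (indicator K x *\<^sub>R f x) * indicator C x)" by simp
  moreover have "(\<lambda>x. (indicator K x *\<^sub>R f x) * indicator C x) = (\<lambda>x. indicator C x * f x)"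
    using assms(2) by (auto simp: indicator_def fun_eq_iff)
  ultimately show ?thesis by simp
qed

section \<open>Mass, energy and counting for orthonormal systems on the manifold\<close>

context riemannian_manifold
begin

text \<open>Uniform ellipticity: the form is positive and continuous on the compact product of Q
  with the unit sphere, so it attains a positive minimum there, and homogeneity extends the bound to
  all vectors.\<close>

lemma metric_inv_lower_bound:
  assumes ch: "chart V \<phi>" and Q: "compact Q" "Q \<subseteq> \<phi> ` V"
  obtains a where "0 < a" "\<And>u x. u \<in> Q \<Longrightarrow> a * (norm x)\<^sup>2 \<le> x \<bullet> (matrix_inv (metric_matrix g V \<phi> u) *v x)"
proof (cases "Q = {}")
  case True
  then show ?thesis using that[of 1] by simp
next
  case False
  let ?q = "\<lambda>(u, x). x \<bullet> (matrix_inv (metric_matrix g V \<phi> u) *v x)"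
  let ?S = "Q \<times> sphere (0::real^'n) 1"
  have "compact ?S" using Q(1) by (intro compact_Times) auto
  moreover have "sphere (0::real^'n) 1 \<noteq> {}" by simp
  then have "?S \<noteq> {}" using False by simp
  moreover have "continuous_on ?S ?q"
  proof -
    have q: "?q = (\<lambda>z. \<Sum>i\<in>UNIV. snd z $ i * (\<Sum>j\<in>UNIV. matrix_inv (metric_matrix g V \<phi> (fst z)) $ i $ j * snd z $ j))"
      by (auto simp: fun_eq_iff inner_vec_def matrix_vector_mult_def)
    have inv: "continuous_on ?S (\<lambda>z. matrix_inv (metric_matrix g V \<phi> (fst z)) $ i $ j)" for i j
      by (rule continuous_on_compose2[OF C1_on_continuous_on[OF C1_on_metric_inv[OF ch]]])
        (use Q(2) in \<open>auto intro!: continuous_intros\<close>)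
    show ?thesis unfolding q
      by (intro continuous_on_sum continuous_on_mult inv continuous_on_component continuous_on_snd continuous_on_id)
  qed
  ultimately have "\<exists>z\<in>?S. \<forall>y\<in>?S. ?q z \<le> ?q y" by (rule continuous_attains_inf)
  then obtain z where z: "z \<in> ?S" "\<And>y. y \<in> ?S \<Longrightarrow> ?q z \<le> ?q y" by blast
  obtain u0 x0 where z0: "z = (u0, x0)" by (cases z)
  have "u0 \<in> \<phi> ` V" "x0 \<noteq> 0" using z(1) Q(2) unfolding z0 by auto
  then have pos: "0 < ?q z" using matrix_inv_metric_pos[OF ch, of u0 x0] unfolding z0 by simp
  have "?q z * (norm x)\<^sup>2 \<le> x \<bullet> (matrix_inv (metric_matrix g V \<phi> u) *v x)" if u: "u \<in> Q" for u x
  proof (cases "x = 0")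
    case False
    define y where "y = x /\<^sub>R norm x"
    have "?q z \<le> ?q (u, y)" using z(2)[of "(u, y)"] u False by (simp add: y_def)
    moreover have x: "x = norm x *\<^sub>R y" using False by (simp add: y_def)
    ultimately have "?q z * (norm x)\<^sup>2 \<le> ?q (u, y) * (norm x)\<^sup>2" by (intro mult_right_mono) auto
    also have "\<dots> = (norm x *\<^sub>R y) \<bullet> (matrix_inv (metric_matrix g V \<phi> u) *v (norm x *\<^sub>R y))"
      by (simp add: power2_eq_square matrix_vector_mult_scaleR)
    finally show ?thesis using x by simp
  qed simp
  with pos show ?thesis using that by blast
qed

text \<open>Not tied to eigenfunctions: the counting estimate has the character of a min-max
  principle and sees only orthonormality and Dirichlet energies.\<close>

definition orthonormal_C1 :: "nat set \<Rightarrow> (nat \<Rightarrow> 'a \<Rightarrow> real) \<Rightarrow> bool" where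
  "orthonormal_C1 F u \<longleftrightarrow> finite F \<and> (\<forall>k\<in>F. C1_manifold (u k)) \<and>
     (\<forall>k\<in>F. \<forall>l\<in>F. (\<integral>x. u k x * u l x \<partial>\<mu>) = (if k = l then 1 else 0))"

text \<open>Bessel's inequality applied to the function whose inner products are the integrals over the
  cell in coordinates.\<close>

lemma sum_cell_integrals_le:
  assumes ch: "chart V \<phi>" and Q: "compact Q" "Q \<subseteq> \<phi> ` V" and C: "C \<in> sets borel" "C \<subseteq> Q"
    and a: "0 < a" "\<And>u. u \<in> Q \<Longrightarrow> a \<le> vol_density V \<phi> u" and u: "orthonormal_C1 F u"
  shows "(\<Sum>k\<in>F. (\<integral>p. indicator C p * u k (chart_inv V \<phi> p) \<partial>lborel)\<^sup>2) \<le> measure lborel C / a"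
proof -
  note c = smooth_chartD[OF ch]
  let ?w = "vol_density V \<phi>" and ?\<sigma> = "chart_inv V \<phi>"
  have V: "V \<inter> space \<mu> \<in> sets \<mu>" using openin_sets_mu[OF c(3)] by auto
  \<comment> \<open>Dividing by the density cancels it in the integral over the manifold, so pairing
    a function with \<zeta> gives its plain coordinate integral over C. The squared norm of \<zeta>
    is then the integral of 1 / density over C, at most the measure of C divided by a.\<close>
  define H where "H p = indicator C p *\<^sub>R (1 / ?w p)" for p
  have wpos: "0 < ?w p" if "p \<in> \<phi> ` V" for p using det_metric_pos[OF ch that] by simp
  have contw: "continuous_on Q (\<lambda>p. 1 / ?w p)"
    using continuous_on_subset[OF C1_on_continuous_on[OF C1_on_sqrt_det[OF ch]] Q(2)] wpos Q(2)
    by (intro continuous_on_divide continuous_on_const) fastforce+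
  have H: "H \<in> borel_measurable borel"
    unfolding H_def[abs_def]
    by (rule borel_measurable_continuous_on_indicator[OF C(1) continuous_on_subset[OF contw C(2)]])
  have H_le: "\<bar>H p\<bar> \<le> 1 / a" for p
  proof (cases "p \<in> C")
    case True
    then have "a \<le> ?w p" using a(2) C(2) by blast
    then have "1 / ?w p \<le> 1 / a" "0 \<le> 1 / ?w p" using a(1) by (auto simp del: real_sqrt_ge_0_iff intro!: frac_le)
    then have "\<bar>1 / ?w p\<bar> \<le> 1 / a" by linarith
    then show ?thesis using True by (simp add: H_def)
  qed (use a in \<open>simp add: H_def\<close>)
  define \<zeta> where "\<zeta> x = indicator V x *\<^sub>R H (\<phi> x)" for x
  have "\<phi> \<in> borel_measurable (restrict_space \<mu> V)"
    using borel_measurable_continuous_on_restrict[OF c(7)] measurable_cong_sets[OF sets_restrict_mu[OF c(2)] refl] by blast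
  then have "(\<lambda>x. H (\<phi> x)) \<in> borel_measurable (restrict_space \<mu> V)" using H by (rule measurable_compose)
  then have \<zeta>[measurable]: "\<zeta> \<in> borel_measurable \<mu>"
    unfolding \<zeta>_def[abs_def] by (rule borel_measurable_restrict_space_iff[OF V, THEN iffD1])
  have \<zeta>_le: "\<bar>\<zeta> x\<bar> \<le> 1 / a" for x using H_le[of "\<phi> x"] a(1) by (auto simp: \<zeta>_def indicator_def)
  have C1: "C1_manifold (u k)" if "k \<in> F" for k using u that unfolding orthonormal_C1_def by blast
  have "\<forall>k\<in>F. \<exists>B. \<forall>x\<in>M. \<bar>u k x\<bar> \<le> B"
    using compact_abs_bounded[OF compact_M C1_manifold_continuous[OF C1]] by metis
  then obtain B where B: "\<And>k x. k \<in> F \<Longrightarrow> x \<in> M \<Longrightarrow> \<bar>u k x\<bar> \<le> B k" by metis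
  have \<zeta>\<sigma>: "\<zeta> (?\<sigma> p) = H p" if "p \<in> \<phi> ` V" for p using c(4,5)[OF that] by (simp add: \<zeta>_def)
  have uk: "u k \<in> borel_measurable \<mu>" if "k \<in> F" for k
    using measurable_continuous[OF C1_manifold_continuous[OF C1[OF that]]] .
  have "(\<integral>p. indicator C p * u k (?\<sigma> p) \<partial>lborel) = (\<integral>x. u k x * \<zeta> x \<partial>\<mu>)" if k: "k \<in> F" for k
  proof -
    note [measurable] = uk[OF k]
    have "(\<integral>x. u k x * \<zeta> x \<partial>\<mu>) = (\<integral>x. indicator V x * (u k x * \<zeta> x) \<partial>\<mu>)"
      by (intro Bochner_Integration.integral_cong) (auto simp: \<zeta>_def indicator_def)
    also have "\<dots> = (\<integral>p. indicator (\<phi> ` V) p * (?w p * (u k (?\<sigma> p) * \<zeta> (?\<sigma> p))) \<partial>lborel)"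
      by (rule integral_chart(1)[OF ch]) simp
    also have "\<dots> = (\<integral>p. indicator C p * u k (?\<sigma> p) \<partial>lborel)"
    proof (intro Bochner_Integration.integral_cong refl)
      fix p show "indicator (\<phi> ` V) p * (?w p * (u k (?\<sigma> p) * \<zeta> (?\<sigma> p))) = indicator C p * u k (?\<sigma> p)"
        using \<zeta>\<sigma>[of p] wpos[of p] C(2) Q(2) by (cases "p \<in> \<phi> ` V") (auto simp: H_def indicator_def)
    qed
    finally show ?thesis by simp
  qed
  then have "(\<Sum>k\<in>F. (\<integral>p. indicator C p * u k (?\<sigma> p) \<partial>lborel)\<^sup>2) = (\<Sum>k\<in>F. (\<integral>x. u k x * \<zeta> x \<partial>\<mu>)\<^sup>2)" by simp
  also have "\<dots> \<le> (\<integral>x. (\<zeta> x)\<^sup>2 \<partial>\<mu>)"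
    using u B \<zeta>_le uk unfolding orthonormal_C1_def
    by (intro mu.bessel_inequality[of F u B \<zeta> "1 / a"]) (auto simp: space_mu)
  also have "\<dots> = (\<integral>x. indicator V x * (\<zeta> x)\<^sup>2 \<partial>\<mu>)"
    by (intro Bochner_Integration.integral_cong) (auto simp: \<zeta>_def indicator_def)
  also have "\<dots> = (\<integral>p. indicator (\<phi> ` V) p * (?w p * (\<zeta> (?\<sigma> p))\<^sup>2) \<partial>lborel)"
    by (rule integral_chart(1)[OF ch]) simp
  also have "\<dots> \<le> (\<integral>p. indicator C p * (1 / a) \<partial>lborel)"
  proof (rule integral_mono')
    show "integrable lborel (\<lambda>p. indicator C p * (1 / a))"
      by (rule integrable_indicator_continuous[OF C Q(1)]) simp
    fix p show "indicator (\<phi> ` V) p * (?w p * (\<zeta> (?\<sigma> p))\<^sup>2) \<le> indicator C p * (1 / a)"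
    proof (cases "p \<in> C")
      case True
      then have p: "p \<in> \<phi> ` V" "p \<in> Q" using C(2) Q(2) by auto
      have "?w p * (\<zeta> (?\<sigma> p))\<^sup>2 = 1 / ?w p"
      proof -
        have "w * (1 / w)\<^sup>2 = 1 / w" for w :: real by (simp add: power2_eq_square)
        moreover have "\<zeta> (?\<sigma> p) = 1 / ?w p" using True by (simp add: \<zeta>\<sigma>[OF p(1)] H_def)
        ultimately show ?thesis by metis
      qed
      also have "\<dots> \<le> 1 / a" using a(1) a(2)[OF p(2)] by (simp add: frac_le)
      finally show ?thesis using p True by simp
    next
      case False
      then show ?thesis by (cases "p \<in> \<phi> ` V") (auto simp: \<zeta>\<sigma> H_def)
    qed
    show "0 \<le> indicator C p * (1 / a)" using a(1) by simp
  qed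
  also have "\<dots> = measure lborel C / a" using C(1) by simp
  finally show ?thesis .
qed

text \<open>On each cell the Poincare inequality bounds the mass of a function by its average and
  its energy. Summed over the orthonormal system, the averages over one cell contribute at most a
  constant, however large the system is; so the first term counts cells instead of
  functions.\<close>

lemma local_weyl:
  assumes p0: "p\<^sub>0 \<in> M"
  shows "\<exists>D. openin (top_of_set M) D \<and> p\<^sub>0 \<in> D \<and> (\<exists>B\<ge>0. \<forall>m\<ge>1. \<forall>F u. orthonormal_C1 F u \<longrightarrow>
     (\<Sum>k\<in>F. \<integral>x. indicator D x * (u k x)\<^sup>2 \<partial>\<mu>)
       \<le> B * real m ^ CARD('n) + B / (real m)\<^sup>2 * (\<Sum>k\<in>F. \<integral>x. grad_inner (u k) (u k) x \<partial>\<mu>))"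
proof -
  obtain V \<phi> e where ch: "chart V \<phi>" and p0V: "p\<^sub>0 \<in> V" and e: "0 < e" "cball (\<phi> p\<^sub>0) e \<subseteq> \<phi> ` V"
      and oD: "openin (top_of_set M) {x \<in> V. \<phi> x \<in> ball (\<phi> p\<^sub>0) e}" using chart_ball[OF p0] .
  note c = smooth_chartD[OF ch]
  let ?w = "vol_density V \<phi>" and ?\<sigma> = "chart_inv V \<phi>"
  \<comment> \<open>D is relatively open, as a cover requires, while Q is the compact coordinate
    ball on which density and metric have uniform bounds.\<close>
  define D where "D = {x \<in> V. \<phi> x \<in> ball (\<phi> p\<^sub>0) e}"
  define Q where "Q = cball (\<phi> p\<^sub>0) e"
  have Q: "compact Q" "convex Q" "Q \<subseteq> \<phi> ` V" "Q \<noteq> {}" "Q \<in> sets borel" using e by (auto simp: Q_def)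
  have wpos: "0 < ?w p" if "p \<in> \<phi> ` V" for p using det_metric_pos[OF ch that] by simp
  have contw: "continuous_on Q ?w"
    using continuous_on_subset[OF C1_on_continuous_on[OF C1_on_sqrt_det[OF ch]] Q(3)] .
  obtain b where b: "\<And>p. p \<in> Q \<Longrightarrow> \<bar>?w p\<bar> \<le> b" by (rule compact_abs_bounded[OF Q(1) contw]) blast
  have b0: "0 \<le> b" using b Q(4) by force
  obtain p1 where p1: "p1 \<in> Q" "\<And>p. p \<in> Q \<Longrightarrow> ?w p1 \<le> ?w p"
    using continuous_attains_inf[OF Q(1,4) contw] by blast
  define a where "a = ?w p1"
  have a: "0 < a" "\<And>p. p \<in> Q \<Longrightarrow> a \<le> ?w p" using p1 wpos Q(3) by (auto simp: a_def)
  obtain a' where a': "0 < a'"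
    "\<And>p x. p \<in> Q \<Longrightarrow> a' * (norm x)\<^sup>2 \<le> x \<bullet> (matrix_inv (metric_matrix g V \<phi> p) *v x)"
    by (rule metric_inv_lower_bound[OF ch Q(1,3)]) blast
  obtain B0 where B0: "0 \<le> B0" "\<And>m::nat. m \<ge> 1 \<Longrightarrow> \<exists>\<C>. finite \<C> \<and> real (card \<C>) \<le> B0 * real m ^ CARD('n) \<and>
     disjoint_family_on id \<C> \<and> \<Union>\<C> = Q \<and>
     (\<forall>C\<in>\<C>. convex C \<and> C \<in> sets borel \<and> (\<forall>x\<in>C. \<forall>y\<in>C. norm (x - y) \<le> real CARD('n) / real m))"
    using grid_cells[OF Q(1,2)] by blast
  \<comment> \<open>The constant of the Poincare inequality for cells of diameter
    \<open>CARD('n)\<close> / m, with the factor 1/m^2 split off.\<close>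
  define \<kappa> where "\<kappa> = 2 ^ CARD('n) * (real CARD('n))\<^sup>2"
  have \<kappa>: "0 \<le> \<kappa>" by (simp add: \<kappa>_def)
  \<comment> \<open>First summand: upper density bound b, at most B0 m^n cells, and 1/a from
    Bessel's inequality per cell. Second summand: the Poincare constant, with a a' from passing to
    the Riemannian energy.\<close>
  define B where "B = b * B0 / a + b * \<kappa> / (a * a')"
  have B_ge: "b * B0 / a \<le> B" "b * \<kappa> / (a * a') \<le> B" "0 \<le> B"
    using b0 B0 a a' \<kappa> by (auto simp: B_def)
  have "(\<Sum>k\<in>F. \<integral>x. indicator D x * (u k x)\<^sup>2 \<partial>\<mu>)
       \<le> B * real m ^ CARD('n) + B / (real m)\<^sup>2 * (\<Sum>k\<in>F. \<integral>x. grad_inner (u k) (u k) x \<partial>\<mu>)"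
    if m: "m \<ge> 1" and u: "orthonormal_C1 F u" for m :: nat and F u
  proof -
    obtain \<C> where \<C>: "finite \<C>" "real (card \<C>) \<le> B0 * real m ^ CARD('n)" "disjoint_family_on id \<C>" "\<Union>\<C> = Q"
      "\<And>C. C \<in> \<C> \<Longrightarrow> convex C" "\<And>C. C \<in> \<C> \<Longrightarrow> C \<in> sets borel"
      "\<And>C x y. C \<in> \<C> \<Longrightarrow> x \<in> C \<Longrightarrow> y \<in> C \<Longrightarrow> norm (x - y) \<le> real CARD('n) / real m"
      using B0(2)[OF m] by blast
    have CQ: "C \<subseteq> Q" if "C \<in> \<C>" for C using that \<C>(4) by blast
    have indQ: "indicator Q p = (\<Sum>C\<in>\<C>. indicator C p :: real)" for p
      using indicator_UN_disjoint[OF \<C>(1,3)] \<C>(4) by simp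
    let ?S = "\<lambda>k C. \<integral>p. indicator C p * u k (?\<sigma> p) \<partial>lborel"
    let ?I = "\<lambda>v. \<integral>x. grad_inner v v x \<partial>\<mu>"
    have main: "(\<integral>x. indicator D x * (v x)\<^sup>2 \<partial>\<mu>)
       \<le> b * ((\<Sum>C\<in>\<C>. (\<integral>p. indicator C p * v (?\<sigma> p) \<partial>lborel)\<^sup>2 / measure lborel C) + \<kappa> / (real m)\<^sup>2 * (?I v / (a * a')))"
      if v: "C1_manifold v" for v
    proof -
      let ?f = "v \<circ> ?\<sigma>" and ?G = "grad_coord V \<phi> v"
      have C1: "C1_on (\<phi> ` V) ?f" using C1_manifoldD[OF v ch] .
      have contf: "continuous_on Q ?f" using continuous_on_subset[OF C1_on_continuous_on[OF C1] Q(3)] .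
      have contG: "continuous_on Q ?G"
        unfolding grad_coord_def[abs_def]
        by (intro continuous_on_vec_lambda continuous_on_subset[OF continuous_on_partial_deriv[OF C1] Q(3)])
      have iC: "integrable lborel (\<lambda>p. indicator C p * (?f p)\<^sup>2)" "integrable lborel (\<lambda>p. indicator C p * (norm (?G p))\<^sup>2)"
        if "C \<in> sets borel" "C \<subseteq> Q" for C
        by (rule integrable_indicator_continuous[OF that Q(1)]; intro continuous_intros contf contG)+
      have vm[measurable]: "v \<in> borel_measurable \<mu>" using measurable_continuous[OF C1_manifold_continuous[OF v]] .
      have [measurable]: "D \<in> sets \<mu>" using openin_sets_mu[OF oD] unfolding D_def .
      have "(\<integral>x. indicator D x * (v x)\<^sup>2 \<partial>\<mu>) = (\<integral>x. indicator V x * (indicator D x * (v x)\<^sup>2) \<partial>\<mu>)"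
        by (intro Bochner_Integration.integral_cong) (auto simp: D_def indicator_def)
      also have "\<dots> = (\<integral>p. indicator (\<phi> ` V) p * (?w p * (indicator D (?\<sigma> p) * (v (?\<sigma> p))\<^sup>2)) \<partial>lborel)"
        by (rule integral_chart(1)[OF ch]) simp
      also have "\<dots> \<le> (\<integral>p. b * (indicator Q p * (?f p)\<^sup>2) \<partial>lborel)"
      proof (rule integral_mono')
        show "integrable lborel (\<lambda>p. b * (indicator Q p * (?f p)\<^sup>2))" using iC(1)[OF Q(5)] by simp
        fix p
        show "indicator (\<phi> ` V) p * (?w p * (indicator D (?\<sigma> p) * (v (?\<sigma> p))\<^sup>2)) \<le> b * (indicator Q p * (?f p)\<^sup>2)"
        proof (cases "p \<in> \<phi> ` V \<and> ?\<sigma> p \<in> D")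
          case True
          then have "p \<in> Q" using c(5)[of p] by (auto simp: D_def Q_def)
          then show ?thesis using True b[of p] by (auto intro!: mult_right_mono)
        qed (use b0 in auto)
        show "0 \<le> b * (indicator Q p * (?f p)\<^sup>2)" using b0 by simp
      qed
      also have "\<dots> = b * (\<Sum>C\<in>\<C>. \<integral>p. indicator C p * (?f p)\<^sup>2 \<partial>lborel)"
      proof -
        have "(\<integral>p. indicator Q p * (?f p)\<^sup>2 \<partial>lborel) = (\<integral>p. (\<Sum>C\<in>\<C>. indicator C p * (?f p)\<^sup>2) \<partial>lborel)"
          by (simp only: indQ sum_distrib_right)
        also have "\<dots> = (\<Sum>C\<in>\<C>. \<integral>p. indicator C p * (?f p)\<^sup>2 \<partial>lborel)"
          by (rule Bochner_Integration.integral_sum) (use iC(1) \<C>(6) CQ in blast)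
        finally show ?thesis by simp
      qed
      also have "\<dots> \<le> b * (\<Sum>C\<in>\<C>. (\<integral>p. indicator C p * ?f p \<partial>lborel)\<^sup>2 / measure lborel C
          + \<kappa> / (real m)\<^sup>2 * (\<integral>p. indicator C p * (norm (?G p))\<^sup>2 \<partial>lborel))"
      proof (intro mult_left_mono sum_mono b0)
        fix C assume C: "C \<in> \<C>"
        let ?A = "\<integral>p. indicator C p * (?f p)\<^sup>2 \<partial>lborel" and ?J = "\<integral>p. indicator C p * (norm (?G p))\<^sup>2 \<partial>lborel"
        let ?s = "\<integral>p. indicator C p * ?f p \<partial>lborel" and ?m = "measure lborel C"
        have der: "(?f has_derivative (\<lambda>y. y \<bullet> ?G z)) (at z)" if "z \<in> Q" for z
        proof -
          have "frechet_derivative ?f (at z) = (\<lambda>y. y \<bullet> ?G z)"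
            using frechet_derivative_grad_coord[OF v ch subsetD[OF Q(3) that]] by (rule ext)
          then show ?thesis using C1_manifold_derivative[OF v ch subsetD[OF Q(3) that]] by simp
        qed
        have pc: "?m * ?A \<le> ?s\<^sup>2 + 2 ^ DIM(real^'n) * (real CARD('n) / real m)\<^sup>2 * ?m * ?J"
          by (rule poincare_convex[OF \<C>(5,6)[OF C] CQ[OF C] Q(1) der contG \<C>(7)[OF C]])
        have k: "2 ^ DIM(real^'n) * (real CARD('n) / real m)\<^sup>2 = \<kappa> / (real m)\<^sup>2"
          by (simp add: \<kappa>_def power_divide)
        have J0: "0 \<le> ?J" by (intro integral_nonneg_AE) auto
        show "?A \<le> ?s\<^sup>2 / ?m + \<kappa> / (real m)\<^sup>2 * ?J"
        \<comment> \<open>A cell may be a null set; the quotient is then 0 by the convention for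
          division by zero, and the integral on the left vanishes too.\<close>
        proof (cases "?m = 0")
          case True
          have "emeasure lborel C < \<infinity>"
            using emeasure_bounded_finite bounded_subset[OF compact_imp_bounded[OF Q(1)] CQ[OF C]] by blast
          then have "emeasure lborel C = 0" using True by (simp add: emeasure_eq_ennreal_measure less_top)
          then have "AE p in lborel. p \<notin> C" using \<C>(6)[OF C] by (intro AE_not_in) auto
          then have "?A = 0" by (intro integral_eq_zero_AE) (auto elim!: eventually_mono)
          then show ?thesis using True J0 \<kappa> by simp
        next
          case False
          then have "0 < ?m" by (simp add: less_le)
          then show ?thesis using pc unfolding k by (simp add: field_simps)
        qed
      qed
      also have "\<dots> = b * ((\<Sum>C\<in>\<C>. (\<integral>p. indicator C p * v (?\<sigma> p) \<partial>lborel)\<^sup>2 / measure lborel C)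
          + \<kappa> / (real m)\<^sup>2 * (\<integral>p. indicator Q p * (norm (?G p))\<^sup>2 \<partial>lborel))"
      proof -
        have "(\<integral>p. indicator Q p * (norm (?G p))\<^sup>2 \<partial>lborel) = (\<integral>p. (\<Sum>C\<in>\<C>. indicator C p * (norm (?G p))\<^sup>2) \<partial>lborel)"
          by (simp only: indQ sum_distrib_right)
        also have "\<dots> = (\<Sum>C\<in>\<C>. \<integral>p. indicator C p * (norm (?G p))\<^sup>2 \<partial>lborel)"
          by (rule Bochner_Integration.integral_sum) (use iC(2) \<C>(6) CQ in blast)
        finally show ?thesis by (simp add: sum.distrib sum_distrib_left)
      qed
      also have "\<dots> \<le> b * ((\<Sum>C\<in>\<C>. (\<integral>p. indicator C p * v (?\<sigma> p) \<partial>lborel)\<^sup>2 / measure lborel C)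
          + \<kappa> / (real m)\<^sup>2 * (?I v / (a * a')))"
      proof (intro mult_left_mono add_left_mono b0)
        have cg: "continuous_on M (grad_inner v v)" using continuous_on_grad_inner[OF v v] .
        have V: "V \<in> sets \<mu>" using openin_sets_mu[OF c(3)] .
        have iV: "integrable \<mu> (\<lambda>x. indicator V x * grad_inner v v x)"
          using integrable_real_mult_indicator[OF V integrable_continuous[OF cg]] by (simp add: mult.commute)
        \<comment> \<open>On Q the density is at least a and the inverse metric at least a' times
          the Euclidean form, which trades the coordinate gradient for the energy on the
          manifold.\<close>
        have "a * a' * (\<integral>p. indicator Q p * (norm (?G p))\<^sup>2 \<partial>lborel) = (\<integral>p. a * a' * (indicator Q p * (norm (?G p))\<^sup>2) \<partial>lborel)"
          by simp
        also have "\<dots> \<le> (\<integral>p. indicator (\<phi> ` V) p * (?w p * grad_inner v v (?\<sigma> p)) \<partial>lborel)"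
        proof (rule integral_mono')
          show "integrable lborel (\<lambda>p. indicator (\<phi> ` V) p * (?w p * grad_inner v v (?\<sigma> p)))"
            using integral_chart(2)[OF ch measurable_continuous[OF cg]] iV by blast
          fix p
          have nn: "0 \<le> indicator (\<phi> ` V) p * (?w p * grad_inner v v (?\<sigma> p))"
          proof (cases "p \<in> \<phi> ` V")
            case True
            then have "?\<sigma> p \<in> M" using c(2,4) by blast
            from grad_inner_nonneg[OF this v] wpos[OF True] show ?thesis by (intro mult_nonneg_nonneg) auto
          qed simp
          then show "0 \<le> indicator (\<phi> ` V) p * (?w p * grad_inner v v (?\<sigma> p))" .
          show "a * a' * (indicator Q p * (norm (?G p))\<^sup>2) \<le> indicator (\<phi> ` V) p * (?w p * grad_inner v v (?\<sigma> p))"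
          proof (cases "p \<in> Q")
            case True
            then have p: "p \<in> \<phi> ` V" using Q(3) by blast
            have "grad_inner v v (?\<sigma> p) = ?G p \<bullet> (matrix_inv (metric_matrix g V \<phi> p) *v ?G p)"
              using grad_inner_eq[OF ch c(4)[OF p] v v] c(5)[OF p] by (simp add: grad_inner_coord_def)
            then have "a' * (norm (?G p))\<^sup>2 \<le> grad_inner v v (?\<sigma> p)" using a'(2)[OF True] by simp
            then have "a * (a' * (norm (?G p))\<^sup>2) \<le> ?w p * grad_inner v v (?\<sigma> p)"
              using a(1) a(2)[OF True] a'(1) wpos[OF p] by (intro mult_mono) auto
            then show ?thesis using True p by simp
          qed (use nn in simp)
        qed
        also have "\<dots> = (\<integral>x. indicator V x * grad_inner v v x \<partial>\<mu>)"
          using integral_chart(1)[OF ch measurable_continuous[OF cg]] by simp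
        also have "\<dots> \<le> ?I v"
        proof (rule integral_mono'[OF integrable_continuous[OF cg]])
          fix x assume "x \<in> space \<mu>"
          then show "0 \<le> grad_inner v v x" "indicator V x * grad_inner v v x \<le> grad_inner v v x"
            using grad_inner_nonneg[OF _ v, of x] by (auto simp: space_mu indicator_def)
        qed
        finally show "(\<integral>p. indicator Q p * (norm (?G p))\<^sup>2 \<partial>lborel) \<le> ?I v / (a * a')"
          using a(1) a'(1) by (simp add: field_simps)
        show "0 \<le> \<kappa> / (real m)\<^sup>2" using \<kappa> by simp
      qed
      finally show ?thesis .
    qed
    have I0: "0 \<le> ?I (u k)" if "k \<in> F" for k
      using u that grad_inner_nonneg unfolding orthonormal_C1_def by (intro integral_nonneg_AE AE_I2) (auto simp: space_mu)
    have "(\<Sum>k\<in>F. \<integral>x. indicator D x * (u k x)\<^sup>2 \<partial>\<mu>)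
      \<le> (\<Sum>k\<in>F. b * ((\<Sum>C\<in>\<C>. (?S k C)\<^sup>2 / measure lborel C) + \<kappa> / (real m)\<^sup>2 * (?I (u k) / (a * a'))))"
      using u main unfolding orthonormal_C1_def by (intro sum_mono) blast
    also have "\<dots> = b * (\<Sum>k\<in>F. \<Sum>C\<in>\<C>. (?S k C)\<^sup>2 / measure lborel C) + b * \<kappa> / (a * a') * (1 / (real m)\<^sup>2 * (\<Sum>k\<in>F. ?I (u k)))"
      by (simp add: sum.distrib sum_distrib_left ring_distribs ac_simps)
    also have "(\<Sum>k\<in>F. \<Sum>C\<in>\<C>. (?S k C)\<^sup>2 / measure lborel C) = (\<Sum>C\<in>\<C>. \<Sum>k\<in>F. (?S k C)\<^sup>2 / measure lborel C)"
      by (rule sum.swap)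
    also have "b * (\<Sum>C\<in>\<C>. \<Sum>k\<in>F. (?S k C)\<^sup>2 / measure lborel C) \<le> b * (\<Sum>C\<in>\<C>. 1 / a)"
    proof (intro mult_left_mono sum_mono b0)
      fix C assume C: "C \<in> \<C>"
      have "(\<Sum>k\<in>F. (?S k C)\<^sup>2) \<le> measure lborel C / a"
        by (rule sum_cell_integrals_le[OF ch Q(1,3) \<C>(6)[OF C] CQ[OF C] a u])
      then have "(\<Sum>k\<in>F. (?S k C)\<^sup>2) / measure lborel C \<le> (measure lborel C / a) / measure lborel C"
        by (intro divide_right_mono) auto
      also have "\<dots> \<le> 1 / a" using a(1) by (cases "measure lborel C = 0") auto
      finally show "(\<Sum>k\<in>F. (?S k C)\<^sup>2 / measure lborel C) \<le> 1 / a" by (simp add: sum_divide_distrib)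
    qed
    also have "b * (\<Sum>C\<in>\<C>. 1 / a) = b / a * real (card \<C>)" by simp
    also have "b / a * real (card \<C>) \<le> b / a * (B0 * real m ^ CARD('n))"
      using \<C>(2) b0 a(1) by (intro mult_left_mono) auto
    also have "b / a * (B0 * real m ^ CARD('n)) = b * B0 / a * real m ^ CARD('n)" by simp
    also have "b * B0 / a * real m ^ CARD('n) \<le> B * real m ^ CARD('n)" using B_ge by (intro mult_right_mono) auto
    also have "b * \<kappa> / (a * a') * (1 / (real m)\<^sup>2 * (\<Sum>k\<in>F. ?I (u k))) \<le> B * (1 / (real m)\<^sup>2 * (\<Sum>k\<in>F. ?I (u k)))"
      using B_ge I0 by (intro mult_right_mono mult_nonneg_nonneg sum_nonneg) auto
    finally show ?thesis by simp
  qed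
  then show ?thesis using oD p0V e(1) B_ge(3) unfolding D_def
    by (intro exI[of _ "{x \<in> V. \<phi> x \<in> ball (\<phi> p\<^sub>0) e}"] conjI exI[of _ B]) auto
qed

text \<open>Each function has norm one and the sets of a finite cover exhaust M, so its masses over
  them add up to at least 1. Summing the local estimates over the cover therefore bounds the number
  of functions.\<close>

theorem weyl_bound:
  "\<exists>B\<ge>0. \<forall>m\<ge>1. \<forall>F u. orthonormal_C1 F u \<longrightarrow>
     real (card F) \<le> B * real m ^ CARD('n) + B / (real m)\<^sup>2 * (\<Sum>k\<in>F. \<integral>x. grad_inner (u k) (u k) x \<partial>\<mu>)"
proof -
  define R where "R D B \<longleftrightarrow> 0 \<le> B \<and> (\<forall>m\<ge>1. \<forall>F u. orthonormal_C1 F u \<longrightarrow>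
     (\<Sum>k\<in>F. \<integral>x. indicator D x * (u k x)\<^sup>2 \<partial>\<mu>)
       \<le> B * real m ^ CARD('n) + B / (real m)\<^sup>2 * (\<Sum>k\<in>F. \<integral>x. grad_inner (u k) (u k) x \<partial>\<mu>))" for D B
  have "\<exists>D. openin (top_of_set M) D \<and> p \<in> D \<and> (\<exists>B. R D B)" if "p \<in> M" for p
    using local_weyl[OF that] unfolding R_def by blast
  then obtain \<D> where \<D>: "finite \<D>" "\<Union>\<D> = M" "\<And>D. D \<in> \<D> \<Longrightarrow> openin (top_of_set M) D \<and> (\<exists>B. R D B)"
    using finite_subcover[of "\<lambda>D. \<exists>B. R D B"] by metis
  then obtain B where B: "\<And>D. D \<in> \<D> \<Longrightarrow> R D (B D)" by metis
  have "real (card F) \<le> (\<Sum>D\<in>\<D>. B D) * real m ^ CARD('n)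
      + (\<Sum>D\<in>\<D>. B D) / (real m)\<^sup>2 * (\<Sum>k\<in>F. \<integral>x. grad_inner (u k) (u k) x \<partial>\<mu>)"
    if m: "m \<ge> 1" and u: "orthonormal_C1 F u" for m :: nat and F u
  proof -
    have "1 \<le> (\<Sum>D\<in>\<D>. \<integral>x. indicator D x * (u k x)\<^sup>2 \<partial>\<mu>)" if k: "k \<in> F" for k
    proof -
      have cont: "continuous_on M (\<lambda>x. (u k x)\<^sup>2)"
        using u k C1_manifold_continuous unfolding orthonormal_C1_def by (intro continuous_intros) blast
      have iD: "integrable \<mu> (\<lambda>x. indicator D x * (u k x)\<^sup>2)" if "D \<in> \<D>" for D
        using integrable_real_mult_indicator[OF openin_sets_mu integrable_continuous[OF cont], of D] \<D>(3)[OF that]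
        by (simp add: mult.commute)
      have "1 = (\<integral>x. (u k x)\<^sup>2 \<partial>\<mu>)"
        using u k unfolding orthonormal_C1_def by (simp add: power2_eq_square)
      also have "\<dots> \<le> (\<integral>x. (\<Sum>D\<in>\<D>. indicator D x * (u k x)\<^sup>2) \<partial>\<mu>)"
      proof (rule integral_mono')
        show "integrable \<mu> (\<lambda>x. \<Sum>D\<in>\<D>. indicator D x * (u k x)\<^sup>2)"
          using iD by (intro Bochner_Integration.integrable_sum) blast
        fix x assume "x \<in> space \<mu>"
        then obtain D0 where D0: "D0 \<in> \<D>" "x \<in> D0" using \<D>(2) by (auto simp: space_mu)
        have "indicator D0 x * (u k x)\<^sup>2 \<le> (\<Sum>D\<in>\<D>. indicator D x * (u k x)\<^sup>2)"
          by (rule member_le_sum[OF D0(1) _ \<D>(1)]) auto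
        then show "(u k x)\<^sup>2 \<le> (\<Sum>D\<in>\<D>. indicator D x * (u k x)\<^sup>2)" using D0(2) by simp
        show "0 \<le> (\<Sum>D\<in>\<D>. indicator D x * (u k x)\<^sup>2)" by (intro sum_nonneg) auto
      qed
      also have "\<dots> = (\<Sum>D\<in>\<D>. \<integral>x. indicator D x * (u k x)\<^sup>2 \<partial>\<mu>)"
        by (rule Bochner_Integration.integral_sum) (rule iD)
      finally show ?thesis .
    qed
    then have "(\<Sum>k\<in>F. 1) \<le> (\<Sum>k\<in>F. \<Sum>D\<in>\<D>. \<integral>x. indicator D x * (u k x)\<^sup>2 \<partial>\<mu>)" by (intro sum_mono)
    also have "\<dots> = (\<Sum>D\<in>\<D>. \<Sum>k\<in>F. \<integral>x. indicator D x * (u k x)\<^sup>2 \<partial>\<mu>)" by (rule sum.swap)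
    also have "\<dots> \<le> (\<Sum>D\<in>\<D>. B D * real m ^ CARD('n)
        + B D / (real m)\<^sup>2 * (\<Sum>k\<in>F. \<integral>x. grad_inner (u k) (u k) x \<partial>\<mu>))"
      using B m u unfolding R_def by (intro sum_mono) blast
    also have "\<dots> = (\<Sum>D\<in>\<D>. B D) * real m ^ CARD('n)
      + (\<Sum>D\<in>\<D>. B D) / (real m)\<^sup>2 * (\<Sum>k\<in>F. \<integral>x. grad_inner (u k) (u k) x \<partial>\<mu>)"
      by (simp only: sum.distrib sum_distrib_right sum_divide_distrib)
    finally show ?thesis by simp
  qed
  moreover have "0 \<le> (\<Sum>D\<in>\<D>. B D)" using B unfolding R_def by (intro sum_nonneg) blast
  ultimately show ?thesis by blast
qed

end

section \<open>Independence of the scattering transform from the eigenbasis\<close>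

text \<open>The outer sum runs over all possible values a, empty fibres contributing 0. Two series
  with different index functions thus take the same form and can be compared fibre by fibre.\<close>

lemma suminf_eq_infsum_fibres:
  fixes f :: "nat \<Rightarrow> real" and h :: "nat \<Rightarrow> 'b"
  assumes f: "summable (\<lambda>k. \<bar>f k\<bar>)" and fin: "\<And>a. finite {k. h k = a}"
  shows "(\<Sum>k. f k) = (\<Sum>\<^sub>\<infinity>a. \<Sum>k | h k = a. f k)"
proof -
  have hs: "(f has_sum (\<Sum>k. f k)) UNIV"
    by (rule norm_summable_imp_has_sum) (use f summable_rabs_cancel summable_sums in auto)
  have bij: "bij_betw (\<lambda>k. (h k, k)) UNIV (Sigma UNIV (\<lambda>a. {k. h k = a}))"
    by (auto simp: bij_betw_def inj_on_def)
  have "(f has_sum (\<Sum>k. f k)) UNIV \<longleftrightarrow> ((\<lambda>z. f (snd z)) has_sum (\<Sum>k. f k)) (Sigma UNIV (\<lambda>a. {k. h k = a}))"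
    using has_sum_reindex_bij_betw[OF bij, of "\<lambda>z. f (snd z)"] by simp
  with hs have hs': "((\<lambda>z. f (snd z)) has_sum (\<Sum>k. f k)) (Sigma UNIV (\<lambda>a. {k. h k = a}))" by blast
  then have s: "(\<lambda>z. f (snd z)) summable_on (Sigma UNIV (\<lambda>a. {k. h k = a}))" by (rule has_sum_imp_summable)
  have "(\<Sum>k. f k) = infsum (\<lambda>z. f (snd z)) (Sigma UNIV (\<lambda>a. {k. h k = a}))"
    using infsumI[OF hs'] by simp
  also have "\<dots> = (\<Sum>\<^sub>\<infinity>a. \<Sum>\<^sub>\<infinity>k\<in>{k. h k = a}. f k)"
    using infsum_Sigma_banach[OF s] by simp
  also have "\<dots> = (\<Sum>\<^sub>\<infinity>a. \<Sum>k | h k = a. f k)" using fin by simp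
  finally show ?thesis .
qed

text \<open>Bounds for H and for x^p H together control the weight (1 + x)^p, because 1 + x \<le> 2
  max 1 x.\<close>

lemma schwartz_half_line_decay:
  assumes "schwartz_half_line G"
  obtains C where "0 \<le> C" "\<And>x. 0 \<le> x \<Longrightarrow> \<bar>G x\<bar> * (1 + x) ^ p \<le> C"
proof -
  obtain H where H: "\<And>k m. \<exists>C. \<forall>x. \<bar>x ^ m * (deriv ^^ k) H x\<bar> \<le> C" "\<And>x. 0 \<le> x \<Longrightarrow> G x = H x"
    using assms unfolding schwartz_half_line_def by blast
  obtain C0 where C0: "\<And>x. \<bar>H x\<bar> \<le> C0" using H(1)[of 0 0] by auto
  obtain C1 where C1: "\<And>x. \<bar>x ^ p * H x\<bar> \<le> C1" using H(1)[of p 0] by auto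
  have "0 \<le> C0" "0 \<le> C1" using C0[of 0] C1[of 0] by linarith+
  moreover have "\<bar>G x\<bar> * (1 + x) ^ p \<le> 2 ^ p * (C0 + C1)" if x: "0 \<le> x" for x
  proof -
    have "(1 + x) ^ p \<le> (2 * max 1 x) ^ p" using x by (intro power_mono) auto
    also have "\<dots> = 2 ^ p * max 1 x ^ p" by (simp add: power_mult_distrib)
    also have "max 1 x ^ p \<le> 1 + x ^ p" using x by (cases "x \<le> 1") (auto simp: max_def)
    finally have "(1 + x) ^ p \<le> 2 ^ p * (1 + x ^ p)" by simp
    then have "\<bar>G x\<bar> * (1 + x) ^ p \<le> \<bar>H x\<bar> * (2 ^ p * (1 + x ^ p))"
      using H(2)[OF x] by (simp add: mult_left_mono)
    also have "\<dots> = 2 ^ p * (\<bar>H x\<bar> + \<bar>x ^ p * H x\<bar>)" using x by (simp add: abs_mult algebra_simps)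
    also have "\<dots> \<le> 2 ^ p * (C0 + C1)" using C0[of x] C1[of x] by (intro mult_left_mono add_mono) auto
    finally show ?thesis .
  qed
  ultimately show ?thesis using that[of "2 ^ p * (C0 + C1)"] by simp
qed

section \<open>Growth of the eigenvalues and summability of the wavelet coefficients\<close>

context riemannian_manifold
begin

abbreviation eigenbasis :: "(nat \<Rightarrow> real) \<Rightarrow> (nat \<Rightarrow> 'a \<Rightarrow> real) \<Rightarrow> bool" where
  "eigenbasis lam e \<equiv> laplace_eigenbasis n M g \<mu> lam e"

lemma eigenbasisD:
  assumes "eigenbasis lam e"
  shows "incseq lam" "has_laplacian n M g (e k) (\<lambda>x. - lam k * e k x)"
    "(\<integral>x. e k x * e l x \<partial>\<mu>) = (if k = l then 1 else 0)"
    "C1_manifold (e k)" "continuous_on M (e k)" "e k \<in> borel_measurable \<mu>"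
proof -
  show "incseq lam" and l: "has_laplacian n M g (e k) (\<lambda>x. - lam k * e k x)"
    and "(\<integral>x. e k x * e l x \<partial>\<mu>) = (if k = l then 1 else 0)"
    using assms unfolding laplace_eigenbasis_def orthonormal_basis_L2_def by blast+
  show c: "C1_manifold (e k)" using eigenfunction_C1[OF l] .
  show "continuous_on M (e k)" by (rule C1_manifold_continuous[OF c])
  then show "e k \<in> borel_measurable \<mu>" by (rule measurable_continuous)
qed

lemma grad_inner_eigenfunction:
  assumes "eigenbasis lam e" shows "(\<integral>x. grad_inner (e k) (e k) x \<partial>\<mu>) = lam k"
  using green_eigenfunction[OF eigenbasisD(4,2)[OF assms]] eigenbasisD(3)[OF assms, of k k] by simp

lemma eigenvalue_nonneg:
  assumes e: "eigenbasis lam e" shows "0 \<le> lam k"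
  unfolding grad_inner_eigenfunction[OF e, of k, symmetric]
  using grad_inner_nonneg[OF _ eigenbasisD(4)[OF e]] by (intro integral_nonneg_AE AE_I2) (auto simp: space_mu)

text \<open>The counting estimate is applied to the first k + 1 eigenfunctions, whose energies are
  their eigenvalues and so at most \<open>lam k\<close> each. The grid parameter is chosen such that
  the energy term is at most half of k + 1 and can be absorbed.\<close>

lemma eigenvalue_growth:
  assumes e: "eigenbasis lam e"
  obtains A where "0 \<le> A" "\<And>k. real (Suc k) \<le> A * (1 + lam k) ^ CARD('n)"
proof -
  obtain B where B: "0 \<le> B" "\<And>m F u. m \<ge> 1 \<Longrightarrow> orthonormal_C1 F u \<Longrightarrow>
     real (card F) \<le> B * real m ^ CARD('n) + B / (real m)\<^sup>2 * (\<Sum>k\<in>F. \<integral>x. grad_inner (u k) (u k) x \<partial>\<mu>)"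
    using weyl_bound by blast
  define A where "A = 2 * B * (2 * B + 2) ^ CARD('n)"
  have "real (Suc k) \<le> A * (1 + lam k) ^ CARD('n)" for k
  proof -
    have L: "0 \<le> lam k" by (rule eigenvalue_nonneg[OF e])
    \<comment> \<open>Of order 2 B \<open>lam k\<close>, and at least 1 also when
      \<open>lam k\<close> = 0. Since m \<le> m^2, the denominator m^2 already dominates 2 B
      \<open>lam k\<close>; this linear choice of m is the origin of the exponent
      \<open>CARD('n)\<close>.\<close>
    define m where "m = nat \<lceil>2 * B * lam k\<rceil> + 1"
    have x0: "0 \<le> 2 * B * lam k" using B L by simp
    have m: "1 \<le> m" "2 * B * lam k \<le> real m" "real m \<le> 2 * B * lam k + 2"
      using x0 unfolding m_def by linarith+
    have m2: "real m \<le> (real m)\<^sup>2" using m(1) by (simp add: power2_eq_square)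
    have "orthonormal_C1 {..k} e" using eigenbasisD[OF e] by (simp add: orthonormal_C1_def)
    from B(2)[OF m(1) this]
    have "real (Suc k) \<le> B * real m ^ CARD('n) + B / (real m)\<^sup>2 * (\<Sum>i\<le>k. lam i)"
      by (simp add: grad_inner_eigenfunction[OF e])
    also have "(\<Sum>i\<le>k. lam i) \<le> real (Suc k) * lam k"
      using sum_bounded_above[of "{..k}" lam "lam k"] incseqD[OF eigenbasisD(1)[OF e]] by simp
    also have "B / (real m)\<^sup>2 * (real (Suc k) * lam k) = (2 * B * lam k) / (real m)\<^sup>2 * (real (Suc k) / 2)" by simp
    also have "\<dots> \<le> 1 * (real (Suc k) / 2)"
    proof (rule mult_right_mono)
      have "2 * B * lam k \<le> (real m)\<^sup>2" "0 < (real m)\<^sup>2" using m m2 by linarith+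
      then show "(2 * B * lam k) / (real m)\<^sup>2 \<le> 1" by (simp only: pos_divide_le_eq mult_1)
    qed simp
    finally have "real (Suc k) \<le> B * real m ^ CARD('n) + 1 * (real (Suc k) / 2)"
      using B(1) by (simp add: mult_left_mono divide_right_mono)
    moreover have "a \<le> 2 * b" if "a \<le> b + 1 * (a / 2)" for a b :: real using that by linarith
    ultimately have "real (Suc k) \<le> 2 * (B * real m ^ CARD('n))" by blast
    then have "real (Suc k) \<le> 2 * B * real m ^ CARD('n)" by (simp only: mult.assoc)
    also have "\<dots> \<le> 2 * B * ((2 * B + 2) * (1 + lam k)) ^ CARD('n)"
    proof (intro mult_left_mono power_mono)
      have "2 * B * lam k + 2 \<le> (2 * B + 2) * (1 + lam k)" using B(1) L by (simp add: algebra_simps)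
      then show "real m \<le> (2 * B + 2) * (1 + lam k)" using m(3) by linarith
    qed (use B in auto)
    also have "\<dots> = A * (1 + lam k) ^ CARD('n)" by (simp add: A_def power_mult_distrib)
    finally show ?thesis .
  qed
  moreover have "0 \<le> A" using B(1) by (simp add: A_def)
  ultimately show ?thesis using that by blast
qed

text \<open>On a fibre the right-hand side of the growth bound is constant, which bounds the
  index.\<close>

lemma finite_eigenvalue_fibre:
  assumes e: "eigenbasis lam e" shows "finite {k. lam k = a}"
proof -
  obtain A where A: "\<And>k. real (Suc k) \<le> A * (1 + lam k) ^ CARD('n)" using eigenvalue_growth[OF e] by blast
  have "{k. lam k = a} \<subseteq> {.. nat \<lceil>A * (1 + a) ^ CARD('n)\<rceil>}"
  proof
    fix k assume "k \<in> {k. lam k = a}"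
    then have "real (Suc k) \<le> A * (1 + a) ^ CARD('n)" using A[of k] by simp
    then show "k \<in> {.. nat \<lceil>A * (1 + a) ^ CARD('n)\<rceil>}" by simp linarith
  qed
  then show ?thesis using finite_subset by blast
qed

text \<open>By the growth bound the weight with exponent 2 \<open>CARD('n)\<close> dominates the
  square of k + 1, so decay of G against that weight makes the terms of order 1 / (k + 1)^2.\<close>

lemma summable_schwartz_eigenvalues:
  assumes e: "eigenbasis lam e" and G: "schwartz_half_line G" and s: "0 < s"
  shows "summable (\<lambda>k. \<bar>G (s * lam k)\<bar>)"
proof -
  let ?n = "CARD('n)"
  obtain A where A: "0 \<le> A" "\<And>k. real (Suc k) \<le> A * (1 + lam k) ^ ?n" using eigenvalue_growth[OF e] by blast
  obtain C where C: "0 \<le> C" "\<And>x. 0 \<le> x \<Longrightarrow> \<bar>G x\<bar> * (1 + x) ^ (2 * ?n) \<le> C"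
    using schwartz_half_line_decay[OF G] by blast
  \<comment> \<open>This factor accounts for the dilation: 1 + \<open>lam k\<close> \<le> (1 + 1/s)
    (1 + s \<open>lam k\<close>).\<close>
  define c where "c = 1 + 1 / s"
  have c: "0 \<le> c" using s by (simp add: c_def)
  define E where "E = (A * c ^ ?n)\<^sup>2"
  have bound: "\<bar>G (s * lam k)\<bar> \<le> (C * E) * inverse ((real (Suc k))\<^sup>2)" for k
  proof -
    have L: "0 \<le> lam k" by (rule eigenvalue_nonneg[OF e])
    then have sL: "0 \<le> s * lam k" using s by simp
    have "1 + lam k \<le> c * (1 + s * lam k)" using s L by (simp add: c_def field_simps)
    then have "(1 + lam k) ^ ?n \<le> (c * (1 + s * lam k)) ^ ?n" using L by (intro power_mono) auto
    then have "real (Suc k) \<le> A * (c * (1 + s * lam k)) ^ ?n"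
      using A(2)[of k] mult_left_mono[OF _ A(1)] by fastforce
    then have "(real (Suc k))\<^sup>2 \<le> (A * (c * (1 + s * lam k)) ^ ?n)\<^sup>2" by (intro power_mono) auto
    also have "\<dots> = E * (1 + s * lam k) ^ (2 * ?n)"
      by (simp add: E_def power_mult_distrib power_mult[symmetric] mult.commute)
    finally have le: "(real (Suc k))\<^sup>2 \<le> E * (1 + s * lam k) ^ (2 * ?n)" .
    have "\<bar>G (s * lam k)\<bar> * (real (Suc k))\<^sup>2 \<le> \<bar>G (s * lam k)\<bar> * (E * (1 + s * lam k) ^ (2 * ?n))"
      by (rule mult_left_mono[OF le]) simp
    also have "\<dots> = E * (\<bar>G (s * lam k)\<bar> * (1 + s * lam k) ^ (2 * ?n))" by (simp add: ac_simps)
    also have "\<dots> \<le> E * C" by (rule mult_left_mono[OF C(2)[OF sL]]) (simp add: E_def)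
    finally have "\<bar>G (s * lam k)\<bar> * (real (Suc k))\<^sup>2 \<le> C * E" by (simp add: mult.commute)
    moreover have "0 < (real (Suc k))\<^sup>2" by simp
    ultimately show ?thesis unfolding divide_inverse[symmetric] by (simp only: pos_le_divide_eq)
  qed
  have "summable (\<lambda>k. inverse ((real (Suc k))\<^sup>2))"
    using inverse_power_summable[of 2, where 'a = real] by (subst summable_Suc_iff) simp
  then have "summable (\<lambda>k. (C * E) * inverse ((real (Suc k))\<^sup>2))" by (rule summable_mult)
  then show ?thesis by (rule summable_comparison_test'[where N = 0]) (use bound in simp)
qed

lemma summable_wavelet_coeff:
  assumes e: "eigenbasis lam e" and G: "schwartz_half_line G"
  shows "summable (\<lambda>k. \<bar>wavelet_coeff G lam j k\<bar>)"
proof (rule summable_comparison_test'[where N = 0])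
  show "summable (\<lambda>k. \<bar>G (2 powi (j - 1) * lam k)\<bar> + \<bar>G (2 powi j * lam k)\<bar>)"
    by (intro summable_add summable_schwartz_eigenvalues[OF e G]) auto
  fix k
  have sq: "\<bar>a\<^sup>2 - b\<^sup>2\<bar> \<le> (\<bar>a\<bar> + \<bar>b\<bar>)\<^sup>2" for a b :: real
  proof -
    have "\<bar>a\<^sup>2 - b\<^sup>2\<bar> \<le> \<bar>a\<bar>\<^sup>2 + \<bar>b\<bar>\<^sup>2" using abs_triangle_ineq4[of "a\<^sup>2" "b\<^sup>2"] by simp
    also have "\<dots> \<le> (\<bar>a\<bar> + \<bar>b\<bar>)\<^sup>2" by (simp add: power2_sum)
    finally show ?thesis .
  qed
  \<comment> \<open>The real \<open>sqrt\<close> is an odd function, so its modulus is the root of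
    the modulus. The difference of the two squares is at most the square of the sum of the moduli,
    so the decay of G itself bounds the coefficient.\<close>
  have "\<bar>wavelet_coeff G lam j k\<bar> = sqrt \<bar>(G (2 powi (j - 1) * lam k))\<^sup>2 - (G (2 powi j * lam k))\<^sup>2\<bar>"
    by (simp add: wavelet_coeff_def real_sqrt_abs2 flip: real_sqrt_abs')
  also have "\<dots> \<le> \<bar>G (2 powi (j - 1) * lam k)\<bar> + \<bar>G (2 powi j * lam k)\<bar>"
    by (rule real_le_lsqrt) (use sq in auto)
  finally show "norm \<bar>wavelet_coeff G lam j k\<bar> \<le> \<bar>G (2 powi (j - 1) * lam k)\<bar> + \<bar>G (2 powi j * lam k)\<bar>" by simp
qed

section \<open>Convergence almost everywhere and change of eigenbasis\<close>

lemma AE_summable_squares: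
  assumes e: "eigenbasis lam e" and c: "summable (\<lambda>k. \<bar>c k\<bar>)"
  shows "AE x in \<mu>. summable (\<lambda>k. \<bar>c k\<bar> * (e k x)\<^sup>2)"
proof -
  note [measurable] = eigenbasisD(6)[OF e]
  have "(\<integral>\<^sup>+x. (\<Sum>k. ennreal (\<bar>c k\<bar> * (e k x)\<^sup>2)) \<partial>\<mu>) = (\<Sum>k. \<integral>\<^sup>+x. ennreal (\<bar>c k\<bar> * (e k x)\<^sup>2) \<partial>\<mu>)"
    by (rule nn_integral_suminf) simp
  also have "\<dots> = (\<Sum>k. ennreal \<bar>c k\<bar>)"
  proof (intro suminf_cong)
    fix k
    have "integrable \<mu> (\<lambda>x. \<bar>c k\<bar> * (e k x)\<^sup>2)"
      using eigenbasisD(5)[OF e, of k] by (intro integrable_continuous continuous_intros)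
    then have "(\<integral>\<^sup>+x. ennreal (\<bar>c k\<bar> * (e k x)\<^sup>2) \<partial>\<mu>) = ennreal (\<integral>x. \<bar>c k\<bar> * (e k x)\<^sup>2 \<partial>\<mu>)"
      by (rule nn_integral_eq_integral) simp
    then show "(\<integral>\<^sup>+x. ennreal (\<bar>c k\<bar> * (e k x)\<^sup>2) \<partial>\<mu>) = ennreal \<bar>c k\<bar>"
      using eigenbasisD(3)[OF e, of k k] by (simp add: power2_eq_square)
  qed
  also have "\<dots> \<noteq> \<infinity>" using c by (simp add: suminf_ennreal2)
  finally have "AE x in \<mu>. (\<Sum>k. ennreal (\<bar>c k\<bar> * (e k x)\<^sup>2)) \<noteq> \<infinity>"
    by (intro nn_integral_noteq_infinite) simp_all
  then show ?thesis
    by (rule eventually_mono) (auto intro!: summable_suminf_not_top)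
qed

text \<open>A product is dominated by the sum of the squares, so convergence at x and at y
  separately suffices. The exceptional set is therefore a null set in one variable, used for both
  arguments, instead of a null set in the product.\<close>

lemma summable_kernel:
  fixes c :: "nat \<Rightarrow> real"
  assumes "summable (\<lambda>k. \<bar>c k\<bar> * (e k x)\<^sup>2)" "summable (\<lambda>k. \<bar>c k\<bar> * (e k y)\<^sup>2)"
  shows "summable (\<lambda>k. \<bar>c k * e k x * e k y\<bar>)"
proof (rule summable_comparison_test'[where N = 0])
  show "summable (\<lambda>k. \<bar>c k\<bar> * (e k x)\<^sup>2 + \<bar>c k\<bar> * (e k y)\<^sup>2)" using assms by (rule summable_add)
  fix k
  have "0 \<le> (\<bar>e k x\<bar> - \<bar>e k y\<bar>)\<^sup>2" by simp
  then have "2 * (\<bar>e k x\<bar> * \<bar>e k y\<bar>) \<le> (e k x)\<^sup>2 + (e k y)\<^sup>2" by (simp add: power2_diff)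
  moreover have "0 \<le> \<bar>e k x\<bar> * \<bar>e k y\<bar>" by simp
  ultimately have "\<bar>e k x\<bar> * \<bar>e k y\<bar> \<le> (e k x)\<^sup>2 + (e k y)\<^sup>2" by linarith
  from mult_left_mono[OF this, of "\<bar>c k\<bar>"]
  show "norm \<bar>c k * e k x * e k y\<bar> \<le> \<bar>c k\<bar> * (e k x)\<^sup>2 + \<bar>c k\<bar> * (e k y)\<^sup>2"
    by (simp add: abs_mult algebra_simps)
qed

text \<open>Completeness of e' expands e k in mean square. Orthogonality of eigenspaces kills every
  coefficient outside the eigenvalue \<open>lam k\<close>, so the partial sums are eventually
  constant and equal a finite sum; the remainder has norm zero and hence vanishes almost everywhere.
  Countability lets one null set serve all k.\<close>

lemma AE_change_of_eigenbasis:
  assumes e: "eigenbasis lam e" and e': "eigenbasis lam' e'"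
  shows "AE x in \<mu>. \<forall>k. e k x = (\<Sum>l | lam' l = lam k. (\<integral>y. e k y * e' l y \<partial>\<mu>) * e' l x)"
  unfolding AE_all_countable
proof
  fix k
  let ?c = "\<lambda>l. \<integral>y. e k y * e' l y \<partial>\<mu>"
  let ?S = "{l. lam' l = lam k}"
  have c0: "?c l = 0" if "l \<notin> ?S" for l
    using eigenfunctions_orthogonal[OF eigenbasisD(2)[OF e] eigenbasisD(2)[OF e'], of k l] that by auto
  have fin: "finite ?S" by (rule finite_eigenvalue_fibre[OF e'])
  obtain N0 where N0: "?S \<subseteq> {..<N0}" using finite_nat_iff_bounded[of ?S] fin by blast
  define r where "r x = e k x - (\<Sum>l\<in>?S. ?c l * e' l x)" for x
  have "e k \<in> Lq_space 2 \<mu>" using e unfolding laplace_eigenbasis_def orthonormal_basis_L2_def by blast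
  then have lim: "(\<lambda>N. Lq_norm 2 \<mu> (\<lambda>x. e k x - (\<Sum>l<N. ?c l * e' l x))) \<longlonglongrightarrow> 0"
    using e' unfolding laplace_eigenbasis_def orthonormal_basis_L2_def by blast
  have eq: "(\<Sum>l<N. ?c l * e' l x) = (\<Sum>l\<in>?S. ?c l * e' l x)" if N: "N0 \<le> N" for N x
    by (rule sum.mono_neutral_right) (use N N0 c0 in auto)
  have "\<forall>\<^sub>F N in sequentially. Lq_norm 2 \<mu> (\<lambda>x. e k x - (\<Sum>l<N. ?c l * e' l x)) = Lq_norm 2 \<mu> r"
    using eventually_ge_at_top[of N0] by eventually_elim (simp only: eq r_def[abs_def])
  from tendsto_cong[OF this] lim have "(\<lambda>N::nat. Lq_norm 2 \<mu> r) \<longlonglongrightarrow> 0" by simp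
  then have "Lq_norm 2 \<mu> r = 0" by (simp add: LIMSEQ_const_iff)
  then have z: "(\<integral>x. \<bar>r x\<bar> powr 2 \<partial>\<mu>) = 0" by (simp add: Lq_norm_def)
  have contr: "continuous_on M r"
    unfolding r_def[abs_def] by (intro continuous_intros eigenbasisD(5)[OF e] eigenbasisD(5)[OF e'])
  then have "integrable \<mu> (\<lambda>x. (r x)\<^sup>2)" by (intro integrable_continuous continuous_intros)
  then have "AE x in \<mu>. (r x)\<^sup>2 = 0"
    using z by (subst integral_nonneg_eq_0_iff_AE[symmetric]) (auto simp: powr_numeral)
  then show "AE x in \<mu>. e k x = (\<Sum>l\<in>?S. ?c l * e' l x)"
    by (rule eventually_mono) (simp add: r_def)
qed

text \<open>The reproducing kernel of an eigenspace does not depend on its orthonormal basis, so the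
  two absolutely convergent series agree after grouping by eigenvalue.\<close>

lemma AE_wavelet_kernel_eq:
  assumes e: "eigenbasis lam e" and e': "eigenbasis lam' e'" and G: "schwartz_half_line G"
  shows "\<exists>X. (AE x in \<mu>. x \<in> X) \<and> (\<forall>x\<in>X. \<forall>y\<in>X. wavelet_kernel G lam e j x y = wavelet_kernel G lam' e' j x y)"
proof -
  \<comment> \<open>The wavelet coefficient depends on k through the eigenvalue alone; evaluating it
    on a constant sequence extracts that function, which is constant on each block.\<close>
  define h where "h a = wavelet_coeff G (\<lambda>_. a) j 0" for a
  have h: "wavelet_coeff G l j k = h (l k)" for l :: "nat \<Rightarrow> real" and k
    by (simp add: h_def wavelet_coeff_def)
  let ?c = "\<lambda>k l. \<integral>y. e k y * e' l y \<partial>\<mu>"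
  \<comment> \<open>Both expansions are recorded with the same coefficients ?c, for the two changes
    of basis are transposes of each other.\<close>
  define X where "X = {x. summable (\<lambda>k. \<bar>h (lam k)\<bar> * (e k x)\<^sup>2) \<and> summable (\<lambda>k. \<bar>h (lam' k)\<bar> * (e' k x)\<^sup>2)
      \<and> (\<forall>k. e k x = (\<Sum>l | lam' l = lam k. ?c k l * e' l x))
      \<and> (\<forall>l. e' l x = (\<Sum>k | lam k = lam' l. ?c k l * e k x))}"
  have "AE x in \<mu>. x \<in> X"
    using AE_summable_squares[OF e, of "\<lambda>k. h (lam k)"] AE_summable_squares[OF e', of "\<lambda>k. h (lam' k)"]
      summable_wavelet_coeff[OF e G, of j] summable_wavelet_coeff[OF e' G, of j]
      AE_change_of_eigenbasis[OF e e'] AE_change_of_eigenbasis[OF e' e]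
    unfolding h X_def by (auto simp: mult.commute[of "e' _ _"])
  moreover have "wavelet_kernel G lam e j x y = wavelet_kernel G lam' e' j x y" if x: "x \<in> X" and y: "y \<in> X" for x y
  proof -
    have sx: "summable (\<lambda>k. \<bar>h (lam k)\<bar> * (e k z)\<^sup>2)" "summable (\<lambda>k. \<bar>h (lam' k)\<bar> * (e' k z)\<^sup>2)"
      if "z \<in> X" for z using that unfolding X_def by blast+
    \<comment> \<open>Expand e k at x, exchange the two finite sums, and recognize the expansion of
      e' l at y. The orthogonality of the coefficient matrix is thus used in the guise of the two
      mutually inverse expansions.\<close>
    have block: "(\<Sum>k | lam k = a. h (lam k) * e k x * e k y) = (\<Sum>l | lam' l = a. h (lam' l) * e' l x * e' l y)" for a
    proof -
      have "(\<Sum>k | lam k = a. h (lam k) * e k x * e k y) = (\<Sum>k | lam k = a. h a * (\<Sum>l | lam' l = a. ?c k l * e' l x) * e k y)"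
      proof (intro sum.cong refl)
        fix k assume "k \<in> {k. lam k = a}"
        then have k: "lam k = a" by simp
        have "e k x = (\<Sum>l | lam' l = lam k. ?c k l * e' l x)" using x unfolding X_def by blast
        then show "h (lam k) * e k x * e k y = h a * (\<Sum>l | lam' l = a. ?c k l * e' l x) * e k y" unfolding k by simp
      qed
      also have "\<dots> = (\<Sum>k | lam k = a. \<Sum>l | lam' l = a. h a * e' l x * (?c k l * e k y))"
        by (simp add: sum_distrib_left sum_distrib_right ac_simps)
      also have "\<dots> = (\<Sum>l | lam' l = a. \<Sum>k | lam k = a. h a * e' l x * (?c k l * e k y))"
        by (rule sum.swap)
      also have "\<dots> = (\<Sum>l | lam' l = a. h (lam' l) * e' l x * e' l y)"
      proof (intro sum.cong refl)
        fix l assume "l \<in> {l. lam' l = a}"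
        then have l: "lam' l = a" by simp
        have "e' l y = (\<Sum>k | lam k = lam' l. ?c k l * e k y)" using y unfolding X_def by blast
        then show "(\<Sum>k | lam k = a. h a * e' l x * (?c k l * e k y)) = h (lam' l) * e' l x * e' l y"
          unfolding l by (simp only: sum_distrib_left)
      qed
      finally show ?thesis .
    qed
    have "wavelet_kernel G lam e j x y = (\<Sum>\<^sub>\<infinity>a. \<Sum>k | lam k = a. h (lam k) * e k x * e k y)"
      unfolding wavelet_kernel_def h
      by (intro suminf_eq_infsum_fibres summable_kernel finite_eigenvalue_fibre[OF e] sx x y)
    also have "\<dots> = (\<Sum>\<^sub>\<infinity>a. \<Sum>k | lam' k = a. h (lam' k) * e' k x * e' k y)" by (simp only: block)
    also have "\<dots> = wavelet_kernel G lam' e' j x y"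
      unfolding wavelet_kernel_def h
      by (intro suminf_eq_infsum_fibres[symmetric] summable_kernel finite_eigenvalue_fibre[OF e'] sx x y)
    finally show ?thesis .
  qed
  ultimately show ?thesis by blast
qed

section \<open>Equality almost everywhere through the layers\<close>

lemma measurable_wavelet_kernel:
  assumes "\<And>k. e k \<in> borel_measurable \<mu>"
  shows "(\<lambda>y. wavelet_kernel G lam e j x y) \<in> borel_measurable \<mu>"
    "(\<lambda>(x, y). wavelet_kernel G lam e j x y) \<in> borel_measurable (\<mu> \<Otimes>\<^sub>M \<mu>)"
  using assms unfolding wavelet_kernel_def by measurable

lemma measurable_scattering_step:
  assumes e: "\<And>k. e k \<in> borel_measurable \<mu>" and [measurable]: "f \<in> borel_measurable \<mu>"
  shows "scattering_step \<mu> G lam e j f \<in> borel_measurable \<mu>"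
proof -
  note [measurable] = measurable_wavelet_kernel(2)[OF e]
  show ?thesis unfolding scattering_step_def wavelet_conv_def by measurable
qed

text \<open>For a fixed x in the good set the two kernels agree for almost every y, so the two
  integrals agree at that x; the good set has full measure.\<close>

lemma AE_scattering_step_eq:
  assumes e: "eigenbasis lam e" and e': "eigenbasis lam' e'" and G: "schwartz_half_line G"
    and [measurable]: "f \<in> borel_measurable \<mu>" "f' \<in> borel_measurable \<mu>" and f: "AE x in \<mu>. f x = f' x"
  shows "AE x in \<mu>. scattering_step \<mu> G lam e j f x = scattering_step \<mu> G lam' e' j f' x"
proof -
  note [measurable] = measurable_wavelet_kernel(1)[OF eigenbasisD(6)[OF e]] measurable_wavelet_kernel(1)[OF eigenbasisD(6)[OF e']]
  obtain X where X: "AE x in \<mu>. x \<in> X"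
      "\<And>x y. x \<in> X \<Longrightarrow> y \<in> X \<Longrightarrow> wavelet_kernel G lam e j x y = wavelet_kernel G lam' e' j x y"
    using AE_wavelet_kernel_eq[OF e e' G, of j] by blast
  have "wavelet_conv \<mu> G lam e j f x = wavelet_conv \<mu> G lam' e' j f' x" if x: "x \<in> X" for x
    unfolding wavelet_conv_def
  proof (rule integral_cong_AE)
    show "AE y in \<mu>. wavelet_kernel G lam e j x y * f y = wavelet_kernel G lam' e' j x y * f' y"
      using X(1) f by eventually_elim (simp add: X(2)[OF x])
  qed simp_all
  then show ?thesis using X(1) unfolding scattering_step_def by (auto elim!: eventually_mono)
qed

lemma measurable_scattering_propagator:
  assumes "\<And>k. e k \<in> borel_measurable \<mu>" "f \<in> borel_measurable \<mu>"
  shows "scattering_propagator \<mu> G lam e js f \<in> borel_measurable \<mu>"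
  using assms(2) unfolding scattering_propagator_def
  by (induction js arbitrary: f) (simp_all add: measurable_scattering_step assms(1))

theorem nonwindowed_scattering_eigenbasis_independent:
  assumes e: "eigenbasis lam e" and e': "eigenbasis lam' e'" and G: "schwartz_half_line G"
    and f: "f \<in> borel_measurable \<mu>"
  shows "nonwindowed_scattering q \<mu> G lam e js f = nonwindowed_scattering q \<mu> G lam' e' js f"
proof -
  \<comment> \<open>The induction has to carry two functions that agree only almost everywhere, as
    the two propagators may already differ on a null set after one layer.\<close>
  have "AE x in \<mu>. fold (scattering_step \<mu> G lam e) js f x = fold (scattering_step \<mu> G lam' e') js f' x"
    if "f \<in> borel_measurable \<mu>" "f' \<in> borel_measurable \<mu>" "AE x in \<mu>. f x = f' x" for f f'
    using that
  proof (induction js arbitrary: f f')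
    case (Cons j js)
    show ?case
      using Cons.IH[OF measurable_scattering_step[OF eigenbasisD(6)[OF e] Cons.prems(1)]
          measurable_scattering_step[OF eigenbasisD(6)[OF e'] Cons.prems(2)]
          AE_scattering_step_eq[OF e e' G Cons.prems]] by simp
  qed simp
  from this[OF f f] have ae: "AE x in \<mu>. scattering_propagator \<mu> G lam e js f x = scattering_propagator \<mu> G lam' e' js f x"
    unfolding scattering_propagator_def by simp
  note [measurable] = measurable_scattering_propagator[OF eigenbasisD(6)[OF e] f]
    measurable_scattering_propagator[OF eigenbasisD(6)[OF e'] f]
  have "(\<integral>x. \<bar>scattering_propagator \<mu> G lam e js f x\<bar> powr q \<partial>\<mu>) = (\<integral>x. \<bar>scattering_propagator \<mu> G lam' e' js f x\<bar> powr q \<partial>\<mu>)"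
    by (rule integral_cong_AE) (use ae in \<open>auto elim!: eventually_mono\<close>)
  then show ?thesis by (simp add: nonwindowed_scattering_def Lq_norm_def)
qed

end

section \<open>Transport along an isometry\<close>

text \<open>Splitting off A \<inter> D leaves a set covered by the remaining members, so agreement
  inside each member propagates by induction. Riemannian volumes are prescribed inside charts only,
  whence this form.\<close>

lemma emeasure_eq_if_locally_eq:
  assumes s: "sets N = sets N'" and fin: "finite \<D>" and D: "\<And>D. D \<in> \<D> \<Longrightarrow> D \<in> sets N"
    and eq: "\<And>D A. D \<in> \<D> \<Longrightarrow> A \<in> sets N \<Longrightarrow> A \<subseteq> D \<Longrightarrow> emeasure N A = emeasure N' A"
    and A: "A \<in> sets N" "A \<subseteq> \<Union>\<D>"
  shows "emeasure N A = emeasure N' A"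
  using fin D eq A
proof (induction \<D> arbitrary: A rule: finite_induct)
  case (insert D \<D>)
  have D: "D \<in> sets N" using insert.prems by blast
  have "emeasure N A = emeasure N (A \<inter> D) + emeasure N (A - D)"
    using plus_emeasure[of "A \<inter> D" N "A - D"] D insert.prems(3) by (simp add: Int_Diff_Un Int_Diff_disjoint)
  also have "emeasure N (A \<inter> D) = emeasure N' (A \<inter> D)"
    by (rule insert.prems(2)[of D]) (use insert.prems(3) D in auto)
  also have "emeasure N (A - D) = emeasure N' (A - D)"
  proof (rule insert.IH)
    show "E \<in> sets N" if "E \<in> \<D>" for E using insert.prems(1) that by blast
    show "emeasure N B = emeasure N' B" if "E \<in> \<D>" "B \<in> sets N" "B \<subseteq> E" for E B
      using insert.prems(2)[of E B] that by blast
    show "A - D \<in> sets N" using insert.prems(3) D by blast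
    show "A - D \<subseteq> \<Union>\<D>" using insert.prems(4) by blast
  qed
  also have "emeasure N' (A \<inter> D) + emeasure N' (A - D) = emeasure N' A"
    using plus_emeasure[of "A \<inter> D" N' "A - D"] D insert.prems(3) s by (simp add: Int_Diff_Un Int_Diff_disjoint)
  finally show ?case .
qed simp

text \<open>The metric and the function are differentiated, so agreement is required on an open set
  around the point and not at the point alone.\<close>

lemma laplace_coord_cong:
  assumes "open S" "u \<in> S" "\<And>p. p \<in> S \<Longrightarrow> metric_matrix g V \<phi> p = metric_matrix g' V' \<phi>' p"
    and "\<And>p. p \<in> S \<Longrightarrow> F p = F' p"
  shows "laplace_coord g V \<phi> F u = laplace_coord g' V' \<phi>' F' u"
proof -
  have "partial_deriv i F p = partial_deriv i F' p" if "p \<in> S" for i p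
    unfolding partial_deriv_def using frechet_derivative_cong_open[OF assms(1) that assms(4)] by simp
  then have "frechet_derivative (\<lambda>v. sqrt (det (metric_matrix g V \<phi> v)) *
             (\<Sum>j\<in>UNIV. matrix_inv (metric_matrix g V \<phi> v) $ i $ j * partial_deriv j F v)) (at u)
      = frechet_derivative (\<lambda>v. sqrt (det (metric_matrix g' V' \<phi>' v)) *
             (\<Sum>j\<in>UNIV. matrix_inv (metric_matrix g' V' \<phi>' v) $ i $ j * partial_deriv j F' v)) (at u)" for i
    using assms(3) by (intro frechet_derivative_cong_open[OF assms(1,2)]) simp
  then show ?thesis using assms(2,3) unfolding laplace_coord_def by (simp add: partial_deriv_def)
qed

locale isometric_manifolds =
  N: riemannian_manifold n M g \<mu> + N': riemannian_manifold n M' g' \<mu>'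
  for n :: "'n::finite itself" and M :: "'a::euclidean_space set" and g \<mu>
    and M' :: "'b::euclidean_space set" and g' \<mu>' +
  fixes \<xi> :: "'a \<Rightarrow> 'b"
  assumes isometry: "riemannian_isometry n M g M' g' \<xi>"
begin

abbreviation \<eta> :: "'b \<Rightarrow> 'a" where "\<eta> \<equiv> inv_into M \<xi>"

lemma bij: "bij_betw \<xi> M M'"
  using isometry unfolding riemannian_isometry_def by blast

lemma \<xi>_in: "x \<in> M \<Longrightarrow> \<xi> x \<in> M'" and \<eta>_in: "y \<in> M' \<Longrightarrow> \<eta> y \<in> M"
  and \<eta>_\<xi>: "x \<in> M \<Longrightarrow> \<eta> (\<xi> x) = x" and \<xi>_\<eta>: "y \<in> M' \<Longrightarrow> \<xi> (\<eta> y) = y"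
  using bij_betwE[OF bij] bij_betwE[OF bij_betw_inv_into[OF bij]]
    bij_betw_inv_into_left[OF bij] bij_betw_inv_into_right[OF bij] by blast+

lemma continuous_\<xi>: "continuous_on M \<xi>"
proof (rule N.continuous_on_manifold)
  fix V \<phi> assume "N.chart V \<phi>"
  then have "smooth_on (\<phi> ` V) (\<xi> \<circ> chart_inv V \<phi>)"
    using isometry unfolding riemannian_isometry_def smooth_map_def by blast
  then show "continuous_on (\<phi> ` V) (\<xi> \<circ> chart_inv V \<phi>)" by (intro C1_on_continuous_on smooth_on_imp_C1_on)
qed

lemma continuous_\<eta>: "continuous_on M' \<eta>"
proof (rule N'.continuous_on_manifold)
  fix V \<phi> assume "N'.chart V \<phi>"
  then have "smooth_on (\<phi> ` V) (\<eta> \<circ> chart_inv V \<phi>)"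
    using isometry unfolding riemannian_isometry_def smooth_map_def by blast
  then show "continuous_on (\<phi> ` V) (\<eta> \<circ> chart_inv V \<phi>)" by (intro C1_on_continuous_on smooth_on_imp_C1_on)
qed

section \<open>Pushing charts forward along the isometry\<close>

context
  fixes V and \<phi> :: "'a \<Rightarrow> real^'n"
  assumes ch: "N.chart V \<phi>"
begin

lemma pushed_chart_image: "(\<phi> \<circ> \<eta>) ` \<xi> ` V = \<phi> ` V"
  using smooth_chartD(2)[OF ch] \<eta>_\<xi> by (force simp: image_image intro!: image_cong)

lemma pushed_chart_inj: "inj_on (\<phi> \<circ> \<eta>) (\<xi> ` V)"
proof (rule inj_onI)
  fix y z assume "y \<in> \<xi> ` V" "z \<in> \<xi> ` V" "(\<phi> \<circ> \<eta>) y = (\<phi> \<circ> \<eta>) z"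
  then obtain x x' where x: "x \<in> V" "y = \<xi> x" "x' \<in> V" "z = \<xi> x'" by blast
  moreover have "x \<in> M" "x' \<in> M" using x smooth_chartD(2)[OF ch] by auto
  ultimately have "\<phi> x = \<phi> x'" using \<open>(\<phi> \<circ> \<eta>) y = (\<phi> \<circ> \<eta>) z\<close> by (simp add: \<eta>_\<xi>)
  then show "y = z" using x smooth_chartD(6)[OF ch] by metis
qed

lemma pushed_chart_inv:
  assumes "u \<in> \<phi> ` V" shows "chart_inv (\<xi> ` V) (\<phi> \<circ> \<eta>) u = \<xi> (chart_inv V \<phi> u)"
proof (rule inv_into_f_eq[OF pushed_chart_inj])
  have "chart_inv V \<phi> u \<in> V" "chart_inv V \<phi> u \<in> M" using smooth_chartD(2,4)[OF ch] assms by blast+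
  then show "\<xi> (chart_inv V \<phi> u) \<in> \<xi> ` V" "(\<phi> \<circ> \<eta>) (\<xi> (chart_inv V \<phi> u)) = u"
    using smooth_chartD(5)[OF ch assms] by (auto simp: \<eta>_\<xi>)
qed

lemma pushed_chart_inv_derivative:
  assumes "u \<in> \<phi> ` V"
  shows "frechet_derivative (chart_inv (\<xi> ` V) (\<phi> \<circ> \<eta>)) (at u) = frechet_derivative (\<xi> \<circ> chart_inv V \<phi>) (at u)"
  by (rule frechet_derivative_cong_open[OF smooth_chartD(1)[OF ch] assms]) (simp add: pushed_chart_inv)

lemma pushed_metric:
  assumes "u \<in> \<phi> ` V"
  shows "g' (\<xi> (chart_inv V \<phi> u)) (frechet_derivative (\<xi> \<circ> chart_inv V \<phi>) (at u) a) (frechet_derivative (\<xi> \<circ> chart_inv V \<phi>) (at u) b)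
    = g (chart_inv V \<phi> u) (frechet_derivative (chart_inv V \<phi>) (at u) a) (frechet_derivative (chart_inv V \<phi>) (at u) b)"
  using isometry ch assms unfolding riemannian_isometry_def by blast

lemma pushed_metric_matrix:
  assumes "u \<in> \<phi> ` V" shows "metric_matrix g' (\<xi> ` V) (\<phi> \<circ> \<eta>) u = metric_matrix g V \<phi> u"
  unfolding metric_matrix_def pushed_chart_inv_derivative[OF assms] pushed_chart_inv[OF assms] pushed_metric[OF assms] ..

text \<open>The topological and smoothness conditions transfer through \<xi> and its inverse. The
  immersion property comes from the isometry: a direction killed by the differential of \<xi> in the
  chart would have length zero for g, contradicting positivity.\<close>

lemma pushed_chart: "N'.chart (\<xi> ` V) (\<phi> \<circ> \<eta>)"
proof -
  note c = smooth_chartD[OF ch]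
  let ?\<sigma> = "chart_inv V \<phi>" and ?\<sigma>' = "chart_inv (\<xi> ` V) (\<phi> \<circ> \<eta>)"
  have sm: "smooth_on (\<phi> ` V) (\<xi> \<circ> ?\<sigma>)"
    using isometry ch unfolding riemannian_isometry_def smooth_map_def by blast
  have sm': "smooth_on (\<phi> ` V) ?\<sigma>'"
    by (rule smooth_on_cong_open[OF c(1) _ sm]) (simp add: pushed_chart_inv)
  have VM': "\<xi> ` V \<subseteq> M'" using c(2) \<xi>_in by blast
  have "\<xi> ` V = M' \<inter> \<eta> -` V"
  proof
    show "\<xi> ` V \<subseteq> M' \<inter> \<eta> -` V" using VM' c(2) \<eta>_\<xi> by auto
    show "M' \<inter> \<eta> -` V \<subseteq> \<xi> ` V" using \<xi>_\<eta> by (metis IntE image_eqI subsetI vimageE)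
  qed
  then have op: "openin (top_of_set M') (\<xi> ` V)"
    using continuous_openin_preimage[OF continuous_\<eta> _ c(3)] \<eta>_in by auto
  have "homeomorphism (\<xi> ` V) (\<phi> ` V) (\<phi> \<circ> \<eta>) ?\<sigma>'"
  proof (rule homeomorphismI)
    have "\<eta> ` \<xi> ` V \<subseteq> V" using c(2) \<eta>_\<xi> by auto
    then show "continuous_on (\<xi> ` V) (\<phi> \<circ> \<eta>)"
      by (intro continuous_on_compose continuous_on_subset[OF continuous_\<eta> VM'] continuous_on_subset[OF c(7)])
    show "continuous_on (\<phi> ` V) ?\<sigma>'" by (intro C1_on_continuous_on smooth_on_imp_C1_on sm')
    show "(\<phi> \<circ> \<eta>) ` \<xi> ` V \<subseteq> \<phi> ` V" using pushed_chart_image by simp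
    show "?\<sigma>' ` \<phi> ` V \<subseteq> \<xi> ` V" using pushed_chart_inv c(4) by auto
    show "?\<sigma>' ((\<phi> \<circ> \<eta>) x) = x" if "x \<in> \<xi> ` V" for x
      using inv_into_f_f[OF pushed_chart_inj that] .
    show "(\<phi> \<circ> \<eta>) (?\<sigma>' u) = u" if "u \<in> \<phi> ` V" for u
      using f_inv_into_f[of u "\<phi> \<circ> \<eta>" "\<xi> ` V"] that pushed_chart_image by simp
  qed
  moreover have "inj (frechet_derivative ?\<sigma>' (at u))" if u: "u \<in> \<phi> ` V" for u
  proof -
    let ?D = "frechet_derivative (\<xi> \<circ> ?\<sigma>) (at u)"
    have l: "linear ?D"
      using C1_on_has_derivative[OF smooth_on_imp_C1_on[OF sm] u] has_derivative_linear by blast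
    have x: "\<xi> (?\<sigma> u) \<in> M'" using u c(2,4) \<xi>_in by blast
    obtain V\<^sub>0 \<phi>\<^sub>0 where ch0: "N'.chart V\<^sub>0 \<phi>\<^sub>0" "\<xi> (?\<sigma> u) \<in> V\<^sub>0" using N'.chart_at[OF x] .
    have u0: "\<phi>\<^sub>0 (\<xi> (?\<sigma> u)) \<in> \<phi>\<^sub>0 ` V\<^sub>0" using ch0(2) by blast
    \<comment> \<open>The form g' is bilinear on tangent vectors only, so
      \<open>g' _ 0 0 = 0\<close> becomes available once 0 is known to be tangent, here as the image
      of the zero direction in some chart.\<close>
    have "0 \<in> tangent_space M' (\<xi> (?\<sigma> u))"
      using tangent_spaceI[OF ch0(1) u0, of 0] linear_0[OF N'.chart_deriv_linear[OF ch0(1) u0]]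
        smooth_chartD(6)[OF ch0(1) ch0(2)] by simp
    from N'.metric_tangent(1)[OF x this this this, of 0 0] have g0: "g' (\<xi> (?\<sigma> u)) 0 0 = 0" by simp
    have "a = 0" if "?D a = 0" for a
    proof (rule ccontr)
      assume "a \<noteq> 0"
      from N.metric_matrix_pos[OF ch u this]
      have "0 < g (?\<sigma> u) (frechet_derivative ?\<sigma> (at u) a) (frechet_derivative ?\<sigma> (at u) a)"
        by (simp add: N.metric_matrix_inner[OF ch u])
      then show False using pushed_metric[OF u, of a a] that g0 by simp
    qed
    then have "inj ?D" using linear_injective_0[OF l] by blast
    then show ?thesis by (simp add: pushed_chart_inv_derivative[OF u])
  qed
  ultimately show ?thesis
    unfolding smooth_chart_def pushed_chart_image using op c(1) sm' by blast
qed

end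

section \<open>Transport of the volume, the Laplacian, eigenbases and the scattering
  transform\<close>

lemma measurable_\<xi>: "\<xi> \<in> measurable \<mu> \<mu>'"
proof -
  have "\<xi> \<in> measurable (restrict_space borel M) (restrict_space borel M')"
    using borel_measurable_continuous_on_restrict[OF continuous_\<xi>] \<xi>_in
    by (intro measurable_restrict_space2) (auto simp: space_restrict_space)
  then show ?thesis using measurable_cong_sets[OF N.sets_mu N'.sets_mu] by blast
qed

lemma measurable_\<eta>: "\<eta> \<in> measurable \<mu>' \<mu>"
proof -
  have "\<eta> \<in> measurable (restrict_space borel M') (restrict_space borel M)"
    using borel_measurable_continuous_on_restrict[OF continuous_\<eta>] \<eta>_in
    by (intro measurable_restrict_space2) (auto simp: space_restrict_space)
  then show ?thesis using measurable_cong_sets[OF N'.sets_mu N.sets_mu] by blast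
qed

text \<open>A chart and its pushforward have the same image and the same Gram matrix, so the volume
  formulas coincide inside each chart; finitely many charts cover M.\<close>

lemma distr_mu: "distr \<mu> \<mu>' \<xi> = \<mu>'"
proof (rule measure_eqI)
  fix A assume "A \<in> sets (distr \<mu> \<mu>' \<xi>)"
  then have A: "A \<in> sets \<mu>'" by simp
  have "\<exists>V. openin (top_of_set M) V \<and> x \<in> V \<and> (\<exists>\<phi>. N.chart V \<phi>)" if x: "x \<in> M" for x
  proof -
    obtain V \<phi> where "N.chart V \<phi>" "x \<in> V" using N.chart_at[OF x] .
    then show ?thesis using smooth_chartD(3) by blast
  qed
  then obtain \<D> where \<D>: "finite \<D>" "\<Union>\<D> = M"
      "\<And>V. V \<in> \<D> \<Longrightarrow> openin (top_of_set M) V \<and> (\<exists>\<phi>. N.chart V \<phi>)"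
    using N.finite_subcover[of "\<lambda>V. \<exists>\<phi>. N.chart V \<phi>"] by metis
  show "emeasure (distr \<mu> \<mu>' \<xi>) A = emeasure \<mu>' A"
  proof (rule emeasure_eq_if_locally_eq[of _ _ "(`) \<xi> ` \<D>"])
    fix D assume "D \<in> (`) \<xi> ` \<D>"
    then obtain V \<phi> where V: "D = \<xi> ` V" "N.chart V \<phi>" using \<D>(3) by blast
    note pc = pushed_chart[OF V(2)] and c = smooth_chartD[OF V(2)]
    show "D \<in> sets (distr \<mu> \<mu>' \<xi>)" using N'.openin_sets_mu[OF smooth_chartD(3)[OF pc]] V(1) by simp
    fix B assume B': "B \<in> sets (distr \<mu> \<mu>' \<xi>)" "B \<subseteq> D"
    then have B: "B \<in> sets \<mu>'" by simp
    have BM: "B \<subseteq> M'" using B'(2) V(1) c(2) \<xi>_in by blast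
    have pre: "\<xi> -` B \<inter> M = \<eta> ` B"
    proof
      show "\<xi> -` B \<inter> M \<subseteq> \<eta> ` B" using \<eta>_\<xi> by (metis IntE image_eqI subsetI vimageE)
      show "\<eta> ` B \<subseteq> \<xi> -` B \<inter> M" using BM \<xi>_\<eta> \<eta>_in by auto
    qed
    have "\<eta> ` B \<subseteq> V"
    proof
      fix z assume "z \<in> \<eta> ` B"
      then obtain x where "x \<in> V" "z = \<eta> (\<xi> x)" using B'(2) V(1) by blast
      then show "z \<in> V" using c(2) \<eta>_\<xi>[of x] by auto
    qed
    moreover have "\<xi> -` B \<inter> M \<in> sets \<mu>" using measurable_sets[OF measurable_\<xi> B] by (simp add: N.space_mu)
    ultimately have "emeasure \<mu> (\<xi> -` B \<inter> M) = (\<integral>\<^sup>+u\<in>\<phi> ` \<eta> ` B. ennreal (sqrt (det (metric_matrix g V \<phi> u))) \<partial>lborel)"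
      using N.volume V(2) unfolding riemannian_volume_def pre by blast
    also have "\<dots> = (\<integral>\<^sup>+u\<in>(\<phi> \<circ> \<eta>) ` B. ennreal (sqrt (det (metric_matrix g' (\<xi> ` V) (\<phi> \<circ> \<eta>) u))) \<partial>lborel)"
    proof (intro nn_integral_cong)
      fix u
      have "u \<in> \<phi> ` V" if "u \<in> \<phi> ` \<eta> ` B" using that \<open>\<eta> ` B \<subseteq> V\<close> by blast
      then show "ennreal (sqrt (det (metric_matrix g V \<phi> u))) * indicator (\<phi> ` \<eta> ` B) u
        = ennreal (sqrt (det (metric_matrix g' (\<xi> ` V) (\<phi> \<circ> \<eta>) u))) * indicator ((\<phi> \<circ> \<eta>) ` B) u"
        using pushed_metric_matrix[OF V(2), of u] by (auto simp: image_comp indicator_def)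
    qed
    also have "\<dots> = emeasure \<mu>' B"
      using N'.volume pc B B'(2) V(1) unfolding riemannian_volume_def by auto
    finally show "emeasure (distr \<mu> \<mu>' \<xi>) B = emeasure \<mu>' B"
      using emeasure_distr[OF measurable_\<xi> B] by (simp add: N.space_mu)
  next
    show "A \<subseteq> \<Union> ((`) \<xi> ` \<D>)"
    proof
      fix y assume "y \<in> A"
      then have "y \<in> M'" using sets.sets_into_space[OF A] by (auto simp: N'.space_mu)
      moreover have "M' = \<xi> ` M" using bij by (simp add: bij_betw_def)
      ultimately show "y \<in> \<Union> ((`) \<xi> ` \<D>)" using \<D>(2) by blast
    qed
  qed (use A \<D>(1) in auto)
qed simp

lemma integral_transport:
  fixes h :: "'b \<Rightarrow> real"
  assumes "h \<in> borel_measurable \<mu>'" shows "(\<integral>y. h y \<partial>\<mu>') = (\<integral>x. h (\<xi> x) \<partial>\<mu>)"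
  using integral_distr[OF measurable_\<xi> assms] unfolding distr_mu .

lemma integrable_transport:
  fixes h :: "'b \<Rightarrow> real"
  assumes "h \<in> borel_measurable \<mu>'" shows "integrable \<mu>' h \<longleftrightarrow> integrable \<mu> (\<lambda>x. h (\<xi> x))"
  using integrable_distr_eq[OF measurable_\<xi> assms] unfolding distr_mu .

lemma Lq_norm_transport:
  assumes [measurable]: "h \<in> borel_measurable \<mu>'" shows "Lq_norm q \<mu>' h = Lq_norm q \<mu> (\<lambda>x. h (\<xi> x))"
  unfolding Lq_norm_def by (subst integral_transport) simp_all

text \<open>In a chart and its pushforward both the metric and the function have the same coordinate
  expression, so the coordinate Laplacian returns the same value.\<close>

lemma has_laplacian_transport:
  assumes "has_laplacian n M' g' u h"
  shows "has_laplacian n M g (\<lambda>x. u (\<xi> x)) (\<lambda>x. h (\<xi> x))"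
  unfolding has_laplacian_def smooth_map_def
proof (intro conjI allI impI ballI)
  fix V \<phi> assume ch: "N.chart V \<phi>"
  note c = smooth_chartD[OF ch] and pc = pushed_chart[OF ch]
  let ?\<sigma> = "chart_inv V \<phi>" and ?\<sigma>' = "chart_inv (\<xi> ` V) (\<phi> \<circ> \<eta>)"
  have eq: "(u \<circ> ?\<sigma>') p = ((\<lambda>x. u (\<xi> x)) \<circ> ?\<sigma>) p" if "p \<in> \<phi> ` V" for p
    using pushed_chart_inv[OF ch that] by simp
  have "smooth_on (\<phi> ` V) (u \<circ> ?\<sigma>')"
    using assms pc unfolding has_laplacian_def smooth_map_def pushed_chart_image[OF ch, symmetric] by blast
  then show "smooth_on (\<phi> ` V) ((\<lambda>x. u (\<xi> x)) \<circ> ?\<sigma>)"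
    by (rule smooth_on_cong_open[OF c(1), rotated]) (rule eq)
  fix x assume x: "x \<in> V"
  then have xM: "x \<in> M" using c(2) by blast
  have "h (\<xi> x) = laplace_coord g' (\<xi> ` V) (\<phi> \<circ> \<eta>) (u \<circ> ?\<sigma>') ((\<phi> \<circ> \<eta>) (\<xi> x))"
    using assms pc x unfolding has_laplacian_def by blast
  also have "(\<phi> \<circ> \<eta>) (\<xi> x) = \<phi> x" by (simp add: \<eta>_\<xi>[OF xM])
  also have "laplace_coord g' (\<xi> ` V) (\<phi> \<circ> \<eta>) (u \<circ> ?\<sigma>') (\<phi> x) = laplace_coord g V \<phi> ((\<lambda>x. u (\<xi> x)) \<circ> ?\<sigma>) (\<phi> x)"
    by (rule laplace_coord_cong[OF c(1)]) (use x eq pushed_metric_matrix[OF ch] in auto)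
  finally show "h (\<xi> x) = laplace_coord g V \<phi> ((\<lambda>x. u (\<xi> x)) \<circ> ?\<sigma>) (\<phi> x)" .
qed

text \<open>Pulling back keeps the sequence of eigenvalues. It produces a second eigenbasis of M,
  which puts the comparison with the given one on a single manifold.\<close>

lemma eigenbasis_transport:
  assumes e: "N'.eigenbasis lam e"
  shows "N.eigenbasis lam (\<lambda>k x. e k (\<xi> x))"
proof -
  note E = N'.eigenbasisD[OF e] and [measurable] = N'.eigenbasisD(6)[OF e]
  have lap: "has_laplacian n M g (\<lambda>x. e k (\<xi> x)) (\<lambda>x. - lam k * e k (\<xi> x))" for k
    using has_laplacian_transport[OF E(2)[of k]] .
  have cont: "continuous_on M (\<lambda>x. e k (\<xi> x))" for k
    using N.C1_manifold_continuous[OF N.eigenfunction_C1[OF lap]] .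
  have "(\<lambda>x. e k (\<xi> x)) \<in> Lq_space 2 \<mu>" for k
    unfolding Lq_space_def using N.measurable_continuous[OF cont[of k]] cont[of k]
    by (auto intro!: N.integrable_continuous continuous_intros simp: powr_numeral)
  moreover have "(\<integral>x. e k (\<xi> x) * e l (\<xi> x) \<partial>\<mu>) = (if k = l then 1 else 0)" for k l
    using integral_transport[of "\<lambda>y. e k y * e l y"] E(3)[of k l] by simp
  moreover have "(\<lambda>N. Lq_norm 2 \<mu> (\<lambda>x. f x - (\<Sum>k<N. (\<integral>y. f y * e k (\<xi> y) \<partial>\<mu>) * e k (\<xi> x)))) \<longlonglongrightarrow> 0"
    if f: "f \<in> Lq_space 2 \<mu>" for f
  proof -
    \<comment> \<open>Completeness is tested on M' with f composed with the inverse isometry; norms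
      and coefficients then transport back to those of f.\<close>
    let ?f = "\<lambda>y. f (\<eta> y)"
    have [measurable]: "?f \<in> borel_measurable \<mu>'"
      using f measurable_compose[OF measurable_\<eta>] unfolding Lq_space_def by blast
    have "integrable \<mu> (\<lambda>x. \<bar>?f (\<xi> x)\<bar> powr 2) \<longleftrightarrow> integrable \<mu> (\<lambda>x. \<bar>f x\<bar> powr 2)"
      by (rule Bochner_Integration.integrable_cong) (auto simp: N.space_mu \<eta>_\<xi>)
    then have fL: "?f \<in> Lq_space 2 \<mu>'"
      using f integrable_transport[of "\<lambda>y. \<bar>?f y\<bar> powr 2"] unfolding Lq_space_def by simp
    have "\<forall>f\<in>Lq_space 2 \<mu>'. (\<lambda>N. Lq_norm 2 \<mu>' (\<lambda>x. f x - (\<Sum>k<N. (\<integral>y. f y * e k y \<partial>\<mu>') * e k x))) \<longlonglongrightarrow> 0"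
      using e unfolding laplace_eigenbasis_def orthonormal_basis_L2_def by blast
    from bspec[OF this fL]
    have lim: "(\<lambda>N. Lq_norm 2 \<mu>' (\<lambda>x. ?f x - (\<Sum>k<N. (\<integral>y. ?f y * e k y \<partial>\<mu>') * e k x))) \<longlonglongrightarrow> 0" .
    have coeff: "(\<integral>y. ?f y * e k y \<partial>\<mu>') = (\<integral>y. f y * e k (\<xi> y) \<partial>\<mu>)" for k
      by (subst integral_transport) (auto intro!: Bochner_Integration.integral_cong simp: N.space_mu \<eta>_\<xi>)
    have "Lq_norm 2 \<mu>' (\<lambda>x. ?f x - (\<Sum>k<N. (\<integral>y. ?f y * e k y \<partial>\<mu>') * e k x))
        = Lq_norm 2 \<mu> (\<lambda>x. f x - (\<Sum>k<N. (\<integral>y. f y * e k (\<xi> y) \<partial>\<mu>) * e k (\<xi> x)))" for N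
    proof -
      have "Lq_norm 2 \<mu>' (\<lambda>x. ?f x - (\<Sum>k<N. (\<integral>y. ?f y * e k y \<partial>\<mu>') * e k x))
        = Lq_norm 2 \<mu> (\<lambda>x. ?f (\<xi> x) - (\<Sum>k<N. (\<integral>y. ?f y * e k y \<partial>\<mu>') * e k (\<xi> x)))"
        by (rule Lq_norm_transport) simp
      also have "\<dots> = Lq_norm 2 \<mu> (\<lambda>x. f x - (\<Sum>k<N. (\<integral>y. f y * e k (\<xi> y) \<partial>\<mu>) * e k (\<xi> x)))"
        unfolding coeff Lq_norm_def
        by (intro arg_cong[where f = "\<lambda>t. t powr _"] Bochner_Integration.integral_cong refl) (simp add: N.space_mu \<eta>_\<xi>)
      finally show ?thesis .
    qed
    with lim show ?thesis by simp
  qed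
  ultimately show ?thesis
    using E(1) lap unfolding laplace_eigenbasis_def orthonormal_basis_L2_def by blast
qed

text \<open>A change of variables in every integral: at the points \<xi> x and \<xi> y the kernel on
  M' is by definition the kernel of the pulled-back functions. Hence the equality is pointwise on M
  at each layer, and only measurability of the functions is asked for.\<close>

lemma nonwindowed_scattering_transport:
  assumes e: "\<And>k. e k \<in> borel_measurable \<mu>'" and f: "f \<in> borel_measurable \<mu>"
  shows "nonwindowed_scattering q \<mu>' G lam e js (deform M \<xi> f)
    = nonwindowed_scattering q \<mu> G lam (\<lambda>k x. e k (\<xi> x)) js f"
proof -
  let ?e = "\<lambda>k x. e k (\<xi> x)"
  have step: "scattering_step \<mu>' G lam e j h (\<xi> x) = scattering_step \<mu> G lam ?e j f x"
    if [measurable]: "h \<in> borel_measurable \<mu>'" and h: "\<And>x. x \<in> M \<Longrightarrow> h (\<xi> x) = f x" for h f j x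
  proof -
    note [measurable] = N'.measurable_wavelet_kernel(1)[OF e]
    have "wavelet_conv \<mu>' G lam e j h (\<xi> x) = (\<integral>y. wavelet_kernel G lam e j (\<xi> x) (\<xi> y) * h (\<xi> y) \<partial>\<mu>)"
      unfolding wavelet_conv_def by (subst integral_transport) simp_all
    also have "\<dots> = wavelet_conv \<mu> G lam ?e j f x"
      unfolding wavelet_conv_def
      by (intro Bochner_Integration.integral_cong refl) (simp add: N.space_mu h wavelet_kernel_def)
    finally show ?thesis by (simp add: scattering_step_def)
  qed
  have propagator: "scattering_propagator \<mu>' G lam e js h (\<xi> x) = scattering_propagator \<mu> G lam ?e js f x"
    if "h \<in> borel_measurable \<mu>'" "\<And>x. x \<in> M \<Longrightarrow> h (\<xi> x) = f x" "x \<in> M" for h f x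
    using that unfolding scattering_propagator_def
  proof (induction js arbitrary: h f)
    case (Cons j js)
    show ?case
      using Cons.IH[OF N'.measurable_scattering_step[OF e Cons.prems(1)] step[OF Cons.prems(1,2)] Cons.prems(3)]
      by simp
  qed simp
  have d: "deform M \<xi> f \<in> borel_measurable \<mu>'"
    unfolding deform_def by (rule measurable_compose[OF measurable_\<eta> f])
  have deformed: "scattering_propagator \<mu>' G lam e js (deform M \<xi> f) (\<xi> x)
      = scattering_propagator \<mu> G lam ?e js f x" if "x \<in> M" for x
    by (rule propagator[OF d _ that]) (simp add: deform_def \<eta>_\<xi>)
  have "nonwindowed_scattering q \<mu>' G lam e js (deform M \<xi> f)
      = Lq_norm q \<mu> (\<lambda>x. scattering_propagator \<mu>' G lam e js (deform M \<xi> f) (\<xi> x))"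
    unfolding nonwindowed_scattering_def
    by (rule Lq_norm_transport[OF N'.measurable_scattering_propagator[OF e d]])
  also have "\<dots> = nonwindowed_scattering q \<mu> G lam ?e js f"
    unfolding nonwindowed_scattering_def Lq_norm_def
    by (intro arg_cong[where f = "\<lambda>t. t powr _"] Bochner_Integration.integral_cong refl)
      (simp add: N.space_mu deformed)
  finally show ?thesis .
qed

end

theorem theorem14:
  fixes M :: "'a::euclidean_space set" and M' :: "'b::euclidean_space set"
    and g :: "'a \<Rightarrow> 'a \<Rightarrow> 'a \<Rightarrow> real" and g' :: "'b \<Rightarrow> 'b \<Rightarrow> 'b \<Rightarrow> real"
    and \<mu> :: "'a measure" and \<mu>' :: "'b measure"
    and lam lam' :: "nat \<Rightarrow> real"
    and e :: "nat \<Rightarrow> 'a \<Rightarrow> real" and e' :: "nat \<Rightarrow> 'b \<Rightarrow> real"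
    and I :: nat and P V :: "nat \<Rightarrow> 'a set" and \<phi> :: "nat \<Rightarrow> 'a \<Rightarrow> real^'n"
    and \<delta> c\<^sub>1 c\<^sub>2 q :: real
    and \<xi> :: "'a \<Rightarrow> 'b" and f :: "'a \<Rightarrow> real" and f' :: "'b \<Rightarrow> real"
    and G :: "real \<Rightarrow> real" and m :: nat
  assumes "compact_riemannian_manifold TYPE('n) M g"
    and "compact_riemannian_manifold TYPE('n) M' g'"
    and "riemannian_volume TYPE('n) M g \<mu>"
    and "riemannian_volume TYPE('n) M' g' \<mu>'"
    and "laplace_eigenbasis TYPE('n) M g \<mu> lam e"
    and "laplace_eigenbasis TYPE('n) M' g' \<mu>' lam' e'"
    and "1 < q" and "q < 2"
    and "riemannian_isometry TYPE('n) M g M' g' \<xi>"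
    and "f \<in> Lq_space q \<mu>"
    and "schwartz_half_line G"
    and "\<forall>x\<ge>0. 0 \<le> G x"
    and "antimono_on {0..} G"
    and "continuous_on {0..} G"
    and "0 < G 0"
    and "(G \<longlongrightarrow> 0) at_top"
    and "covering_constants M g I P V \<phi> \<delta> c\<^sub>1 c\<^sub>2"
    and "c\<^sub>1 * c\<^sub>2 < 2"
    and "f' = deform M \<xi> f"
    and "1 \<le> m"
  shows "\<forall>js. length js = m \<longrightarrow>
    nonwindowed_scattering q \<mu>' G lam' e' js f' = nonwindowed_scattering q \<mu> G lam e js f"
proof -
  interpret isometric_manifolds "TYPE('n)" M g \<mu> M' g' \<mu>' \<xi>
    by unfold_locales (use assms(1-4,9) in simp_all)
  have f: "f \<in> borel_measurable \<mu>" using assms(10) unfolding Lq_space_def by blast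
  \<comment> \<open>The transport expresses the left-hand side on M through \<open>lam'\<close> and
    the pulled-back functions \<open>e'\<close>, which form an eigenbasis there; independence from
    the eigenbasis replaces them by \<open>lam\<close> and \<open>e\<close>.\<close>
  show ?thesis
    unfolding assms(19) nonwindowed_scattering_transport[OF N'.eigenbasisD(6)[OF assms(6)] f]
    using N.nonwindowed_scattering_eigenbasis_independent[OF eigenbasis_transport[OF assms(6)] assms(5,11) f]
    by simp
qed

end
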